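(* The graded vector space $\mathcal{A}=\bigoplus_{n\ge0}\mathcal{A}_n$ is closed under the star product $*$, and $(\mathcal{A},* )$ is a unital associative algebra. This algebra is commutative. Its Poincaré series is $$\sum_{n\ge 0} (\dim_{\mathbb{F}} \mathcal{A}_n)\, z^n=\prod_{m\ge 1}(1-z^m)^{-1}.$$
   Context: Let $q_1,q_2$ be independent indeterminates, $q_3=1/(q_1q_2)$, and $\mathbb{F}=\mathbb{Q}(q_1,q_2)$. For $n,k\in\mathbb{N}_+$ and a symmetric rational function $f$ in $x_1,\dots,x_n$ define $\partial^{(0,k)}f=\frac{n!}{(n-k)!}\lim_{\xi\to0}f(x_1,\dots,x_{n-k},\xi x_{n-k+1},\dots,\xi x_n)$ and $\partial^{(\infty,k)}f=\frac{n!}{(n-k)!}\lim_{\xi\to\infty}f(x_1,\dots,x_{n-k},\xi x_{n-k+1},\dots,\xi x_n)$ whenever the limits exist; set $\partial^{(0,k)}c=\partial^{(\infty,k)}c=0$ for $c\in\mathbb{F}$, and let $\partial^{(0,0)},\partial^{(\infty,0)}$ be the identity. The space $\mathcal{A}_n$ is defined by: (i) $\mathcal{A}_0=\mathbb{F}$; for $n\ge1$, elements of $\mathcal{A}_n$ are rational functions in $x_1,\dots,x_n$ with coefficients in $\mathbb{F}$, symmetric in the $x_i$; (ii) for $0\le k\le n$ and $f\in\mathcal{A}_n$, both limits $\partial^{(\infty,k)}f$ and $\partial^{(0,k)}f$ exist and are equal; (iii) the poles of $f$ lie only on the diagonal $\{x_i=x_j \text{ for some } i\ne j\}$ and have order at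 most two; (iv) for $n\ge3$, $f(x_1,q_1x_1,q_1q_2x_1,x_4,\dots)=0$ and $f(x_1,q_2x_1,q_1q_2x_1,x_4,\dots)=0$. Star product: for an $m$-variable symmetric rational function $f$ and an $n$-variable one $g$, $(f*g)(x_1,\dots,x_{m+n})=\operatorname{Sym}\big[f(x_1,\dots,x_m)g(x_{m+1},\dots,x_{m+n})\prod_{1\le\alpha\le m<\beta\le m+n}\omega(x_\alpha,x_\beta)\big]$, where $\omega(x,y)=\frac{(x-q_1y)(x-q_2y)(x-q_3y)}{(x-y)^3}$ and $\operatorname{Sym}F=\frac{1}{N!}\sum_{\sigma\in\mathfrak{S}_N}\sigma(F)$ (permuting the variables). *)

theory Defs
  imports
    "HOL-Library.Poly_Mapping"
    "HOL-Combinatorics.Permutations"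
    "HOL-Computational_Algebra.Computational_Algebra"
    "HOL-Algebra.Module"
    "HOL-Algebra.Algebraic_Closure_Type"
    "HOL-Analysis.Infinite_Products"
begin

section \<open>Coefficients and rational functions\<close>

text \<open>The field \<open>\<rat>(q\<^sub>1,q\<^sub>2)\<close> is the fraction field of \<open>\<rat>[q\<^sub>1][q\<^sub>2]\<close>.\<close>

type_synonym coef = "rat poly poly fract"

definition q1 :: coef where "q1 = to_fract [:[:0, 1:]:]"
definition q2 :: coef where "q2 = to_fract [:0, 1:]"
definition q3 :: coef where "q3 = 1 / (q1 * q2)"

text \<open>Polynomials over \<^typ>\<open>coef\<close> in countably many indeterminates, and their fraction field.
  The indeterminates are numbered from 0, so \<open>n\<close>-variable functions involve the indices
  \<open>0, \<dots>, n - 1\<close>.\<close>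

type_synonym mpol = "(nat \<Rightarrow>\<^sub>0 nat) \<Rightarrow>\<^sub>0 coef"
type_synonym ratf = "mpol fract"

definition const :: "coef \<Rightarrow> ratf" where
  "const c = to_fract (Poly_Mapping.single 0 c)"

definition xvar :: "nat \<Rightarrow> ratf" where
  "xvar i = to_fract (Poly_Mapping.single (Poly_Mapping.single i 1) 1)"

definition mpol_vars :: "mpol \<Rightarrow> nat set" where
  "mpol_vars P = (\<Union>m\<in>Poly_Mapping.keys P. Poly_Mapping.keys m)"

definition ratfuns :: "nat \<Rightarrow> ratf set" where
  "ratfuns n = {Fract P Q | P Q. Q \<noteq> 0 \<and> mpol_vars P \<subseteq> {..<n} \<and> mpol_vars Q \<subseteq> {..<n}}"

definition scale :: "coef \<Rightarrow> ratf \<Rightarrow> ratf" where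
  "scale c f = const c * f"

lemma const_add: "const (a + b) = const a + const b"
  by (simp add: const_def single_add)

lemma const_mult: "const (a * b) = const a * const b"
  by (simp add: const_def mult_single flip: to_fract_mult)

lemma const_1: "const 1 = 1"
  by (simp add: const_def)

global_interpretation ratf: vector_space scale
  by standard (simp_all add: scale_def const_add const_mult const_1 algebra_simps)

section \<open>Substitution\<close>

text \<open>The argument \<open>h\<close> embeds the coefficients into the target.\<close>

definition mpol_eval :: "(coef \<Rightarrow> 'b::comm_ring_1) \<Rightarrow> (nat \<Rightarrow> 'b) \<Rightarrow> mpol \<Rightarrow> 'b" where
  "mpol_eval h a P =
     (\<Sum>m\<in>Poly_Mapping.keys P. h (Poly_Mapping.lookup P m) *
        (\<Prod>i\<in>Poly_Mapping.keys m. a i ^ Poly_Mapping.lookup m i))"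

text \<open>\<open>f\<close> is defined at the point \<open>a\<close> (some denominator of \<open>f\<close> does not vanish there) and
  takes the value \<open>v\<close>.\<close>

definition has_value_at :: "(coef \<Rightarrow> 'b::field) \<Rightarrow> (nat \<Rightarrow> 'b) \<Rightarrow> ratf \<Rightarrow> 'b \<Rightarrow> bool" where
  "has_value_at h a f v \<longleftrightarrow>
     (\<exists>P Q. f = Fract P Q \<and> mpol_eval h a Q \<noteq> 0 \<and> v = mpol_eval h a P / mpol_eval h a Q)"

text \<open>\<open>f(x\<^bsub>s 0\<^esub>, x\<^bsub>s 1\<^esub>, \<dots>)\<close>; every \<open>f\<close> is defined at this point when \<open>s\<close> is injective.\<close>

definition rename :: "(nat \<Rightarrow> nat) \<Rightarrow> ratf \<Rightarrow> ratf" where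
  "rename s f = (THE g. has_value_at const (\<lambda>i. xvar (s i)) f g)"

definition symmetric :: "nat \<Rightarrow> ratf \<Rightarrow> bool" where
  "symmetric n f \<longleftrightarrow> (\<forall>s. s permutes {..<n} \<longrightarrow> rename s f = f)"

section \<open>The limit operators\<close>

text \<open>Rational functions in the extra indeterminate \<open>\<xi>\<close> are elements of \<^typ>\<open>ratf poly fract\<close>.
  Limits at \<open>0\<close> and \<open>\<infinity>\<close> are algebraic: the value at a point of the projective \<open>\<xi>\<close>-line where
  the function is regular.\<close>

definition lim_at_zero :: "ratf poly fract \<Rightarrow> ratf \<Rightarrow> bool" where
  "lim_at_zero F L \<longleftrightarrow>
     (\<exists>u v. F = Fract u v \<and> poly v 0 \<noteq> 0 \<and> L = poly u 0 / poly v 0)"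

definition lim_at_infty :: "ratf poly fract \<Rightarrow> ratf \<Rightarrow> bool" where
  "lim_at_infty F L \<longleftrightarrow>
     (\<exists>u v. F = Fract u v \<and> v \<noteq> 0 \<and> degree u \<le> degree v \<and>
            L = coeff u (degree v) / lead_coeff v)"

text \<open>\<open>F = f(x\<^sub>1, \<dots>, x\<^bsub>n-k\<^esub>, \<xi> x\<^bsub>n-k+1\<^esub>, \<dots>, \<xi> x\<^sub>n)\<close>\<close>

definition rescaled :: "nat \<Rightarrow> nat \<Rightarrow> ratf \<Rightarrow> ratf poly fract \<Rightarrow> bool" where
  "rescaled n k f F \<longleftrightarrow>
     has_value_at (\<lambda>c. to_fract [:const c:])
       (\<lambda>i. if n - k \<le> i \<and> i < n then to_fract [:0, xvar i:] else to_fract [:xvar i:]) f F"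

text \<open>\<open>\<partial>\<^sup>(\<^sup>0\<^sup>,\<^sup>k\<^sup>) f\<close>, respectively \<open>\<partial>\<^sup>(\<^sup>\<infinity>\<^sup>,\<^sup>k\<^sup>) f\<close>, of an \<open>n\<close>-variable function \<open>f\<close>
  exists and equals \<open>g\<close>.\<close>

definition partial_zero :: "nat \<Rightarrow> nat \<Rightarrow> ratf \<Rightarrow> ratf \<Rightarrow> bool" where
  "partial_zero n k f g \<longleftrightarrow>
     (if k = 0 then g = f
      else \<exists>F L. rescaled n k f F \<and> lim_at_zero F L \<and> g = of_nat (fact n) / of_nat (fact (n - k)) * L)"

definition partial_infty :: "nat \<Rightarrow> nat \<Rightarrow> ratf \<Rightarrow> ratf \<Rightarrow> bool" where
  "partial_infty n k f g \<longleftrightarrow>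
     (if k = 0 then g = f
      else \<exists>F L. rescaled n k f F \<and> lim_at_infty F L \<and> g = of_nat (fact n) / of_nat (fact (n - k)) * L)"

section \<open>The spaces \<open>\<A>\<^sub>n\<close>\<close>

text \<open>A rational function has poles only along the diagonals \<open>x\<^sub>i = x\<^sub>j\<close>, of order at most two,
  iff it can be written with a denominator that is a product of factors \<open>x\<^sub>i - x\<^sub>j\<close>, each to a
  power at most two.\<close>

definition diagonal_poles :: "nat \<Rightarrow> ratf \<Rightarrow> bool" where
  "diagonal_poles n f \<longleftrightarrow>
     (\<exists>P e. (\<forall>i j. e i j \<le> (2::nat)) \<and>
        f = to_fract P / (\<Prod>(i, j)\<in>{(i, j). i < j \<and> j < n}. (xvar i - xvar j) ^ e i j))"

text \<open>\<open>f(x\<^sub>1, a x\<^sub>1, b x\<^sub>1, x\<^sub>4, \<dots>) = 0\<close>\<close>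

definition vanishes_at_wheel :: "coef \<Rightarrow> coef \<Rightarrow> ratf \<Rightarrow> bool" where
  "vanishes_at_wheel a b f \<longleftrightarrow>
     has_value_at const
       (xvar(1 := const a * xvar 0, 2 := const b * xvar 0)) f 0"

definition A_space :: "nat \<Rightarrow> ratf set" where
  "A_space n =
     (if n = 0 then range const
      else {f \<in> ratfuns n.
             symmetric n f \<and>
             (\<forall>k\<le>n. \<exists>g. partial_infty n k f g \<and> partial_zero n k f g) \<and>
             diagonal_poles n f \<and>
             (n \<ge> 3 \<longrightarrow> vanishes_at_wheel q1 (q1 * q2) f \<and> vanishes_at_wheel q2 (q1 * q2) f)})"

section \<open>The star product and the graded algebra\<close>

definition omega :: "ratf \<Rightarrow> ratf \<Rightarrow> ratf" where
  "omega x y = (x - const q1 * y) * (x - const q2 * y) * (x - const q3 * y) / (x - y) ^ 3"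

definition Sym :: "nat \<Rightarrow> ratf \<Rightarrow> ratf" where
  "Sym N F = (\<Sum>s | s permutes {..<N}. rename s F) / of_nat (fact N)"

definition star :: "nat \<Rightarrow> nat \<Rightarrow> ratf \<Rightarrow> ratf \<Rightarrow> ratf" where
  "star m n f g =
     Sym (m + n) (f * rename (\<lambda>i. m + i) g *
       (\<Prod>\<alpha>\<in>{..<m}. \<Prod>\<beta>\<in>{m..<m + n}. omega (xvar \<alpha>) (xvar \<beta>)))"

text \<open>The direct sum consists of the finitely supported families \<open>(a\<^sub>n)\<close> with \<open>a\<^sub>n \<in> \<A>\<^sub>n\<close>; the
  star product is extended to it bilinearly.\<close>

definition A_algebra :: "(coef, nat \<Rightarrow> ratf) module" where
  "A_algebra =
     \<lparr> carrier = {a. finite {n. a n \<noteq> 0} \<and> (\<forall>n. a n \<in> A_space n)},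
       monoid.mult = (\<lambda>a b N. \<Sum>m\<le>N. star m (N - m) (a m) (b (N - m))),
       monoid.one = (\<lambda>n. if n = 0 then 1 else 0),
       ring.zero = (\<lambda>n. 0),
       ring.add = (\<lambda>a b n. a n + b n),
       module.smult = (\<lambda>c a n. scale c (a n)) \<rparr>"

end

theory Submission
  imports Defs
begin

text \<open>
  A symmetric rational function with poles on the diagonals is a function of finite sets of
  nonzero points, and up to a scalar the star product is
  \<open>(F * G)(V) = \<Sum>\<^bsub>S \<subseteq> V\<^esub> F(S) G(V - S) \<Prod>\<^bsub>x \<in> S, y \<notin> S\<^esub> \<omega>(x, y)\<close>.
  The operators \<open>\<Theta>\<^sub>p F(Z) = lim\<^bsub>\<xi> \<rightarrow> 0\<^esub> F({1, q\<^sub>1, \<dots>, q\<^sub>1\<^bsup>p-1\<^esup>} \<union> \<xi>Z)\<close> lower the degree by \<open>p\<close>. Since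
  \<open>\<omega>(q\<^sub>1 y, y) = 0\<close> and \<open>\<omega>\<close> tends to \<open>1\<close> at \<open>0\<close> and \<open>\<infinity>\<close>, they satisfy
  \<open>\<Theta>\<^sub>p(F * G) = \<Sum>\<^bsub>a+b=p\<^esub> \<gamma>(a, b) \<Theta>\<^sub>a F * \<Theta>\<^sub>b G\<close> with \<open>\<gamma>\<close> symmetric and nonzero. Counting zeros
  shows that an element of positive degree killed by all \<open>\<Theta>\<^sub>p\<close> with \<open>p \<ge> 1\<close> is zero, so
  commutativity follows by induction on the degree.

  Let \<open>B\<^sub>n\<^sub>,\<^sub>p\<close> be the elements of degree \<open>n\<close> killed by \<open>\<Theta>\<^sub>r\<close> for all \<open>r > p\<close>. The sequences
  \<open>0 \<rightarrow> B\<^sub>n\<^sub>,\<^sub>p\<^sub>-\<^sub>1 \<rightarrow> B\<^sub>n\<^sub>,\<^sub>p \<rightarrow> B\<^sub>n\<^sub>-\<^sub>p\<^sub>,\<^sub>p \<rightarrow> 0\<close> given by \<open>\<Theta>\<^sub>p\<close> are exact; surjectivity comes from products of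
  \<open>p\<close> generators \<open>e\<^sub>k(V) = \<Prod>\<^bsub>x \<noteq> y\<^esub> (x - q\<^sub>1 y)/(x - y)\<close>, for which \<open>\<Theta>\<^sub>1 e\<^sub>k\<close> is a multiple of
  \<open>e\<^sub>k\<^sub>-\<^sub>1\<close> and \<open>\<Theta>\<^sub>r e\<^sub>k = 0\<close> for \<open>r \<ge> 2\<close>. The dimensions therefore obey the recursion of
  \<open>\<Prod>\<^bsub>m \<le> p\<^esub> (1 - z\<^sup>m)\<^sup>-\<^sup>1\<close>.
\<close>

section \<open>Polynomial evaluation\<close>

text \<open>The obstacle is the equality of the limits at 0 and at infinity: \<open>Th p\<close>
  does not visibly preserve it, so an induction on the degree cannot carry it. All work is done in
  larger spaces \<open>Bsp n\<close>, where the limits only have to exist. The generators satisfy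
  the equality, products and linear combinations keep it, and once the products of generators span
  \<open>Bsp n\<close> it holds throughout.

  Strings use powers of \<open>q1\<close> because then \<open>om\<close> vanishes between neighbours
  in one order. Among all ways to divide a string between two factors only initial segments survive,
  which gives the product formula its shape.

  The count of zeros is exact. Beside a string of length p a free point has 2(p - 1) positions that
  complete a wheel and 2 that lengthen the string, while the numerator has room for 2p zeros in the
  scale per free point. The vanishing of the limit is the one further zero needed, provided longer
  strings are already excluded; hence the descent in p.\<close>

definition Cm :: "coef \<Rightarrow> mpol" where "Cm c = Poly_Mapping.single 0 c"
definition Xm :: "nat \<Rightarrow> mpol" where "Xm i = Poly_Mapping.single (Poly_Mapping.single i 1) 1"

definition mmon :: "(nat \<Rightarrow> 'b::comm_ring_1) \<Rightarrow> (nat \<Rightarrow>\<^sub>0 nat) \<Rightarrow> 'b" where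
  "mmon a m = (\<Prod>i\<in>Poly_Mapping.keys m. a i ^ Poly_Mapping.lookup m i)"

lemma mmon_superset:
  assumes "finite S" "Poly_Mapping.keys m \<subseteq> S"
  shows "mmon a m = (\<Prod>i\<in>S. a i ^ Poly_Mapping.lookup m i)"
  unfolding mmon_def
  by (rule prod.mono_neutral_left) (use assms in \<open>auto simp: in_keys_iff\<close>)

lemma mmon_0 [simp]: "mmon a 0 = 1"
  by (simp add: mmon_def)

lemma mmon_add: "mmon a (m + n) = mmon a m * mmon a n"
proof -
  let ?S = "Poly_Mapping.keys m \<union> Poly_Mapping.keys n"
  have "Poly_Mapping.keys (m + n) \<subseteq> ?S" by (rule Poly_Mapping.keys_add)
  then show ?thesis
    by (simp add: mmon_superset[where S = ?S] lookup_add power_add prod.distrib)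
qed

lemma mmon_single [simp]: "mmon a (Poly_Mapping.single i k) = a i ^ k"
  by (cases "k = 0") (simp_all add: mmon_def)

text \<open>Serves all targets of evaluation: coefficients, polynomials, rational functions, and
  polynomials and fractions in the scaling parameter \<xi>.\<close>

locale coef_hom =
  fixes h :: "coef \<Rightarrow> 'b::comm_ring_1"
  assumes h_1 [simp]: "h 1 = 1"
    and h_add [simp]: "h (x + y) = h x + h y"
    and h_mult [simp]: "h (x * y) = h x * h y"
begin

lemma h_0 [simp]: "h 0 = 0"
  using h_add[of 0 0] by simp

lemma h_minus [simp]: "h (- x) = - h x"
proof -
  have "h x + h (- x) = 0" using h_add[of x "- x"] by simp
  then show ?thesis by (simp add: eq_neg_iff_add_eq_0 add.commute)
qed

lemma h_eq_0_iff [simp]: "h x = 0 \<longleftrightarrow> x = 0"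
proof
  assume "h x = 0"
  show "x = 0"
  proof (rule ccontr)
    assume "x \<noteq> 0"
    then have "h x * h (1 / x) = 1" by (subst h_mult[symmetric]) simp
    then show False using \<open>h x = 0\<close> by simp
  qed
qed simp

lemma h_of_nat [simp]: "h (of_nat n) = of_nat n"
  by (induction n) simp_all

lemma eval_superset:
  assumes "finite S" "Poly_Mapping.keys P \<subseteq> S"
  shows "mpol_eval h a P = (\<Sum>m\<in>S. h (Poly_Mapping.lookup P m) * mmon a m)"
  unfolding mpol_eval_def mmon_def
  by (rule sum.mono_neutral_left) (use assms in \<open>auto simp: in_keys_iff\<close>)

lemma eval_alt: "mpol_eval h a P = (\<Sum>m\<in>Poly_Mapping.keys P. h (Poly_Mapping.lookup P m) * mmon a m)"
  by (rule eval_superset) simp_all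

lemma eval_0 [simp]: "mpol_eval h a 0 = 0"
  by (simp add: mpol_eval_def)

lemma eval_single [simp]: "mpol_eval h a (Poly_Mapping.single m c) = h c * mmon a m"
  by (subst eval_superset[where S = "{m}"]) auto

lemma eval_add [simp]: "mpol_eval h a (P + Q) = mpol_eval h a P + mpol_eval h a Q"
proof -
  let ?S = "Poly_Mapping.keys P \<union> Poly_Mapping.keys Q"
  have "Poly_Mapping.keys (P + Q) \<subseteq> ?S" by (rule Poly_Mapping.keys_add)
  then show ?thesis
    by (simp add: eval_superset[where S = ?S] lookup_add distrib_right sum.distrib)
qed

lemma eval_sum [simp]: "mpol_eval h a (\<Sum>i\<in>I. f i) = (\<Sum>i\<in>I. mpol_eval h a (f i))"
  by (induction I rule: infinite_finite_induct) simp_all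

end

lemma pm_expansion:
  "P = (\<Sum>m\<in>Poly_Mapping.keys P. Poly_Mapping.single m (Poly_Mapping.lookup P m))"
  by (rule poly_mapping_eqI) (simp add: lookup_sum lookup_single Poly_Mapping.when_def in_keys_iff)

lemma mpol_induct [case_names single add]:
  fixes P :: mpol
  assumes "\<And>m c. R (Poly_Mapping.single m c)" "\<And>P Q. R P \<Longrightarrow> R Q \<Longrightarrow> R (P + Q)"
  shows "R P"
proof -
  have "R (\<Sum>m\<in>S. Poly_Mapping.single m (Poly_Mapping.lookup P m))" if "finite S" for S
    using that
  proof (induction S)
    case empty
    show ?case using assms(1)[of 0 0] by simp
  qed (simp add: assms)
  then show ?thesis using pm_expansion[of P] by (metis finite_keys)
qed

context coef_hom begin

lemma eval_mult [simp]: "mpol_eval h a (P * Q) = mpol_eval h a P * mpol_eval h a Q"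
proof (induction P rule: mpol_induct)
  case (single m c)
  show ?case
    by (induction Q rule: mpol_induct)
      (simp_all add: mult_single mmon_add algebra_simps)
qed (simp add: algebra_simps)

lemma eval_1 [simp]: "mpol_eval h a 1 = 1"
  using eval_single[of a 0 1] by simp

lemma eval_uminus [simp]: "mpol_eval h a (- P) = - mpol_eval h a P"
proof -
  have "mpol_eval h a P + mpol_eval h a (- P) = 0" using eval_add[of a P "- P"] by simp
  then show ?thesis by (simp add: eq_neg_iff_add_eq_0 add.commute)
qed

lemma eval_diff [simp]: "mpol_eval h a (P - Q) = mpol_eval h a P - mpol_eval h a Q"
  using eval_add[of a P "- Q"] by simp

lemma eval_prod [simp]: "mpol_eval h a (\<Prod>i\<in>I. f i) = (\<Prod>i\<in>I. mpol_eval h a (f i))"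
  by (induction I rule: infinite_finite_induct) simp_all

lemma eval_power [simp]: "mpol_eval h a (P ^ k) = mpol_eval h a P ^ k"
  by (induction k) simp_all

lemma eval_Cm [simp]: "mpol_eval h a (Cm c) = h c"
  by (simp add: Cm_def)

lemma eval_Xm [simp]: "mpol_eval h a (Xm i) = a i"
  by (simp add: Xm_def)

lemma eval_cong:
  assumes "\<And>i. i \<in> mpol_vars P \<Longrightarrow> a i = b i"
  shows "mpol_eval h a P = mpol_eval h b P"
proof -
  have "mmon a m = mmon b m" if "m \<in> Poly_Mapping.keys P" for m
    unfolding mmon_def
  proof (rule prod.cong)
    fix i assume "i \<in> Poly_Mapping.keys m"
    then have "i \<in> mpol_vars P" using that by (auto simp: mpol_vars_def)
    then show "a i ^ Poly_Mapping.lookup m i = b i ^ Poly_Mapping.lookup m i" using assms by simp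
  qed simp
  then show ?thesis by (simp add: eval_alt)
qed

lemma eval_hom:
  fixes \<phi> :: "'b \<Rightarrow> 'c::comm_ring_1"
  assumes "\<phi> 1 = 1" "\<And>x y. \<phi> (x + y) = \<phi> x + \<phi> y" "\<And>x y. \<phi> (x * y) = \<phi> x * \<phi> y"
  shows "\<phi> (mpol_eval h a P) = mpol_eval (\<lambda>c. \<phi> (h c)) (\<lambda>i. \<phi> (a i)) P"
proof -
  interpret g: coef_hom "\<lambda>c. \<phi> (h c)" by standard (simp_all add: assms)
  have pw: "\<phi> (x ^ k) = \<phi> x ^ k" for x k by (induction k) (simp_all add: assms)
  have pr: "\<phi> (\<Prod>i\<in>I. f i) = (\<Prod>i\<in>I. \<phi> (f i))" for f and I :: "nat set"
    by (induction I rule: infinite_finite_induct) (simp_all add: assms)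
  show ?thesis
    by (induction P rule: mpol_induct) (simp_all add: assms mmon_def pw pr)
qed

text \<open>A factor theorem in several variables: products of congruent factors stay congruent,
  hence so do monomials. With \<open>d\<close> a difference of two variables it later cancels a
  pole.\<close>

lemma eval_dvd_diff:
  assumes "\<And>i. d dvd a i - b i"
  shows "d dvd mpol_eval h a P - mpol_eval h b P"
proof (induction P rule: mpol_induct)
  case (single m c)
  have pd: "d dvd x * y - x' * y'" if "d dvd x - x'" "d dvd y - y'" for x y x' y' :: 'b
  proof -
    have "x * y - x' * y' = (x - x') * y + x' * (y - y')" by (simp add: algebra_simps)
    then show ?thesis using that by (simp add: dvd_add)
  qed
  have pw: "d dvd x ^ k - x' ^ k" if "d dvd x - x'" for x x' k
    by (induction k) (use that pd in auto)
  have "d dvd (\<Prod>i\<in>I. f i) - (\<Prod>i\<in>I. g i)" if "\<And>i. d dvd f i - g i" for f g and I :: "nat set"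
    by (induction I rule: infinite_finite_induct) (use that pd in auto)
  then have "d dvd mmon a m - mmon b m" using pw assms by (simp add: mmon_def)
  then show ?case by (simp flip: right_diff_distrib)
next
  case (add P Q)
  then show ?case using dvd_add[OF add] by (simp add: algebra_simps)
qed

end

interpretation id: coef_hom id by standard simp_all
interpretation const: coef_hom const by standard (simp_all add: const_add const_mult const_1)
interpretation Cm: coef_hom Cm by standard (simp_all add: Cm_def single_add mult_single)
interpretation constp: coef_hom "\<lambda>c. [:const c:]" by standard (simp_all add: const_add const_mult)
interpretation constpf: coef_hom "\<lambda>c. to_fract [:const c:]"
  by standard (simp_all add: const_add const_mult const_1 flip: to_fract_add to_fract_mult one_pCons)
interpretation cpol: coef_hom "\<lambda>c. [:c:]" by standard simp_all

abbreviation ev :: "mpol \<Rightarrow> (nat \<Rightarrow> coef) \<Rightarrow> coef" where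
  "ev P a \<equiv> mpol_eval id a P"

lemma mpol_eval_ident [simp]: "mpol_eval (\<lambda>c. c) = mpol_eval id"
  by (simp add: id_def)

text \<open>Evaluation with \<open>Cm\<close> is substitution of polynomials into a polynomial;
  values after a substitution reduce to values at a new point.\<close>

lemma eval_compose:
  assumes "coef_hom h"
  shows "mpol_eval h b (mpol_eval Cm A P) = mpol_eval h (\<lambda>i. mpol_eval h b (A i)) P"
proof -
  interpret h: coef_hom h by fact
  show ?thesis
    by (subst Cm.eval_hom[where \<phi> = "mpol_eval h b"]) simp_all
qed

lemma to_fract_Cm: "to_fract (Cm c) = const c"
  by (simp add: const_def Cm_def)

lemma to_fract_Xm: "to_fract (Xm i) = xvar i"
  by (simp add: xvar_def Xm_def)

lemma to_fract_eval: "to_fract (mpol_eval Cm A P) = mpol_eval const (\<lambda>i. to_fract (A i)) P"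
  by (subst Cm.eval_hom[where \<phi> = to_fract]) (simp_all add: to_fract_Cm)

lemma mpol_eval_Cm_Xm: "mpol_eval Cm Xm P = P"
proof -
  have step: "Poly_Mapping.single i (Suc k) = Poly_Mapping.single i 1 + Poly_Mapping.single i k" for i k :: nat
    using single_add[of i 1 k] by simp
  have pw: "Xm i ^ k = Poly_Mapping.single (Poly_Mapping.single i k) 1" for i k
  proof (induction k)
    case (Suc k)
    then show ?case by (simp only: power_Suc Suc Xm_def step mult_single mult_1)
  qed simp
  have *: "(\<Prod>i\<in>I. Poly_Mapping.single (f i) (1::coef)) = Poly_Mapping.single (\<Sum>i\<in>I. f i) 1"
    if "finite I" for I and f :: "nat \<Rightarrow> nat \<Rightarrow>\<^sub>0 nat"
    using that by induction (simp_all add: mult_single)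
  have "mmon Xm m = Poly_Mapping.single m 1" for m
  proof -
    have "mmon Xm m = Poly_Mapping.single (\<Sum>i\<in>Poly_Mapping.keys m. Poly_Mapping.single i (Poly_Mapping.lookup m i)) 1"
      unfolding mmon_def pw by (rule *) simp
    then show ?thesis by (simp only: pm_expansion[symmetric])
  qed
  then show ?thesis
    by (induction P rule: mpol_induct) (simp_all add: mult_single Cm_def)
qed

lemma eval_xvar: "mpol_eval const xvar P = to_fract P"
  using to_fract_eval[of Xm P] by (simp add: mpol_eval_Cm_Xm to_fract_Xm)

section \<open>Polynomials are determined by their values\<close>

lemma digit_sum_less:
  fixes f :: "nat \<Rightarrow> nat"
  assumes "\<And>i. i < n \<Longrightarrow> f i < N"
  shows "(\<Sum>i<n. f i * N ^ i) < N ^ n"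
  using assms
proof (induction n)
  case (Suc n)
  have "(\<Sum>i<Suc n. f i * N ^ i) < N ^ n + f n * N ^ n" using Suc by simp
  also have "\<dots> = (f n + 1) * N ^ n" by simp
  also have "\<dots> \<le> N * N ^ n" using Suc.prems[of n] by (intro mult_right_mono) auto
  finally show ?case by simp
qed simp

lemma digit_sum_inj:
  fixes f g :: "nat \<Rightarrow> nat"
  assumes "\<And>i. i < n \<Longrightarrow> f i < N" "\<And>i. i < n \<Longrightarrow> g i < N"
    and "(\<Sum>i<n. f i * N ^ i) = (\<Sum>i<n. g i * N ^ i)"
  shows "\<forall>i<n. f i = g i"
  using assms
proof (induction n)
  case (Suc n)
  let ?F = "\<Sum>i<n. f i * N ^ i" and ?G = "\<Sum>i<n. g i * N ^ i"
  have F: "?F < N ^ n" and G: "?G < N ^ n" using Suc.prems by (auto intro!: digit_sum_less)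
  have eq: "?F + f n * N ^ n = ?G + g n * N ^ n" using Suc.prems(3) by simp
  have pos: "N ^ n \<noteq> 0" using F by (metis not_less_zero)
  have "f n = (?F + f n * N ^ n) div N ^ n" using F by (simp only: div_mult_self1[OF pos] div_less)
  also have "\<dots> = g n" unfolding eq using G by (simp only: div_mult_self1[OF pos] div_less)
  finally have fg: "f n = g n" .
  have "\<forall>i<n. f i = g i"
    by (rule Suc.IH) (use eq fg in \<open>simp_all only: add_right_cancel\<close>, simp_all add: Suc.prems(1,2))
  with fg show ?case by (metis less_Suc_eq)
qed simp

text \<open>Kronecker's substitution \<open>x\<^sub>i = t^(N^i)\<close> separates the monomials of \<open>P\<close>, and for
  \<open>t \<ge> 2\<close> its values are distinct positive integers.\<close>

lemma mpol_nonzero_value: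
  assumes "P \<noteq> 0"
  obtains b :: "nat \<Rightarrow> nat" where "inj b" "\<And>i. b i > 0" "ev P (\<lambda>i. of_nat (b i)) \<noteq> 0"
proof -
  define V where "V = mpol_vars P"
  have finV: "finite V" by (simp add: V_def mpol_vars_def)
  then obtain n where n: "V \<subseteq> {..<n}"
    by (metis finite_nat_iff_bounded)
  \<comment> \<open>The base exceeds every exponent of \<open>P\<close>; the summand 2 keeps the
    powers \<open>N ^ i\<close> distinct even for constant \<open>P\<close>.\<close>
  define N where "N = 2 + (\<Sum>m\<in>Poly_Mapping.keys P. \<Sum>i<n. Poly_Mapping.lookup m i)"
  have less: "Poly_Mapping.lookup m i < N" if "m \<in> Poly_Mapping.keys P" "i < n" for m i
  proof -
    have "Poly_Mapping.lookup m i \<le> (\<Sum>i<n. Poly_Mapping.lookup m i)"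
      using that by (intro member_le_sum) auto
    also have "\<dots> \<le> (\<Sum>m\<in>Poly_Mapping.keys P. \<Sum>i<n. Poly_Mapping.lookup m i)"
      by (rule member_le_sum[OF that(1)]) auto
    finally show ?thesis by (simp add: N_def)
  qed
  define w where "w m = (\<Sum>i<n. Poly_Mapping.lookup m i * N ^ i)" for m
  have keysub: "Poly_Mapping.keys m \<subseteq> {..<n}" if "m \<in> Poly_Mapping.keys P" for m
    using that n by (auto simp: V_def mpol_vars_def)
  have inj: "inj_on w (Poly_Mapping.keys P)"
  proof (rule inj_onI)
    fix m m' assume m: "m \<in> Poly_Mapping.keys P" "m' \<in> Poly_Mapping.keys P" and eq: "w m = w m'"
    have lt: "\<forall>i<n. Poly_Mapping.lookup m i = Poly_Mapping.lookup m' i"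
      using eq less m unfolding w_def by (intro digit_sum_inj) auto
    show "m = m'"
    proof (rule poly_mapping_eqI)
      fix i
      show "Poly_Mapping.lookup m i = Poly_Mapping.lookup m' i"
      proof (cases "i < n")
        case False
        then have "i \<notin> Poly_Mapping.keys m" "i \<notin> Poly_Mapping.keys m'" using keysub m by auto
        then show ?thesis by (simp add: in_keys_iff)
      qed (use lt in simp)
    qed
  qed
  define p where "p = (\<Sum>m\<in>Poly_Mapping.keys P. monom (Poly_Mapping.lookup P m) (w m))"
  have ev: "ev P (\<lambda>i. t ^ N ^ i) = poly p t" for t
  proof -
    have "mmon (\<lambda>i. t ^ N ^ i) m = t ^ w m" if "m \<in> Poly_Mapping.keys P" for m
      unfolding w_def using keysub[OF that]
      by (simp add: mmon_superset[where S = "{..<n}"] power_sum mult.commute flip: power_mult)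
    then show ?thesis
      by (simp add: id.eval_alt p_def poly_sum poly_monom)
  qed
  from assms obtain m0 where m0: "m0 \<in> Poly_Mapping.keys P" by (metis ex_in_conv keys_eq_empty)
  have "coeff p (w m0) = (\<Sum>m\<in>Poly_Mapping.keys P. if m = m0 then Poly_Mapping.lookup P m else 0)"
    unfolding p_def coeff_sum using inj m0 by (intro sum.cong) (auto simp: inj_on_def)
  also have "\<dots> = Poly_Mapping.lookup P m0" using m0 by simp
  finally have "p \<noteq> 0" using m0 by (auto simp: in_keys_iff)
  then have "finite {t. poly p t = 0}" by (rule poly_roots_finite)
  then have "finite ((of_nat :: nat \<Rightarrow> coef) -` {t. poly p t = 0})"
    by (rule finite_vimageI) (simp add: inj_on_def)
  then obtain t0 where t0: "\<And>t. t \<ge> t0 \<Longrightarrow> t \<notin> (of_nat :: nat \<Rightarrow> coef) -` {t. poly p t = 0}"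
    by (metis finite_nat_set_iff_bounded not_le)
  \<comment> \<open>Beyond the natural zeros of \<open>p\<close>, and at least 2 so that distinct
    exponents give distinct points.\<close>
  define t where "t = t0 + 2"
  have "poly p (of_nat t) \<noteq> 0" using t0[of t] by (simp add: t_def)
  then have 1: "ev P (\<lambda>i. of_nat (t ^ N ^ i)) \<noteq> 0" by (simp add: ev)
  have 2: "inj (\<lambda>i. t ^ N ^ i)"
  proof (rule injI)
    fix i j assume "t ^ N ^ i = t ^ N ^ j"
    then have "N ^ i = N ^ j" by (rule power_inject_exp[THEN iffD1, rotated]) (simp add: t_def)
    then show "i = j" by (rule power_inject_exp[THEN iffD1, rotated]) (simp add: N_def)
  qed
  show ?thesis by (rule that[OF 2 _ 1]) (simp add: t_def)
qed

text \<open>Exactly the points whose first \<open>n\<close> coordinates enumerate a set of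
  \<open>n\<close> nonzero elements, so no diagonal denominator vanishes there.\<close>

definition generic :: "nat \<Rightarrow> (nat \<Rightarrow> 'b::zero) \<Rightarrow> bool" where
  "generic n a \<longleftrightarrow> inj_on a {..<n} \<and> (\<forall>i<n. a i \<noteq> 0)"

lemma generic_of_nat:
  assumes "inj b" "\<And>i. b i > (0::nat)"
  shows "generic n (\<lambda>i. of_nat (b i) :: coef)"
  using assms by (auto simp: generic_def inj_on_def less_imp_neq)

lemma mpol_eq_0I:
  assumes "\<And>a. generic n a \<Longrightarrow> ev P a = 0"
  shows "P = 0"
  using assms generic_of_nat mpol_nonzero_value by metis

lemma mpol_eqI:
  assumes "\<And>a. generic n a \<Longrightarrow> ev P a = ev Q a"
  shows "P = Q"
  using mpol_eq_0I[of n "P - Q"] assms by simp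

definition pfilter :: "((nat \<Rightarrow>\<^sub>0 nat) \<Rightarrow> bool) \<Rightarrow> mpol \<Rightarrow> mpol" where
  "pfilter \<phi> P = (\<Sum>m | m \<in> Poly_Mapping.keys P \<and> \<phi> m. Poly_Mapping.single m (Poly_Mapping.lookup P m))"

lemma lookup_pfilter: "Poly_Mapping.lookup (pfilter \<phi> P) m = (if \<phi> m then Poly_Mapping.lookup P m else 0)"
  by (auto simp: pfilter_def lookup_sum lookup_single Poly_Mapping.when_def in_keys_iff)

lemma keys_pfilter: "Poly_Mapping.keys (pfilter \<phi> P) = {m \<in> Poly_Mapping.keys P. \<phi> m}"
  by (auto simp: in_keys_iff lookup_pfilter split: if_splits)

lemma pfilter_add: "pfilter \<phi> (P + Q) = pfilter \<phi> P + pfilter \<phi> Q"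
  by (rule poly_mapping_eqI) (simp add: lookup_pfilter lookup_add)

lemma pfilter_single: "pfilter \<phi> (Poly_Mapping.single m c) = (if \<phi> m then Poly_Mapping.single m c else 0)"
  by (rule poly_mapping_eqI) (auto simp: lookup_pfilter lookup_single Poly_Mapping.when_def)

text \<open>Dropping the monomials that involve a variable from \<open>n\<close> on amounts to
  setting these variables to 0. By hypothesis this changes no value at a generic point, so nothing
  was dropped.\<close>

lemma mpol_varsI:
  assumes "\<And>a b. generic n a \<Longrightarrow> (\<And>i. i < n \<Longrightarrow> a i = b i) \<Longrightarrow> ev P a = ev P b"
  shows "mpol_vars P \<subseteq> {..<n}"
proof -
  let ?\<phi> = "\<lambda>m. Poly_Mapping.keys m \<subseteq> {..<n}"
  have *: "ev (pfilter ?\<phi> P) a = ev P (\<lambda>i. if i < n then a i else 0)" for a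
  proof (induction P rule: mpol_induct)
    case (single m c)
    have "mmon (\<lambda>i. if i < n then a i else 0) m = (if ?\<phi> m then mmon a m else 0)"
      by (auto simp: mmon_def in_keys_iff intro!: prod.cong)
    then show ?case by (simp add: pfilter_single)
  qed (simp add: pfilter_add)
  have "pfilter ?\<phi> P = P"
    by (rule mpol_eqI[of n], unfold *) (rule sym, rule assms, simp_all)
  then show ?thesis using keys_pfilter[of ?\<phi> P] by (auto simp: mpol_vars_def)
qed

section \<open>Rescaling a set of variables\<close>

definition wt :: "nat set \<Rightarrow> (nat \<Rightarrow>\<^sub>0 nat) \<Rightarrow> nat" where
  "wt S m = (\<Sum>i\<in>S. Poly_Mapping.lookup m i)"

text \<open>The homogeneous component of degree \<open>j\<close> in the variables of
  \<open>S\<close>.\<close>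

definition part :: "nat set \<Rightarrow> nat \<Rightarrow> mpol \<Rightarrow> mpol" where
  "part S j P = pfilter (\<lambda>m. wt S m = j) P"

text \<open>The indeterminate of \<^typ>\<open>'b poly\<close> is the scaling parameter \<open>\<xi>\<close>.\<close>

definition resc :: "nat set \<Rightarrow> (nat \<Rightarrow> 'b::comm_ring_1) \<Rightarrow> nat \<Rightarrow> 'b poly" where
  "resc S A i = (if i \<in> S then [:0, A i:] else [:A i:])"

lemma poly_resc: "poly (resc S A i) x = (if i \<in> S then x * A i else A i)"
  by (simp add: resc_def)

lemma mmon_resc:
  assumes "finite S"
  shows "mmon (resc S A) m = monom (mmon A m) (wt S m)"
proof -
  let ?T = "Poly_Mapping.keys m \<union> S"
  have pm: "(\<Prod>i\<in>T. monom (f i) (g i)) = monom (\<Prod>i\<in>T. f i) (\<Sum>i\<in>T. g i)"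
    if "finite T" for T and f :: "nat \<Rightarrow> 'a" and g
    using that by induction (simp_all add: mult_monom)
  have "resc S A i ^ e = monom (A i ^ e) (if i \<in> S then e else 0)" for i e
  proof -
    have "[:0, A i:] = monom (A i) 1" "[:A i:] = monom (A i) 0" by (simp_all add: monom_Suc monom_0)
    then show ?thesis by (simp add: resc_def monom_power)
  qed
  then have "mmon (resc S A) m = (\<Prod>i\<in>?T. monom (A i ^ Poly_Mapping.lookup m i)
      (if i \<in> S then Poly_Mapping.lookup m i else 0))"
    using assms by (simp add: mmon_superset[where S = ?T])
  also have "\<dots> = monom (mmon A m) (wt S m)"
    using assms by (simp add: pm mmon_superset[where S = ?T] wt_def sum.If_cases Int_absorb1)
  finally show ?thesis .
qed

context coef_hom begin

lemma coef_hom_pCons: "coef_hom (\<lambda>c. [:h c:])"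
  by standard simp_all

lemma poly_eval: "poly (mpol_eval (\<lambda>c. [:h c:]) A P) x = mpol_eval h (\<lambda>i. poly (A i) x) P"
proof -
  interpret p: coef_hom "\<lambda>c. [:h c:]" by (rule coef_hom_pCons)
  show ?thesis by (subst p.eval_hom[where \<phi> = "\<lambda>p. poly p x"]) simp_all
qed

text \<open>Rescaling multiplies a monomial by \<xi> to its weight in \<open>S\<close>, so powers of
  \<xi> sort the monomials by weight. Statements on limits become statements on weights through this
  identity.\<close>

lemma coeff_eval_resc:
  assumes "finite S"
  shows "coeff (mpol_eval (\<lambda>c. [:h c:]) (resc S A) P) j = mpol_eval h A (part S j P)"
proof -
  interpret p: coef_hom "\<lambda>c. [:h c:]" by (rule coef_hom_pCons)
  show ?thesis
    by (induction P rule: mpol_induct)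
      (auto simp: part_def pfilter_add pfilter_single mmon_resc assms)
qed

end

lemma part_0_iff: "part S j P = 0 \<longleftrightarrow> (\<forall>m\<in>Poly_Mapping.keys P. wt S m \<noteq> j)"
  using keys_pfilter[of "\<lambda>m. wt S m = j" P] by (auto simp: part_def simp flip: keys_eq_empty)

section \<open>Independence of the parameters\<close>

lemma to_fract_power: "to_fract (x ^ k) = to_fract x ^ k"
  by (induction k) simp_all

lemma q_monomial: "of_nat r * q1 ^ a * q2 ^ b = to_fract (monom (monom (of_nat r) a) b)"
proof -
  have r: "of_nat r = (to_fract (of_nat r) :: coef)" by (induction r) simp_all
  have "of_nat r * [:[:0, 1:]:] ^ a * [:0, 1:] ^ b = monom (monom (of_nat r :: rat) a) b"
    by (simp add: monom_altdef poly_const_pow of_nat_poly)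
  then show ?thesis unfolding q1_def q2_def r by (simp flip: to_fract_power to_fract_mult)
qed

lemma q1_nz [simp]: "q1 \<noteq> 0" and q2_nz [simp]: "q2 \<noteq> 0" and q3_nz [simp]: "q3 \<noteq> 0"
  and q123: "q1 * q2 * q3 = 1"
  by (simp_all add: q1_def q2_def q3_def)

definition qm :: "int \<Rightarrow> int \<Rightarrow> coef" where
  "qm i j = q1 powi i * q2 powi j"

lemma qm_nz [simp]: "qm i j \<noteq> 0"
  by (simp add: qm_def)

lemma qm_mult: "qm i j * qm i' j' = qm (i + i') (j + j')"
  by (simp add: qm_def power_int_add)

lemma qm_00 [simp]: "qm 0 0 = 1"
  by (simp add: qm_def)

text \<open>A common factor \<open>qm N M\<close> makes all exponents nonnegative, and then
  monomials of the polynomial ring are compared. The integer factors are there because free points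
  will be positive integers, to be told apart from powers of the parameters.\<close>

lemma qm_independent:
  assumes eq: "of_nat r * qm i j = of_nat r' * qm i' j'" and pos: "r > 0" "r' > 0"
  shows "r = r' \<and> i = i' \<and> j = j'"
proof -
  define N M where "N = \<bar>i\<bar> + \<bar>i'\<bar>" and "M = \<bar>j\<bar> + \<bar>j'\<bar>"
  have nat: "of_nat r * qm i j * qm N M = to_fract (monom (monom (of_nat r) (nat (i + N))) (nat (j + M)))"
    if "i + N \<ge> 0" "j + M \<ge> 0" for r i j
    using that unfolding q_monomial[symmetric] mult.assoc qm_mult by (simp add: qm_def power_int_def)
  have "of_nat r * qm i j * qm N M = of_nat r' * qm i' j' * qm N M" using eq by simp
  then have "monom (monom (of_nat r :: rat) (nat (i + N))) (nat (j + M)) =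
      monom (monom (of_nat r') (nat (i' + N))) (nat (j' + M))"
    by (subst (asm) (1 2) nat) (simp_all add: N_def M_def)
  then have "r = r'" "nat (i + N) = nat (i' + N)" "nat (j + M) = nat (j' + M)"
    using pos by (auto simp: monom_eq_iff')
  moreover have "0 \<le> i + N" "0 \<le> i' + N" "0 \<le> j + M" "0 \<le> j' + M"
    by (auto simp: N_def M_def abs_if)
  ultimately show ?thesis by (simp add: eq_nat_nat_iff)
qed

lemma q1_power_inj: "q1 ^ i = q1 ^ j \<longleftrightarrow> i = j"
  using qm_independent[of 1 "int i" 0 1 "int j" 0] by (auto simp: qm_def)

section \<open>Limits of rational functions of one variable\<close>

text \<open>For functions that agree with a rational function off a finite set. The exceptions
  absorb the scale 0 and the scales at which two points of a configuration collide.\<close>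

definition lim0 :: "(coef \<Rightarrow> coef) \<Rightarrow> coef \<Rightarrow> bool" where
  "lim0 \<phi> L \<longleftrightarrow> (\<exists>u v. poly v 0 \<noteq> 0 \<and> L = poly u 0 / poly v 0 \<and>
     finite {x. \<phi> x \<noteq> poly u x / poly v x})"

lemma lim0_cong:
  assumes "finite {x. \<phi> x \<noteq> \<psi> x}" "lim0 \<psi> L"
  shows "lim0 \<phi> L"
proof -
  obtain u v where uv: "poly v 0 \<noteq> 0" "L = poly u 0 / poly v 0" "finite {x. \<psi> x \<noteq> poly u x / poly v x}"
    using assms(2) by (auto simp: lim0_def)
  have "finite {x. \<phi> x \<noteq> poly u x / poly v x}"
    by (rule finite_subset[OF _ finite_UnI[OF assms(1) uv(3)]]) auto
  then show ?thesis using uv unfolding lim0_def by blast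
qed

lemma lim0_poly_quot: "poly v 0 \<noteq> 0 \<Longrightarrow> lim0 (\<lambda>x. poly u x / poly v x) (poly u 0 / poly v 0)"
  unfolding lim0_def by (intro exI[of _ u] exI[of _ v]) auto

lemma poly_eqI_cofinite:
  fixes p q :: "coef poly"
  assumes "finite {x. poly p x \<noteq> poly q x}"
  shows "p = q"
proof (rule ccontr)
  assume "p \<noteq> q"
  then have "finite {x. poly (p - q) x = 0}" by (intro poly_roots_finite) simp
  then have "finite ({x. poly p x \<noteq> poly q x} \<union> {x. poly (p - q) x = 0})" using assms by simp
  moreover have "{x. poly p x \<noteq> poly q x} \<union> {x. poly (p - q) x = 0} = (UNIV :: coef set)" by auto
  ultimately show False using infinite_UNIV_char_0 by metis
qed

lemma finite_poly_zeros: "poly v 0 \<noteq> 0 \<Longrightarrow> finite {x. poly v (x::coef) = 0}"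
  by (rule poly_roots_finite) auto

lemma lim0_unique:
  assumes "lim0 \<phi> L" "lim0 \<phi> M"
  shows "L = M"
proof -
  obtain u v where uv: "poly v 0 \<noteq> 0" "L = poly u 0 / poly v 0" "finite {x. \<phi> x \<noteq> poly u x / poly v x}"
    using assms(1) by (auto simp: lim0_def)
  obtain s t where st: "poly t 0 \<noteq> 0" "M = poly s 0 / poly t 0" "finite {x. \<phi> x \<noteq> poly s x / poly t x}"
    using assms(2) by (auto simp: lim0_def)
  let ?B = "{x. poly v x = 0} \<union> {x. poly t x = 0} \<union> {x. \<phi> x \<noteq> poly u x / poly v x} \<union> {x. \<phi> x \<noteq> poly s x / poly t x}"
  have "{x. poly (u * t) x \<noteq> poly (s * v) x} \<subseteq> ?B"
    by (auto simp: field_simps)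
  moreover have "finite ?B" using uv st by (auto intro: finite_poly_zeros)
  ultimately have "u * t = s * v" by (intro poly_eqI_cofinite) (rule finite_subset)
  then have "poly u 0 * poly t 0 = poly s 0 * poly v 0" by (metis poly_mult)
  then show ?thesis using uv st by (simp add: frac_eq_eq)
qed

lemma lim0_const: "lim0 (\<lambda>x. c) c"
  using lim0_poly_quot[of 1 "[:c:]"] by simp

lemma lim0_ident: "lim0 (\<lambda>x. x) 0"
  using lim0_poly_quot[of 1 "[:0, 1:]"] by simp

lemma lim0_add:
  assumes "lim0 \<phi> L" "lim0 \<psi> M"
  shows "lim0 (\<lambda>x. \<phi> x + \<psi> x) (L + M)"
proof -
  obtain u v where uv: "poly v 0 \<noteq> 0" "L = poly u 0 / poly v 0" "finite {x. \<phi> x \<noteq> poly u x / poly v x}"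
    using assms(1) by (auto simp: lim0_def)
  obtain s t where st: "poly t 0 \<noteq> 0" "M = poly s 0 / poly t 0" "finite {x. \<psi> x \<noteq> poly s x / poly t x}"
    using assms(2) by (auto simp: lim0_def)
  let ?B = "{x. poly v x = 0} \<union> {x. poly t x = 0} \<union> {x. \<phi> x \<noteq> poly u x / poly v x} \<union> {x. \<psi> x \<noteq> poly s x / poly t x}"
  have "{x. \<phi> x + \<psi> x \<noteq> poly (u * t + s * v) x / poly (v * t) x} \<subseteq> ?B"
    by (auto simp: add_frac_eq)
  moreover have "finite ?B" using uv st by (auto intro: finite_poly_zeros)
  ultimately have "finite {x. \<phi> x + \<psi> x \<noteq> poly (u * t + s * v) x / poly (v * t) x}"
    by (rule finite_subset)
  moreover have "L + M = poly (u * t + s * v) 0 / poly (v * t) 0" using uv st by (simp add: add_frac_eq)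
  ultimately show ?thesis unfolding lim0_def using uv(1) st(1)
    by (intro exI[of _ "u * t + s * v"] exI[of _ "v * t"]) simp
qed

lemma lim0_mult:
  assumes "lim0 \<phi> L" "lim0 \<psi> M"
  shows "lim0 (\<lambda>x. \<phi> x * \<psi> x) (L * M)"
proof -
  obtain u v where uv: "poly v 0 \<noteq> 0" "L = poly u 0 / poly v 0" "finite {x. \<phi> x \<noteq> poly u x / poly v x}"
    using assms(1) by (auto simp: lim0_def)
  obtain s t where st: "poly t 0 \<noteq> 0" "M = poly s 0 / poly t 0" "finite {x. \<psi> x \<noteq> poly s x / poly t x}"
    using assms(2) by (auto simp: lim0_def)
  have "{x. \<phi> x * \<psi> x \<noteq> poly (u * s) x / poly (v * t) x} \<subseteq>
      {x. \<phi> x \<noteq> poly u x / poly v x} \<union> {x. \<psi> x \<noteq> poly s x / poly t x}" by auto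
  then have "finite {x. \<phi> x * \<psi> x \<noteq> poly (u * s) x / poly (v * t) x}"
    by (rule finite_subset) (use uv st in simp)
  then show ?thesis unfolding lim0_def using uv st
    by (intro exI[of _ "u * s"] exI[of _ "v * t"]) simp
qed

lemma lim0_inverse:
  assumes "lim0 \<phi> L" "L \<noteq> 0"
  shows "lim0 (\<lambda>x. inverse (\<phi> x)) (inverse L)"
proof -
  obtain u v where uv: "poly v 0 \<noteq> 0" "L = poly u 0 / poly v 0" "finite {x. \<phi> x \<noteq> poly u x / poly v x}"
    using assms(1) by (auto simp: lim0_def)
  have "finite {x. inverse (\<phi> x) \<noteq> poly v x / poly u x}"
    by (rule finite_subset[OF _ uv(3)]) auto
  then show ?thesis unfolding lim0_def using uv assms(2)
    by (intro exI[of _ v] exI[of _ u]) auto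
qed

lemma lim0_divide:
  "lim0 \<phi> L \<Longrightarrow> lim0 \<psi> M \<Longrightarrow> M \<noteq> 0 \<Longrightarrow> lim0 (\<lambda>x. \<phi> x / \<psi> x) (L / M)"
  unfolding divide_inverse by (intro lim0_mult lim0_inverse)

lemma lim0_diff: "lim0 \<phi> L \<Longrightarrow> lim0 \<psi> M \<Longrightarrow> lim0 (\<lambda>x. \<phi> x - \<psi> x) (L - M)"
  using lim0_add[of \<phi> L "\<lambda>x. (-1) * \<psi> x" "(-1) * M"] lim0_mult[OF lim0_const, of \<psi> M "-1"] by simp

lemma lim0_power: "lim0 \<phi> L \<Longrightarrow> lim0 (\<lambda>x. \<phi> x ^ k) (L ^ k)"
  by (induction k) (simp_all add: lim0_const lim0_mult)

lemma lim0_sum: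
  "(\<And>i. i \<in> I \<Longrightarrow> lim0 (\<phi> i) (L i)) \<Longrightarrow> lim0 (\<lambda>x. \<Sum>i\<in>I. \<phi> i x) (\<Sum>i\<in>I. L i)"
  by (induction I rule: infinite_finite_induct) (simp_all add: lim0_const lim0_add)

lemma lim0_prod:
  "(\<And>i. i \<in> I \<Longrightarrow> lim0 (\<phi> i) (L i)) \<Longrightarrow> lim0 (\<lambda>x. \<Prod>i\<in>I. \<phi> i x) (\<Prod>i\<in>I. L i)"
  by (induction I rule: infinite_finite_induct) (simp_all add: lim0_const lim0_mult)

lemma lim0_scale:
  assumes "lim0 \<phi> L" "c \<noteq> 0"
  shows "lim0 (\<lambda>x. \<phi> (c * x)) L"
proof -
  obtain u v where uv: "poly v 0 \<noteq> 0" "L = poly u 0 / poly v 0" "finite {x. \<phi> x \<noteq> poly u x / poly v x}"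
    using assms(1) by (auto simp: lim0_def)
  have "finite ((\<lambda>x. c * x) -` {x. \<phi> x \<noteq> poly u x / poly v x})"
    using uv(3) by (rule finite_vimageI) (simp add: inj_on_def assms)
  then have "finite {x. \<phi> (c * x) \<noteq> poly (pcompose u [:0, c:]) x / poly (pcompose v [:0, c:]) x}"
    by (simp add: vimage_def poly_pcompose mult.commute)
  then show ?thesis unfolding lim0_def using uv
    by (intro exI[of _ "pcompose u [:0, c:]"] exI[of _ "pcompose v [:0, c:]"]) (simp add: poly_pcompose)
qed

section \<open>Functions of finite sets of points\<close>

definition om :: "coef \<Rightarrow> coef \<Rightarrow> coef" where
  "om x y = (x - q1 * y) * (x - q2 * y) * (x - q3 * y) / (x - y) ^ 3"

definition Om :: "coef set \<Rightarrow> coef set \<Rightarrow> coef" where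
  "Om S T = (\<Prod>x\<in>S. \<Prod>y\<in>T. om x y)"

text \<open>The star product without its factor \<open>m! n! / (m + n)!\<close>. The degrees of \<open>F\<close> and \<open>G\<close> do not
  occur, because a function of degree \<open>n\<close> is zero on sets that do not have \<open>n\<close> elements.\<close>

definition conv :: "(coef set \<Rightarrow> coef) \<Rightarrow> (coef set \<Rightarrow> coef) \<Rightarrow> coef set \<Rightarrow> coef" where
  "conv F G V = (\<Sum>S\<in>Pow V. F S * G (V - S) * Om S (V - S))"

definition supp :: "nat \<Rightarrow> (coef set \<Rightarrow> coef) \<Rightarrow> bool" where
  "supp n F \<longleftrightarrow> (\<forall>V. F V \<noteq> 0 \<longrightarrow> finite V \<and> card V = n \<and> 0 \<notin> V)"

definition wheel :: "(coef set \<Rightarrow> coef) \<Rightarrow> bool" where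
  "wheel F \<longleftrightarrow> (\<forall>V x. x \<in> V \<and> (q1 * x \<in> V \<or> q2 * x \<in> V) \<and> q1 * q2 * x \<in> V \<longrightarrow> F V = 0)"

definition homog :: "(coef set \<Rightarrow> coef) \<Rightarrow> bool" where
  "homog F \<longleftrightarrow> (\<forall>V c. c \<noteq> 0 \<longrightarrow> F ((*) c ` V) = F V)"

definition has_lims :: "(coef set \<Rightarrow> coef) \<Rightarrow> bool" where
  "has_lims F \<longleftrightarrow> (\<forall>Y Z. \<exists>L. lim0 (\<lambda>x. F (Y \<union> (*) x ` Z)) L)"

text \<open>The coefficient of \<open>\<partial>\<^sup>(\<^sup>0\<^sup>,\<^sup>k\<^sup>)\<close> and, with the arguments exchanged and \<open>F\<close> homogeneous, of
  \<open>\<partial>\<^sup>(\<^sup>\<infinity>\<^sup>,\<^sup>k\<^sup>)\<close>; it is unspecified if the limit does not exist.\<close>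

definition delta :: "(coef set \<Rightarrow> coef) \<Rightarrow> coef set \<Rightarrow> coef set \<Rightarrow> coef" where
  "delta F Y Z = (THE L. lim0 (\<lambda>x. F (Y \<union> (*) x ` Z)) L)"

lemma delta_eqI: "lim0 (\<lambda>x. F (Y \<union> (*) x ` Z)) L \<Longrightarrow> delta F Y Z = L"
  unfolding delta_def using lim0_unique by blast

lemma lim0_delta: "has_lims F \<Longrightarrow> lim0 (\<lambda>x. F (Y \<union> (*) x ` Z)) (delta F Y Z)"
  unfolding has_lims_def using delta_eqI by metis

lemma om_zero: "x = q1 * y \<or> x = q2 * y \<or> x = q3 * y \<Longrightarrow> om x y = 0"
  by (auto simp: om_def)

lemma om_scale: "c \<noteq> 0 \<Longrightarrow> om (c * x) (c * y) = om x y"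
proof -
  assume c: "c \<noteq> 0"
  have "c * x - q * (c * y) = c * (x - q * y)" "c * x - c * y = c * (x - y)" for q
    by (simp_all add: algebra_simps)
  then show ?thesis using c
    by (simp add: om_def power_mult_distrib power3_eq_cube mult.assoc)
qed

lemma om_lim_right: "s \<noteq> 0 \<Longrightarrow> lim0 (\<lambda>x. om s (x * z)) 1"
proof -
  assume s: "s \<noteq> 0"
  have "lim0 (\<lambda>x. om s (x * z)) ((s - q1 * (0 * z)) * (s - q2 * (0 * z)) * (s - q3 * (0 * z)) / (s - 0 * z) ^ 3)"
    unfolding om_def
    by (intro lim0_divide lim0_mult lim0_diff lim0_const lim0_ident lim0_power) (use s in auto)
  then show ?thesis using s by (simp add: power3_eq_cube)
qed

text \<open>The second terms of the linear factors remain, and they multiply to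
  \<open>q1 * q2 * q3\<close> times the limit of the denominator; this is where the choice of
  \<open>q3\<close> enters.\<close>

lemma om_lim_left: "s \<noteq> 0 \<Longrightarrow> lim0 (\<lambda>x. om (x * z) s) 1"
proof -
  assume s: "s \<noteq> 0"
  have "lim0 (\<lambda>x. om (x * z) s) ((0 * z - q1 * s) * (0 * z - q2 * s) * (0 * z - q3 * s) / (0 * z - s) ^ 3)"
    unfolding om_def
    by (intro lim0_divide lim0_mult lim0_diff lim0_const lim0_ident lim0_power) (use s in auto)
  moreover have "(0 * z - q1 * s) * (0 * z - q2 * s) * (0 * z - q3 * s) = (q1 * q2 * q3) * (0 * z - s) ^ 3"
    by (simp add: power3_eq_cube algebra_simps)
  ultimately show ?thesis using s by (simp add: q123)
qed

lemma Om_Un_left: "finite S \<Longrightarrow> finite S' \<Longrightarrow> S \<inter> S' = {} \<Longrightarrow> Om (S \<union> S') T = Om S T * Om S' T"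
  by (simp add: Om_def prod.union_disjoint)

lemma Om_Un_right: "finite T \<Longrightarrow> finite T' \<Longrightarrow> T \<inter> T' = {} \<Longrightarrow> Om S (T \<union> T') = Om S T * Om S T'"
  by (simp add: Om_def prod.union_disjoint prod.distrib)

lemma Om_scale:
  assumes "c \<noteq> 0"
  shows "Om ((*) c ` S) ((*) c ` T) = Om S T"
proof -
  have "inj_on ((*) c) A" for A using assms by (auto simp: inj_on_def)
  then show ?thesis using assms by (simp add: Om_def prod.reindex om_scale)
qed

lemma Om_zero: "finite S \<Longrightarrow> finite T \<Longrightarrow> x \<in> S \<Longrightarrow> y \<in> T \<Longrightarrow> om x y = 0 \<Longrightarrow> Om S T = 0"
  by (auto simp: Om_def)

lemma Om_empty [simp]: "Om {} T = 1" "Om S {} = 1"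
  by (simp_all add: Om_def)

text \<open>Both sides sum over the ordered divisions of \<open>V\<close> into three disjoint sets,
  because \<open>Om\<close> is multiplicative in each argument.\<close>

lemma conv_assoc: "conv (conv F G) H = conv F (conv G H)"
proof
  fix V
  show "conv (conv F G) H V = conv F (conv G H) V"
  proof (cases "finite V")
    case fin: True
    have fs: "finite S" if "S \<subseteq> V" for S using that fin finite_subset by blast
    have "conv (conv F G) H V =
        (\<Sum>T\<in>Pow V. \<Sum>S\<in>Pow T. F S * G (T - S) * H (V - T) * Om S (T - S) * Om S (V - T) * Om (T - S) (V - T))"
      unfolding conv_def sum_distrib_right
    proof (intro sum.cong refl)
      fix T S assume "T \<in> Pow V" "S \<in> Pow T"
      then have "Om T (V - T) = Om S (V - T) * Om (T - S) (V - T)"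
        using fs Om_Un_left[of S "T - S" "V - T"] by (simp add: Un_absorb1)
      then show "F S * G (T - S) * Om S (T - S) * H (V - T) * Om T (V - T) =
          F S * G (T - S) * H (V - T) * Om S (T - S) * Om S (V - T) * Om (T - S) (V - T)" by simp
    qed
    also have "\<dots> = (\<Sum>(T, S)\<in>(SIGMA T:Pow V. Pow T).
        F S * G (T - S) * H (V - T) * Om S (T - S) * Om S (V - T) * Om (T - S) (V - T))"
      by (rule sum.Sigma) (use fin fs in auto)
    also have "\<dots> = (\<Sum>(S, U)\<in>(SIGMA S:Pow V. Pow (V - S)).
        F S * G U * H (V - S - U) * Om S U * Om S (V - S - U) * Om U (V - S - U))"
    proof (rule sum.reindex_bij_witness[where i = "\<lambda>(S, U). (S \<union> U, S)" and j = "\<lambda>(T, S). (S, T - S)"])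
      fix p assume "p \<in> (SIGMA T:Pow V. Pow T)"
      then obtain T S where p: "p = (T, S)" "T \<subseteq> V" "S \<subseteq> T" by auto
      then have "V - S - (T - S) = V - T" by blast
      then show "(case case p of (T, S) \<Rightarrow> (S, T - S) of (S, U) \<Rightarrow>
            F S * G U * H (V - S - U) * Om S U * Om S (V - S - U) * Om U (V - S - U)) =
          (case p of (T, S) \<Rightarrow>
            F S * G (T - S) * H (V - T) * Om S (T - S) * Om S (V - T) * Om (T - S) (V - T))"
        by (simp add: p(1))
    qed auto
    also have "\<dots> = (\<Sum>S\<in>Pow V. \<Sum>U\<in>Pow (V - S).
        F S * G U * H (V - S - U) * Om S U * Om S (V - S - U) * Om U (V - S - U))"
      by (rule sum.Sigma[symmetric]) (use fin fs in auto)
    also have "\<dots> = conv F (conv G H) V"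
      unfolding conv_def sum_distrib_left sum_distrib_right
    proof (intro sum.cong refl)
      fix S U assume "S \<in> Pow V" "U \<in> Pow (V - S)"
      then have "Om S (V - S) = Om S U * Om S (V - S - U)"
        using fs Om_Un_right[of U "V - S - U" S] fin by (simp add: Un_absorb1 finite_subset)
      then show "F S * G U * H (V - S - U) * Om S U * Om S (V - S - U) * Om U (V - S - U) =
          F S * (G U * H (V - S - U) * Om U (V - S - U)) * Om S (V - S)" by simp
    qed
    finally show ?thesis .
  qed (simp add: conv_def)
qed

lemma conv_nzE:
  assumes "conv F G V \<noteq> 0"
  obtains S where "S \<subseteq> V" "F S \<noteq> 0" "G (V - S) \<noteq> 0"
proof -
  obtain S where "S \<in> Pow V" "F S * G (V - S) * Om S (V - S) \<noteq> 0"
    using assms unfolding conv_def by (rule sum.not_neutral_contains_not_neutral)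
  then show ?thesis using that by simp
qed

lemma conv_supp:
  assumes "supp m F" "supp n G"
  shows "supp (m + n) (conv F G)"
  unfolding supp_def
proof (intro allI impI)
  fix V assume "conv F G V \<noteq> 0"
  then obtain S where S: "S \<subseteq> V" "F S \<noteq> 0" "G (V - S) \<noteq> 0" by (rule conv_nzE)
  then have "finite S" "card S = m" "0 \<notin> S" "finite (V - S)" "card (V - S) = n" "0 \<notin> V - S"
    using assms by (auto simp: supp_def)
  then show "finite V \<and> card V = m + n \<and> 0 \<notin> V"
    using S(1) by (metis Diff_iff Un_Diff_cancel Un_absorb1 card_Un_disjoint Diff_disjoint finite_UnI)
qed

lemma wheelD: "wheel F \<Longrightarrow> {q, q'} = {q1, q2} \<Longrightarrow> x \<in> V \<Longrightarrow> q * x \<in> V \<Longrightarrow> q1 * q2 * x \<in> V \<Longrightarrow> F V = 0"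
  unfolding wheel_def doubleton_eq_iff by blast

text \<open>The points of a wheel form a cycle in which each is the previous one times one of
  \<open>q1\<close>, \<open>q2\<close>, \<open>q3\<close>. If \<open>S\<close> contains some but not
  all of them, the cycle has a point outside \<open>S\<close> followed by one in \<open>S\<close>,
  and \<open>om\<close> vanishes on this pair. Otherwise \<open>F\<close> or \<open>G\<close> sees
  the whole wheel.\<close>

lemma conv_wheel:
  assumes "wheel F" "wheel G"
  shows "wheel (conv F G)"
  unfolding wheel_def
proof (intro allI impI)
  fix V x assume x: "x \<in> V \<and> (q1 * x \<in> V \<or> q2 * x \<in> V) \<and> q1 * q2 * x \<in> V"
  show "conv F G V = 0"
  proof (cases "finite V")
    case fin: True
    have key: "F S * G (V - S) * Om S (V - S) = 0"
      if S: "S \<subseteq> V" and q: "q * q' = q1 * q2" "{q, q'} = {q1, q2}" and q': "q * x \<in> V" for S q q'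
    proof -
      have om0: "om u v = 0" if "u = q * v \<or> u = q' * v \<or> u = q3 * v" for u v
        using that q(2) by (intro om_zero) (auto simp: doubleton_eq_iff)
      have cyc: "x = q3 * (q1 * q2 * x)" "q1 * q2 * x = q' * (q * x)"
      proof -
        have "q3 * (q1 * q2 * x) = (q1 * q2 * q3) * x" by (simp only: mult_ac)
        then show "x = q3 * (q1 * q2 * x)" by (simp only: q123 mult_1)
        show "q1 * q2 * x = q' * (q * x)" by (simp only: q(1)[symmetric] mult_ac)
      qed
      have Om: "Om S (V - S) = 0" if "u \<in> S" "v \<in> V - S" "u = q * v \<or> u = q' * v \<or> u = q3 * v" for u v
        using Om_zero[of S "V - S" u v] om0[of u v] that fin S by (auto intro: finite_subset)
      consider "x \<in> S" "q * x \<in> S" "q1 * q2 * x \<in> S" | "x \<notin> S" "q * x \<notin> S" "q1 * q2 * x \<notin> S"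
        | "q * x \<in> S" "x \<notin> S" | "q1 * q2 * x \<in> S" "q * x \<notin> S" | "x \<in> S" "q1 * q2 * x \<notin> S" by blast
      then show ?thesis
      proof cases
        case 1
        then have "F S = 0" using wheelD[OF assms(1) q(2), of x S] by simp
        then show ?thesis by simp
      next
        case 2
        then have "G (V - S) = 0" using wheelD[OF assms(2) q(2), of x "V - S"] x q' by simp
        then show ?thesis by simp
      next
        case 3
        then show ?thesis using Om[of "q * x" x] x by simp
      next
        case 4
        then show ?thesis using Om[of "q1 * q2 * x" "q * x"] q' cyc(2) by simp
      next
        case 5
        then show ?thesis using Om[of x "q1 * q2 * x"] x cyc(1) by simp
      qed
    qed
    have "F S * G (V - S) * Om S (V - S) = 0" if "S \<subseteq> V" for S
    proof (cases "q1 * x \<in> V")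
      case True
      then show ?thesis using key[OF that, of q1 q2] by simp
    next
      case False
      then show ?thesis using key[OF that, of q2 q1] x by (simp add: insert_commute mult.commute)
    qed
    then show ?thesis by (auto simp: conv_def intro!: sum.neutral)
  qed (simp add: conv_def)
qed

lemma conv_homog:
  assumes "homog F" "homog G"
  shows "homog (conv F G)"
  unfolding homog_def
proof (intro allI impI)
  fix V and c :: coef assume c: "c \<noteq> 0"
  have inj: "inj ((*) c)" using c by (auto simp: inj_def)
  have "conv F G ((*) c ` V) = (\<Sum>S\<in>(`) ((*) c) ` Pow V. F S * G ((*) c ` V - S) * Om S ((*) c ` V - S))"
    by (simp add: conv_def image_Pow_surj)
  also have "\<dots> = (\<Sum>S\<in>Pow V. F ((*) c ` S) * G ((*) c ` V - (*) c ` S) * Om ((*) c ` S) ((*) c ` V - (*) c ` S))"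
    by (subst sum.reindex) (auto simp: inj_on_def inj_image_eq_iff[OF inj])
  also have "\<dots> = conv F G V"
    using assms c by (simp add: conv_def homog_def Om_scale flip: image_set_diff[OF inj])
  finally show "conv F G ((*) c ` V) = conv F G V" .
qed

section \<open>Limits of products\<close>

lemma sum_Pow_Un:
  assumes "A \<inter> B = {}"
  shows "(\<Sum>S\<in>Pow (A \<union> B). f S) = (\<Sum>S\<in>Pow A. \<Sum>T\<in>Pow B. f (S \<union> T))"
proof -
  have "(\<Sum>S\<in>Pow (A \<union> B). f S) = (\<Sum>(S, T)\<in>Pow A \<times> Pow B. f (S \<union> T))"
  proof (rule sum.reindex_bij_witness[where j = "\<lambda>S. (S \<inter> A, S \<inter> B)" and i = "\<lambda>(S, T). S \<union> T"])
    fix S assume "S \<in> Pow (A \<union> B)"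
    then have "S \<inter> A \<union> S \<inter> B = S" by auto
    then show "(case (S \<inter> A, S \<inter> B) of (S, T) \<Rightarrow> f (S \<union> T)) = f S" "(case (S \<inter> A, S \<inter> B) of (S, T) \<Rightarrow> S \<union> T) = S"
      by simp_all
  next
    fix p assume "p \<in> Pow A \<times> Pow B"
    then show "(\<lambda>S. (S \<inter> A, S \<inter> B)) (case p of (S, T) \<Rightarrow> S \<union> T) = p" using assms by auto
  qed auto
  then show ?thesis by (simp add: sum.cartesian_product)
qed

lemma finite_meets_scaled:
  assumes "finite Y" "finite Z" "0 \<notin> Z"
  shows "finite {x::coef. Y \<inter> (*) x ` Z \<noteq> {}}"
proof (rule finite_subset)
  show "{x. Y \<inter> (*) x ` Z \<noteq> {}} \<subseteq> (\<lambda>(y, z). y / z) ` (Y \<times> Z)"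
    using assms(3) by (force simp: image_iff)
qed (use assms in auto)

lemma inj_on_scale: "c \<noteq> (0::coef) \<Longrightarrow> inj_on ((*) c) A"
  by (auto simp: inj_on_def)

text \<open>Off finitely many scales a subset of the configuration is \<open>A\<close> together with
  a rescaled \<open>B\<close>. Inside each of the two clusters \<open>om\<close> is invariant under
  scaling; between them it tends to 1 in either order.\<close>

lemma conv_lim:
  assumes lims: "has_lims F" "has_lims G" and fin: "finite Y" "finite Z" and nz: "0 \<notin> Y" "0 \<notin> Z"
  shows "lim0 (\<lambda>x. conv F G (Y \<union> (*) x ` Z))
    (\<Sum>A\<in>Pow Y. \<Sum>B\<in>Pow Z. delta F A B * delta G (Y - A) (Z - B) * (Om A (Y - A) * Om B (Z - B)))"
proof -
  define \<psi> where "\<psi> x = (\<Sum>A\<in>Pow Y. \<Sum>B\<in>Pow Z. F (A \<union> (*) x ` B) * G ((Y - A) \<union> (*) x ` (Z - B)) *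
      (Om A (Y - A) * Om B (Z - B) * ((\<Prod>s\<in>A. \<Prod>z\<in>Z - B. om s (x * z)) * (\<Prod>z\<in>B. \<Prod>s\<in>Y - A. om (x * z) s))))" for x
  have "lim0 \<psi> (\<Sum>A\<in>Pow Y. \<Sum>B\<in>Pow Z. delta F A B * delta G (Y - A) (Z - B) *
      (Om A (Y - A) * Om B (Z - B) * ((\<Prod>s\<in>A. \<Prod>z\<in>Z - B. 1) * (\<Prod>z\<in>B. \<Prod>s\<in>Y - A. 1))))"
    unfolding \<psi>_def
    by (intro lim0_sum lim0_mult lim0_prod lim0_delta lims lim0_const om_lim_left om_lim_right)
      (use nz in auto)
  then have "lim0 \<psi> (\<Sum>A\<in>Pow Y. \<Sum>B\<in>Pow Z. delta F A B * delta G (Y - A) (Z - B) * (Om A (Y - A) * Om B (Z - B)))"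
    by simp
  then show ?thesis
  proof (rule lim0_cong[rotated])
    have "conv F G (Y \<union> (*) x ` Z) = \<psi> x" if x: "x \<noteq> 0" and disj: "Y \<inter> (*) x ` Z = {}" for x
    proof -
      let ?t = "\<lambda>V. (*) x ` V"
      have "conv F G (Y \<union> ?t Z) = (\<Sum>A\<in>Pow Y. \<Sum>B\<in>Pow (?t Z).
          F (A \<union> B) * G (Y \<union> ?t Z - (A \<union> B)) * Om (A \<union> B) (Y \<union> ?t Z - (A \<union> B)))"
        unfolding conv_def by (rule sum_Pow_Un[OF disj])
      also have "\<dots> = (\<Sum>A\<in>Pow Y. \<Sum>B\<in>Pow Z.
          F (A \<union> ?t B) * G (Y \<union> ?t Z - (A \<union> ?t B)) * Om (A \<union> ?t B) (Y \<union> ?t Z - (A \<union> ?t B)))"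
        by (simp add: sum.reindex[OF inj_on_image_Pow[OF inj_on_scale[OF x]]] flip: image_Pow_surj[OF refl])
      also have "\<dots> = \<psi> x"
        unfolding \<psi>_def
      proof (intro sum.cong refl)
        fix A B assume "A \<in> Pow Y" "B \<in> Pow Z"
        then have AB: "A \<subseteq> Y" "B \<subseteq> Z" "finite A" "finite B" using fin finite_subset by auto
        have img: "?t (Z - B) = ?t Z - ?t B" using inj_on_scale[OF x, of UNIV] by (rule image_set_diff)
        have tB: "?t B \<subseteq> ?t Z" using AB by auto
        have eq: "Y \<union> ?t Z - (A \<union> ?t B) = (Y - A) \<union> ?t (Z - B)"
          unfolding img using disj AB tB by blast
        have d: "A \<inter> ?t B = {}" "(Y - A) \<inter> ?t (Z - B) = {}" using disj AB by auto
        have "Om (A \<union> ?t B) ((Y - A) \<union> ?t (Z - B)) =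
            Om A (Y - A) * Om A (?t (Z - B)) * (Om (?t B) (Y - A) * Om (?t B) (?t (Z - B)))"
          using AB fin d by (simp add: Om_Un_left Om_Un_right)
        also have "\<dots> = Om A (Y - A) * Om B (Z - B) *
            ((\<Prod>s\<in>A. \<Prod>z\<in>Z - B. om s (x * z)) * (\<Prod>z\<in>B. \<Prod>s\<in>Y - A. om (x * z) s))"
          by (simp add: Om_scale[OF x]) (simp add: Om_def prod.reindex inj_on_scale[OF x])
        finally show "F (A \<union> ?t B) * G (Y \<union> ?t Z - (A \<union> ?t B)) * Om (A \<union> ?t B) (Y \<union> ?t Z - (A \<union> ?t B)) =
            F (A \<union> ?t B) * G ((Y - A) \<union> ?t (Z - B)) * (Om A (Y - A) * Om B (Z - B) *
            ((\<Prod>s\<in>A. \<Prod>z\<in>Z - B. om s (x * z)) * (\<Prod>z\<in>B. \<Prod>s\<in>Y - A. om (x * z) s)))"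
          unfolding eq by simp
      qed
      finally show ?thesis .
    qed
    then have "{x. conv F G (Y \<union> (*) x ` Z) \<noteq> \<psi> x} \<subseteq> {0} \<union> {x. Y \<inter> (*) x ` Z \<noteq> {}}" by auto
    then show "finite {x. conv F G (Y \<union> (*) x ` Z) \<noteq> \<psi> x}"
      by (rule finite_subset) (use finite_meets_scaled[OF fin nz(2)] in simp)
  qed
qed

text \<open>In all remaining cases \<open>F\<close> vanishes at all but finitely many scales,
  because the set has the wrong cardinality, is infinite or contains 0; the limit is then 0.\<close>

lemma has_limsI:
  assumes "supp n F"
    and "\<And>Y Z. finite Y \<Longrightarrow> finite Z \<Longrightarrow> 0 \<notin> Y \<Longrightarrow> 0 \<notin> Z \<Longrightarrow> card Y + card Z = n \<Longrightarrow>
      \<exists>L. lim0 (\<lambda>x. F (Y \<union> (*) x ` Z)) L"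
  shows "has_lims F"
  unfolding has_lims_def
proof (intro allI)
  fix Y Z :: "coef set"
  show "\<exists>L. lim0 (\<lambda>x. F (Y \<union> (*) x ` Z)) L"
  proof (cases "finite Y \<and> finite Z \<and> 0 \<notin> Y \<and> 0 \<notin> Z \<and> card Y + card Z = n")
    case False
    have "finite {x. F (Y \<union> (*) x ` Z) \<noteq> 0}"
    proof (cases "finite Y \<and> finite Z \<and> 0 \<notin> Y \<and> 0 \<notin> Z")
      case True
      have "F (Y \<union> (*) x ` Z) = 0" if "x \<noteq> 0" "Y \<inter> (*) x ` Z = {}" for x
      proof -
        have "card (Y \<union> (*) x ` Z) = card Y + card Z"
          using that True by (simp add: card_Un_disjoint card_image inj_on_scale)
        then show ?thesis using assms(1) True \<open>\<not> (finite Y \<and> _)\<close> by (auto simp: supp_def)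
      qed
      then have "{x. F (Y \<union> (*) x ` Z) \<noteq> 0} \<subseteq> {0} \<union> {x. Y \<inter> (*) x ` Z \<noteq> {}}" by auto
      then show ?thesis by (rule finite_subset) (use True finite_meets_scaled in simp)
    next
      case False
      have "F (Y \<union> (*) x ` Z) = 0" if "x \<noteq> 0" for x
      proof (rule ccontr)
        assume "F (Y \<union> (*) x ` Z) \<noteq> 0"
        then have "finite (Y \<union> (*) x ` Z)" "0 \<notin> Y \<union> (*) x ` Z" using assms(1) by (auto simp: supp_def)
        then show False using False that
          by (auto simp: finite_image_iff inj_on_scale)
      qed
      then have "{x. F (Y \<union> (*) x ` Z) \<noteq> 0} \<subseteq> {0}" by auto
      then show ?thesis by (rule finite_subset) simp
    qed
    then show ?thesis by (intro exI[of _ 0]) (rule lim0_cong[OF _ lim0_const])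
  qed (use assms in auto)
qed

lemma conv_has_lims:
  assumes "supp m F" "supp n G" "has_lims F" "has_lims G"
  shows "has_lims (conv F G)"
  by (rule has_limsI[OF conv_supp[OF assms(1,2)]]) (use conv_lim assms in blast)

text \<open>Scaling \<open>Y\<close> by \<open>c\<close> is scaling the parameter by
  \<open>1 / c\<close>. This moves the tail of a string back to its standard position.\<close>

lemma delta_scale_left:
  assumes "homog F" "has_lims F" "c \<noteq> 0"
  shows "delta F ((*) c ` Y) Z = delta F Y Z"
proof (rule delta_eqI)
  have "F ((*) c ` Y \<union> (*) x ` Z) = F (Y \<union> (*) (1 / c * x) ` Z)" for x
  proof -
    have "(*) c ` Y \<union> (*) x ` Z = (*) c ` (Y \<union> (*) (1 / c * x) ` Z)"
      using assms(3) by (simp add: image_Un image_image)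
    then show ?thesis using assms by (simp only: homog_def) simp
  qed
  moreover have "lim0 (\<lambda>x. F (Y \<union> (*) (1 / c * x) ` Z)) (delta F Y Z)"
    by (rule lim0_scale[OF lim0_delta]) (use assms in auto)
  ultimately show "lim0 (\<lambda>x. F ((*) c ` Y \<union> (*) x ` Z)) (delta F Y Z)" by simp
qed

section \<open>Strings and the operators \<open>\<Theta>\<^sub>p\<close>\<close>

definition str :: "nat \<Rightarrow> coef set" where
  "str p = (\<lambda>i. q1 ^ i) ` {..<p}"

definition Th :: "nat \<Rightarrow> (coef set \<Rightarrow> coef) \<Rightarrow> coef set \<Rightarrow> coef" where
  "Th p F Z = delta F (str p) Z"

text \<open>The factor between the first \<open>a\<close> points of a string of length
  \<open>a + b\<close> and its last \<open>b\<close> points.\<close>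

definition gam :: "nat \<Rightarrow> nat \<Rightarrow> coef" where
  "gam a b = Om (str a) ((*) (q1 ^ a) ` str b)"

lemma finite_str [simp]: "finite (str p)"
  and str_nz [simp]: "0 \<notin> str p"
  by (auto simp: str_def)

lemma card_str [simp]: "card (str p) = p"
  by (simp add: str_def card_image inj_on_def q1_power_inj)

lemma str_in_iff: "q1 ^ i \<in> str p \<longleftrightarrow> i < p"
  by (auto simp: str_def q1_power_inj)

lemma str_0 [simp]: "str 0 = {}"
  by (simp add: str_def)

lemma str_diff: "a \<le> p \<Longrightarrow> str p - str a = (*) (q1 ^ a) ` str (p - a)"
proof -
  assume a: "a \<le> p"
  have "x \<in> (*) (q1 ^ a) ` str (p - a)" if x: "x \<in> str p - str a" for x
  proof -
    obtain i where i: "x = q1 ^ i" "i < p" using x by (auto simp: str_def)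
    with x have "a \<le> i" by (auto simp: str_in_iff)
    then have "x = q1 ^ a * q1 ^ (i - a)" "i - a < p - a" using i by (auto simp flip: power_add)
    then show ?thesis by (auto simp: str_in_iff)
  qed
  moreover have "x \<in> str p - str a" if x: "x \<in> (*) (q1 ^ a) ` str (p - a)" for x
  proof -
    obtain i where "x = q1 ^ a * q1 ^ i" "i < p - a" using x by (auto simp: str_def)
    then have "x = q1 ^ (a + i)" "a + i < p" by (auto simp: power_add)
    then show ?thesis by (auto simp: str_in_iff)
  qed
  ultimately show ?thesis by blast
qed

lemma str_mono: "a \<le> p \<Longrightarrow> str a \<subseteq> str p"
  by (auto simp: str_def)

text \<open>A point of \<open>A\<close> whose predecessor in the string is not in \<open>A\<close>
  would produce the factor \<open>om (q1 * y) y = 0\<close>, so \<open>A\<close> is closed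
  downwards.\<close>

lemma initial_segment:
  assumes A: "A \<subseteq> str p" and Om: "Om A (str p - A) \<noteq> 0"
  shows "A \<in> str ` {..p}"
proof -
  have down: "q1 ^ i \<in> A" if "q1 ^ Suc i \<in> A" for i
  proof (rule ccontr)
    assume "q1 ^ i \<notin> A"
    have "q1 ^ Suc i \<in> str p" using that A by blast
    then have "Suc i < p" by (simp only: str_in_iff)
    then have "q1 ^ i \<in> str p - A" using \<open>q1 ^ i \<notin> A\<close> by (simp add: str_in_iff)
    then have "Om A (str p - A) = 0"
      using that A by (intro Om_zero[where x = "q1 ^ Suc i" and y = "q1 ^ i"])
        (auto intro: om_zero finite_subset)
    then show False using Om by simp
  qed
  define a where "a = (LEAST i. q1 ^ i \<notin> A)"
  have "q1 ^ p \<notin> A" using A by (auto simp: str_in_iff)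
  then have a: "q1 ^ a \<notin> A" "a \<le> p"
    unfolding a_def by (rule LeastI[where P = "\<lambda>i. q1 ^ i \<notin> A"], rule Least_le)
  have lt: "q1 ^ i \<in> A" if "i < a" for i using not_less_Least that unfolding a_def by blast
  have ge: "q1 ^ (a + i) \<notin> A" for i
    by (induction i) (use a down in auto)
  have "A = str a"
  proof
    show "A \<subseteq> str a"
    proof
      fix x assume "x \<in> A"
      with A obtain i where i: "x = q1 ^ i" by (auto simp: str_def)
      then have "i < a" using ge[of "i - a"] \<open>x \<in> A\<close> by (cases "i < a") auto
      then show "x \<in> str a" using i by (simp add: str_in_iff)
    qed
  qed (use lt in \<open>auto simp: str_def\<close>)
  then show ?thesis using a by auto
qed

text \<open>The order of the arguments matters: a zero would need the first exponent to be larger by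
  one, or the exponent of \<open>q2\<close> to change.\<close>

lemma om_power_nz: "i < k \<Longrightarrow> om (q1 ^ i) (q1 ^ k) \<noteq> 0"
proof -
  assume ik: "i < k"
  have eq: "x \<noteq> y * z" if "x = qm a b" "y = qm c d" "z = qm e f" "(a, b) \<noteq> (c + e, d + f)" for x y z a b c d e f
    using qm_independent[of 1 a b 1 "c + e" "d + f"] that by (auto simp: qm_mult)
  have p: "q1 ^ i = qm (int i) 0" for i by (simp add: qm_def)
  have q: "q1 = qm 1 0" "q2 = qm 0 1" "q3 = qm (-1) (-1)"
    by (simp_all add: qm_def q3_def power_int_minus field_simps)
  have "q1 ^ i \<noteq> q1 * q1 ^ k" by (rule eq[OF p q(1) p]) (use ik in simp)
  moreover have "q1 ^ i \<noteq> q2 * q1 ^ k" by (rule eq[OF p q(2) p]) simp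
  moreover have "q1 ^ i \<noteq> q3 * q1 ^ k" by (rule eq[OF p q(3) p]) simp
  moreover have "q1 ^ i \<noteq> q1 ^ k" using ik by (simp add: q1_power_inj)
  ultimately show ?thesis by (simp add: om_def)
qed

lemma gam_alt: "gam a b = (\<Prod>i<a. \<Prod>j<b. om (q1 ^ i) (q1 ^ (a + j)))"
proof -
  have inj: "inj_on (\<lambda>i. q1 ^ i) A" for A by (auto simp: inj_on_def q1_power_inj)
  have "(*) (q1 ^ a) ` str b = (\<lambda>j. q1 ^ (a + j)) ` {..<b}" by (auto simp: str_def power_add)
  moreover have "inj_on (\<lambda>j. q1 ^ (a + j)) {..<b}" by (auto simp: inj_on_def q1_power_inj)
  ultimately show ?thesis by (simp add: gam_def Om_def prod.reindex str_def inj)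
qed

lemma gam_nz: "gam a b \<noteq> 0"
  by (simp add: gam_alt om_power_nz)

text \<open>By homogeneity \<open>om (q1 ^ i) (q1 ^ k)\<close> depends only on \<open>k - i\<close>.
  Counting the first block from its end, the differences are \<open>i + j + 1\<close> with
  \<open>i < a\<close> and \<open>j < b\<close>, which is symmetric in the blocks.\<close>

lemma gam_commute: "gam a b = gam b a"
proof -
  define \<tau> where "\<tau> d = om 1 (q1 ^ Suc d)" for d
  have *: "gam a b = (\<Prod>i<a. \<Prod>j<b. \<tau> (i + j))" for a b
  proof -
    have "om (q1 ^ i) (q1 ^ (a + j)) = \<tau> (a - Suc i + j)" if "i < a" for i j
    proof -
      have "q1 ^ (a + j) = q1 ^ i * q1 ^ Suc (a - Suc i + j)"
        using that by (simp flip: power_add power_Suc)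
      then show ?thesis using om_scale[of "q1 ^ i" 1] by (simp add: \<tau>_def)
    qed
    then have "gam a b = (\<Prod>i<a. \<Prod>j<b. \<tau> (a - Suc i + j))" by (simp add: gam_alt)
    then show ?thesis using prod.nat_diff_reindex[of "\<lambda>i. \<Prod>j<b. \<tau> (i + j)" a] by simp
  qed
  show ?thesis unfolding * by (subst prod.swap) (simp add: add.commute)
qed

lemma delta_zeroI:
  assumes "\<And>x. x \<noteq> 0 \<Longrightarrow> Y \<inter> (*) x ` Z = {} \<Longrightarrow> F (Y \<union> (*) x ` Z) = 0" "finite Y" "finite Z" "0 \<notin> Z"
  shows "delta F Y Z = 0"
proof (rule delta_eqI, rule lim0_cong[OF _ lim0_const])
  have "{x. F (Y \<union> (*) x ` Z) \<noteq> 0} \<subseteq> {0} \<union> {x. Y \<inter> (*) x ` Z \<noteq> {}}" using assms(1) by auto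
  then show "finite {x. F (Y \<union> (*) x ` Z) \<noteq> 0}"
    by (rule finite_subset) (use finite_meets_scaled assms in simp)
qed

lemma delta_zeroI':
  assumes "\<And>x. x \<noteq> 0 \<Longrightarrow> F (Y \<union> (*) x ` Z) = 0"
  shows "delta F Y Z = 0"
proof (rule delta_eqI, rule lim0_cong[OF _ lim0_const])
  have "{x. F (Y \<union> (*) x ` Z) \<noteq> 0} \<subseteq> {0}" using assms by auto
  then show "finite {x. F (Y \<union> (*) x ` Z) \<noteq> 0}" by (rule finite_subset) simp
qed

text \<open>The form \<open>p + card Z = n\<close> also excludes \<open>p > n\<close>, which the
  truncated difference \<open>n - p\<close> would not.\<close>

lemma Th_supp:
  assumes "supp n F" "Th p F Z \<noteq> 0"
  shows "finite Z \<and> 0 \<notin> Z \<and> p + card Z = n"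
proof (rule ccontr)
  assume neg: "\<not> ?thesis"
  have "delta F (str p) Z = 0"
  proof (cases "finite Z \<and> 0 \<notin> Z")
    case True
    show ?thesis
    proof (rule delta_zeroI)
      fix x assume "x \<noteq> 0" "str p \<inter> (*) x ` Z = {}"
      then have "card (str p \<union> (*) x ` Z) = p + card Z"
        using True by (simp add: card_Un_disjoint card_image inj_on_scale)
      then show "F (str p \<union> (*) x ` Z) = 0" using neg True assms(1) by (auto simp: supp_def)
    qed (use True in auto)
  next
    case False
    show ?thesis
    proof (rule delta_zeroI', rule ccontr)
      fix x assume "x \<noteq> 0" "F (str p \<union> (*) x ` Z) \<noteq> 0"
      then have "finite (str p \<union> (*) x ` Z)" "0 \<notin> str p \<union> (*) x ` Z" using assms(1) by (auto simp: supp_def)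
      then show False using False \<open>x \<noteq> 0\<close>
        by (auto simp: finite_image_iff inj_on_scale)
    qed
  qed
  then show False using assms(2) by (simp add: Th_def)
qed

lemma supp_Th: "supp n F \<Longrightarrow> supp (n - p) (Th p F)"
  unfolding supp_def[of "n - p"] using Th_supp[of n F p] by (metis add_diff_cancel_left')

lemma Th_eq_0: "supp n F \<Longrightarrow> n < p \<Longrightarrow> Th p F = (\<lambda>Z. 0)"
proof
  show "supp n F \<Longrightarrow> n < p \<Longrightarrow> Th p F Z = 0" for Z
    using Th_supp[of n F p Z] by linarith
qed

text \<open>Only initial segments contribute to \<open>conv_lim\<close>. The complement of
  \<open>str a\<close> is a string of length \<open>p - a\<close> starting at \<open>q1 ^ a\<close>,
  and homogeneity of \<open>G\<close> moves its start back to 1.\<close>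

lemma Th_conv:
  assumes supp: "supp m F" "supp n G" and lims: "has_lims F" "has_lims G" and hom: "homog G"
  shows "Th p (conv F G) = (\<lambda>Z. \<Sum>a\<le>p. gam a (p - a) * conv (Th a F) (Th (p - a) G) Z)"
proof
  fix Z
  show "Th p (conv F G) Z = (\<Sum>a\<le>p. gam a (p - a) * conv (Th a F) (Th (p - a) G) Z)"
  proof (cases "finite Z \<and> 0 \<notin> Z")
    case True
    let ?g = "\<lambda>A. \<Sum>B\<in>Pow Z. delta F A B * delta G (str p - A) (Z - B) * (Om A (str p - A) * Om B (Z - B))"
    have inj: "inj_on str {..p}" by (metis card_str inj_onI)
    have "Th p (conv F G) Z = (\<Sum>A\<in>Pow (str p). ?g A)"
      unfolding Th_def by (rule delta_eqI, rule conv_lim) (use lims True in auto)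
    also have "\<dots> = (\<Sum>A\<in>str ` {..p}. ?g A)"
    proof (rule sum.mono_neutral_right)
      show "str ` {..p} \<subseteq> Pow (str p)" using str_mono by auto
      show "\<forall>A\<in>Pow (str p) - str ` {..p}. ?g A = 0"
      proof
        fix A assume "A \<in> Pow (str p) - str ` {..p}"
        then have "Om A (str p - A) = 0" using initial_segment by blast
        then show "?g A = 0" by simp
      qed
    qed simp
    also have "\<dots> = (\<Sum>a\<le>p. ?g (str a))" by (subst sum.reindex[OF inj]) simp
    also have "\<dots> = (\<Sum>a\<le>p. gam a (p - a) * conv (Th a F) (Th (p - a) G) Z)"
    proof (intro sum.cong refl)
      fix a assume "a \<in> {..p}"
      then have a: "delta G (str p - str a) W = Th (p - a) G W" "Om (str a) (str p - str a) = gam a (p - a)" for W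
        by (simp_all add: str_diff delta_scale_left[OF hom lims(2)] Th_def gam_def)
      show "?g (str a) = gam a (p - a) * conv (Th a F) (Th (p - a) G) Z"
        unfolding a conv_def sum_distrib_left Th_def[of a] by (simp add: mult_ac)
    qed
    finally show ?thesis .
  next
    case False
    have "Th p (conv F G) Z = 0" using Th_supp[OF conv_supp[OF supp]] False by blast
    moreover have "conv (Th a F) (Th b G) Z = 0" for a b
    proof (rule ccontr)
      assume "conv (Th a F) (Th b G) Z \<noteq> 0"
      then obtain S where S: "S \<subseteq> Z" "Th a F S \<noteq> 0" "Th b G (Z - S) \<noteq> 0" by (rule conv_nzE)
      then have "finite S \<and> 0 \<notin> S" "finite (Z - S) \<and> 0 \<notin> Z - S"
        using Th_supp[OF supp(1)] Th_supp[OF supp(2)] by blast+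
      then show False using False S(1) by (metis Diff_iff finite_Diff2)
    qed
    ultimately show ?thesis by simp
  qed
qed

text \<open>For \<open>p = 1\<close> this is vanishing on every set with a nonzero point, the end of
  a descent in \<open>p\<close>.\<close>

definition vstr :: "nat \<Rightarrow> (coef set \<Rightarrow> coef) \<Rightarrow> bool" where
  "vstr p F \<longleftrightarrow> (\<forall>V y. y \<noteq> 0 \<and> (*) y ` str p \<subseteq> V \<longrightarrow> F V = 0)"

lemma Th_zeroI:
  assumes "supp n F" "\<And>x. x \<noteq> 0 \<Longrightarrow> F (str p \<union> (*) x ` Z) = 0"
  shows "Th p F Z = 0"
  unfolding Th_def using assms(2) by (rule delta_zeroI')

lemma vstr_Th: "supp n F \<Longrightarrow> vstr r F \<Longrightarrow> vstr r (Th p F)"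
  unfolding vstr_def
proof (intro allI impI)
  fix Z and y :: coef
  assume F: "supp n F" and v: "\<forall>V y. y \<noteq> 0 \<and> (*) y ` str r \<subseteq> V \<longrightarrow> F V = 0" and y: "y \<noteq> 0 \<and> (*) y ` str r \<subseteq> Z"
  show "Th p F Z = 0"
  proof (rule Th_zeroI[OF F])
    fix x :: coef assume "x \<noteq> 0"
    moreover have "(*) (x * y) ` str r \<subseteq> str p \<union> (*) x ` Z"
      using y by (auto simp: mult.assoc)
    ultimately show "F (str p \<union> (*) x ` Z) = 0" using v y by (metis no_zero_divisors)
  qed
qed

lemma wheel_Th: "supp n F \<Longrightarrow> wheel F \<Longrightarrow> wheel (Th p F)"
  unfolding wheel_def
proof (intro allI impI)
  fix Z and z :: coef
  assume F: "supp n F" and w: "\<forall>V x. x \<in> V \<and> (q1 * x \<in> V \<or> q2 * x \<in> V) \<and> q1 * q2 * x \<in> V \<longrightarrow> F V = 0"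
    and z: "z \<in> Z \<and> (q1 * z \<in> Z \<or> q2 * z \<in> Z) \<and> q1 * q2 * z \<in> Z"
  show "Th p F Z = 0"
  proof (rule Th_zeroI[OF F])
    fix x :: coef assume "x \<noteq> 0"
    have "x * z' \<in> str p \<union> (*) x ` Z" if "z' \<in> Z" for z' using that by auto
    then show "F (str p \<union> (*) x ` Z) = 0" using w[rule_format, of "x * z"] z
      by (metis mult.left_commute)
  qed
qed

lemma has_lims_lincomb:
  assumes "has_lims F" "has_lims G"
  shows "has_lims (\<lambda>V. c * F V + G V)"
  unfolding has_lims_def
  using lim0_add[OF lim0_mult[OF lim0_const lim0_delta[OF assms(1)]] lim0_delta[OF assms(2)]] by blast

lemma delta_lincomb:
  assumes "has_lims F" "has_lims G"
  shows "delta (\<lambda>V. c * F V + G V) Y Z = c * delta F Y Z + delta G Y Z"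
  by (rule delta_eqI, rule lim0_add[OF lim0_mult[OF lim0_const lim0_delta[OF assms(1)]] lim0_delta[OF assms(2)]])

lemma Th_lincomb:
  assumes "has_lims F" "has_lims G"
  shows "Th p (\<lambda>V. c * F V + G V) = (\<lambda>Z. c * Th p F Z + Th p G Z)"
  unfolding Th_def delta_lincomb[OF assms] ..

section \<open>Numerators\<close>

text \<open>Up to sign the discriminant: each unordered pair occurs in both orders, so the product
  is symmetric and clears poles of order two on all diagonals.\<close>

definition dsc :: "nat set \<Rightarrow> (nat \<Rightarrow> 'b::comm_ring_1) \<Rightarrow> 'b" where
  "dsc I A = (\<Prod>i\<in>I. \<Prod>j\<in>I - {i}. A i - A j)"

definition mixed :: "nat set \<Rightarrow> nat set \<Rightarrow> (nat \<Rightarrow> 'b::comm_ring_1) \<Rightarrow> 'b" where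
  "mixed T S A = (\<Prod>i\<in>T. \<Prod>j\<in>S. (A i - A j) * (A j - A i))"

lemma prod_pairs_Un:
  assumes "finite T" "finite S" "T \<inter> S = {}"
  shows "(\<Prod>x\<in>T \<union> S. \<Prod>y\<in>T \<union> S - {x}. f x y) =
    (\<Prod>x\<in>T. \<Prod>y\<in>T - {x}. f x y) * (\<Prod>x\<in>S. \<Prod>y\<in>S - {x}. f x y) *
    (\<Prod>x\<in>T. \<Prod>y\<in>S. f x y * f y x :: 'b::comm_monoid_mult)"
proof -
  have 1: "(\<Prod>y\<in>T \<union> S - {x}. f x y) = (\<Prod>y\<in>T - {x}. f x y) * (\<Prod>y\<in>S. f x y)" if "x \<in> T" for x
  proof -
    have "T \<union> S - {x} = (T - {x}) \<union> S" "(T - {x}) \<inter> S = {}" using assms that by auto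
    then show ?thesis using assms by (simp add: prod.union_disjoint)
  qed
  have 2: "(\<Prod>y\<in>T \<union> S - {x}. f x y) = (\<Prod>y\<in>S - {x}. f x y) * (\<Prod>y\<in>T. f x y)" if "x \<in> S" for x
  proof -
    have "T \<union> S - {x} = (S - {x}) \<union> T" "(S - {x}) \<inter> T = {}" using assms that by auto
    then show ?thesis using assms by (simp add: prod.union_disjoint)
  qed
  have "(\<Prod>y\<in>S. \<Prod>x\<in>T. f y x) = (\<Prod>x\<in>T. \<Prod>y\<in>S. f y x)" by (rule prod.swap)
  then show ?thesis using assms by (simp add: prod.union_disjoint 1 2 prod.distrib mult_ac)
qed

lemma dsc_Un:
  assumes "finite T" "finite S" "T \<inter> S = {}"
  shows "dsc (T \<union> S) A = dsc T A * dsc S A * mixed T S A"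
  unfolding dsc_def mixed_def by (rule prod_pairs_Un[OF assms])

lemma dsc_nz:
  fixes A :: "nat \<Rightarrow> 'b::idom"
  assumes "finite I" "inj_on A I"
  shows "dsc I A \<noteq> 0"
  using assms by (auto simp: dsc_def inj_on_def)

lemma dsc_scale:
  assumes "finite S"
  shows "dsc S (\<lambda>i. c * A i) = c ^ (card S * (card S - 1)) * dsc S A"
proof -
  have "dsc S (\<lambda>i. c * A i) = (\<Prod>i\<in>S. \<Prod>j\<in>S - {i}. c * (A i - A j))"
    by (simp add: dsc_def algebra_simps)
  also have "\<dots> = (\<Prod>i\<in>S. c ^ (card S - 1) * (\<Prod>j\<in>S - {i}. A i - A j))"
    by (intro prod.cong refl) (simp add: prod.distrib assms)
  also have "\<dots> = c ^ (card S * (card S - 1)) * dsc S A"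
    by (simp add: prod.distrib dsc_def mult.commute flip: power_mult)
  finally show ?thesis .
qed

lemma dsc_cong: "(\<And>i. i \<in> I \<Longrightarrow> A i = B i) \<Longrightarrow> dsc I A = dsc I B"
  by (simp add: dsc_def)

lemma dsc_reindex:
  assumes "inj_on e I"
  shows "dsc (e ` I) A = dsc I (\<lambda>i. A (e i))"
proof -
  have "e ` I - {e i} = e ` (I - {i})" if "i \<in> I" for i using assms that by (auto simp: inj_on_def)
  moreover have "inj_on e (I - {i})" for i using assms by (auto simp: inj_on_def)
  ultimately show ?thesis using assms by (simp add: dsc_def prod.reindex)
qed

lemma (in coef_hom) eval_dsc: "mpol_eval h A (dsc I Xm) = dsc I A"
  by (simp add: dsc_def)

text \<open>The rescaled discriminant without the power of \<xi> that comes from pairs inside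
  \<open>S\<close>. Over a domain its value at \<xi> = 0 is nonzero at \<open>sgeneric\<close>
  points.\<close>

definition reg_part :: "nat \<Rightarrow> nat set \<Rightarrow> (nat \<Rightarrow> 'b::comm_ring_1) \<Rightarrow> 'b poly" where
  "reg_part n S A = smult (dsc ({..<n} - S) A * dsc S A)
     (mixed ({..<n} - S) S (resc S A))"

text \<open>A coordinate in \<open>S\<close> may equal one outside \<open>S\<close>, since almost
  every rescaling separates them. This lets a fixed string be combined with arbitrary free
  points.\<close>

definition sgeneric :: "nat \<Rightarrow> nat set \<Rightarrow> (nat \<Rightarrow> 'b::zero) \<Rightarrow> bool" where
  "sgeneric n S a \<longleftrightarrow> S \<subseteq> {..<n} \<and> inj_on a S \<and> inj_on a ({..<n} - S) \<and> (\<forall>i<n. a i \<noteq> 0)"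

lemma generic_imp_sgeneric: "generic n a \<Longrightarrow> S \<subseteq> {..<n} \<Longrightarrow> sgeneric n S a"
  by (auto simp: generic_def sgeneric_def inj_on_def)

lemma poly_mixed: "poly (mixed T S A) x = mixed T S (\<lambda>i. poly (A i) x)"
  by (simp add: mixed_def poly_prod)

lemma dsc_resc:
  assumes "S \<subseteq> {..<n}"
  shows "dsc {..<n} (resc S A) = monom 1 (card S * (card S - 1)) * reg_part n S A"
proof -
  let ?T = "{..<n} - S"
  have fin: "finite S" using assms finite_subset by blast
  have "dsc {..<n} (resc S A) = dsc (?T \<union> S) (resc S A)" using assms by (simp add: Un_absorb2)
  also have "\<dots> = dsc ?T (resc S A) * dsc S (resc S A) * mixed ?T S (resc S A)"
    by (rule dsc_Un) (use fin in auto)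
  also have "dsc ?T (resc S A) = [:dsc ?T A:]"
  proof -
    have c: "(\<Prod>i\<in>I. [:f i:]) = [:\<Prod>i\<in>I. f i:]" for I and f :: "nat \<Rightarrow> 'a"
      by (induction I rule: infinite_finite_induct) simp_all
    have "dsc ?T (resc S A) = dsc ?T (\<lambda>i. [:A i:])" by (rule dsc_cong) (simp add: resc_def)
    also have "\<dots> = [:dsc ?T A:]" by (simp add: dsc_def c)
    finally show ?thesis .
  qed
  also have "dsc S (resc S A) = [:dsc S A:] * monom 1 (card S * (card S - 1))"
  proof -
    have c: "(\<Prod>i\<in>I. [:f i:]) = [:\<Prod>i\<in>I. f i:]" for I and f :: "nat \<Rightarrow> 'a"
      by (induction I rule: infinite_finite_induct) simp_all
    have "dsc S (resc S A) = dsc S (\<lambda>i. [:0, 1:] * [:A i:])" by (rule dsc_cong) (simp add: resc_def)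
    also have "\<dots> = [:dsc S A:] * monom 1 (card S * (card S - 1))"
      by (simp only: dsc_scale[OF fin]) (simp add: dsc_def c monom_altdef)
    finally show ?thesis .
  qed
  finally show ?thesis by (simp add: reg_part_def mult_ac)
qed

lemma poly_reg_part_0:
  "poly (reg_part n S A) 0 = dsc ({..<n} - S) A * dsc S A * (\<Prod>i\<in>{..<n} - S. \<Prod>j\<in>S. - (A i * A i))"
proof -
  have "mixed ({..<n} - S) S (\<lambda>i. if i \<in> S then 0 * A i else A i) =
      (\<Prod>i\<in>{..<n} - S. \<Prod>j\<in>S. - (A i * A i))"
    unfolding mixed_def by (intro prod.cong refl) auto
  then show ?thesis by (simp only: reg_part_def poly_smult poly_mixed poly_resc)
qed

lemma poly_reg_part_0_nz:
  fixes A :: "nat \<Rightarrow> 'b::idom"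
  assumes "sgeneric n S A"
  shows "poly (reg_part n S A) 0 \<noteq> 0"
proof -
  have "finite S" using assms by (auto simp: sgeneric_def intro: finite_subset)
  then show ?thesis
    unfolding poly_reg_part_0 using assms by (auto simp: dsc_nz sgeneric_def)
qed

section \<open>Numerators over the discriminant, and limits as conditions on weights\<close>

definition rep :: "nat \<Rightarrow> (coef set \<Rightarrow> coef) \<Rightarrow> mpol \<Rightarrow> bool" where
  "rep n F P \<longleftrightarrow> (\<forall>a. generic n a \<longrightarrow> F (a ` {..<n}) * dsc {..<n} a = ev P a)"

text \<open>The condition on the monomials of the numerator says that all limits at \<open>0\<close> and \<open>\<infinity>\<close> exist.
  That the two limits agree is not required in \<open>Bsp\<close>; it turns out to be automatic.\<close>

definition adm :: "nat \<Rightarrow> mpol \<Rightarrow> bool" where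
  "adm n P \<longleftrightarrow> (\<forall>m\<in>Poly_Mapping.keys P. Poly_Mapping.keys m \<subseteq> {..<n} \<and>
     (\<forall>S\<subseteq>{..<n}. card S * (card S - 1) \<le> wt S m) \<and> wt {..<n} m = n * (n - 1))"

definition Bsp :: "nat \<Rightarrow> (coef set \<Rightarrow> coef) set" where
  "Bsp n = {F. supp n F \<and> wheel F \<and> (\<exists>P. adm n P \<and> rep n F P)}"

definition scaled :: "nat set \<Rightarrow> (nat \<Rightarrow> coef) \<Rightarrow> mpol \<Rightarrow> coef poly" where
  "scaled S a P = mpol_eval (\<lambda>c. [:id c:]) (resc S a) P"

lemma poly_scaled: "poly (scaled S a P) x = ev P (\<lambda>i. if i \<in> S then x * a i else a i)"
  by (simp only: scaled_def id.poly_eval poly_resc)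

lemma coeff_scaled: "finite S \<Longrightarrow> coeff (scaled S a P) j = ev (part S j P) a"
  unfolding scaled_def by (rule id.coeff_eval_resc)

lemma low_coeffs_factor:
  fixes p :: "'b::comm_ring_1 poly"
  assumes "\<And>j. j < k \<Longrightarrow> coeff p j = 0"
  obtains p' where "p = monom 1 k * p'" "\<And>j. coeff p' j = coeff p (j + k)"
proof
  show "p = monom 1 k * poly_shift k p"
    by (rule poly_eqI) (use assms in \<open>auto simp: coeff_monom_mult coeff_poly_shift\<close>)
  show "coeff (poly_shift k p) j = coeff p (j + k)" for j by (simp add: coeff_poly_shift add.commute)
qed

lemma image_scaled:
  assumes "S \<subseteq> {..<n}"
  shows "(\<lambda>i. if i \<in> S then x * a i else a i) ` {..<n} = a ` ({..<n} - S) \<union> (*) x ` (a ` S)"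
  using assms by (auto simp: image_iff)

lemma generic_scaled:
  assumes "sgeneric n S a" "x \<noteq> (0::coef)" "a ` ({..<n} - S) \<inter> (*) x ` (a ` S) = {}"
  shows "generic n (\<lambda>i. if i \<in> S then x * a i else a i)"
proof -
  have 1: "a i \<noteq> x * a j" if "i \<in> {..<n} - S" "j \<in> S" for i j
  proof
    assume "a i = x * a j"
    then have "a i \<in> (*) x ` (a ` S)" using that by auto
    moreover have "a i \<in> a ` ({..<n} - S)" using that by blast
    ultimately show False using assms(3) by blast
  qed
  have 2: "a i = a j \<longleftrightarrow> i = j" if "i \<in> S \<and> j \<in> S \<or> i \<in> {..<n} - S \<and> j \<in> {..<n} - S" for i j
    using assms(1) that by (auto simp: sgeneric_def inj_on_def)
  have "inj_on (\<lambda>i. if i \<in> S then x * a i else a i) {..<n}"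
  proof (rule inj_onI)
    fix i j assume ij: "i \<in> {..<n}" "j \<in> {..<n}" and eq: "(if i \<in> S then x * a i else a i) = (if j \<in> S then x * a j else a j)"
    show "i = j"
      using eq 1[of i j] 1[of j i] 2[of i j] ij assms(2)
      by (cases "i \<in> S"; cases "j \<in> S") auto
  qed
  then show ?thesis using assms(1,2) by (simp add: generic_def sgeneric_def)
qed

lemma dsc_scaled:
  assumes "S \<subseteq> {..<n}"
  shows "dsc {..<n} (\<lambda>i. if i \<in> S then x * a i else a i) =
    x ^ (card S * (card S - 1)) * poly (reg_part n S a) (x::coef)"
proof -
  have "poly (dsc {..<n} (resc S a)) x = dsc {..<n} (\<lambda>i. poly (resc S a i) x)"
    by (simp add: dsc_def poly_prod)
  then show ?thesis by (simp add: dsc_resc[OF assms] poly_resc poly_monom)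
qed

lemma rep_scaled:
  assumes "rep n F P" "sgeneric n S a" "x \<noteq> 0" "a ` ({..<n} - S) \<inter> (*) x ` (a ` S) = {}"
  shows "F (a ` ({..<n} - S) \<union> (*) x ` (a ` S)) *
    (x ^ (card S * (card S - 1)) * poly (reg_part n S a) x) = poly (scaled S a P) x"
proof -
  have S: "S \<subseteq> {..<n}" using assms(2) by (simp add: sgeneric_def)
  show ?thesis
    using assms(1) generic_scaled[OF assms(2-4)]
    unfolding rep_def poly_scaled dsc_scaled[OF S, symmetric] image_scaled[OF S, symmetric] by blast
qed

lemma finite_bad_scales:
  assumes "sgeneric n S (a :: nat \<Rightarrow> coef)"
  shows "finite ({0} \<union> {x. a ` ({..<n} - S) \<inter> (*) x ` (a ` S) \<noteq> {}})"
proof -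
  have "finite S" "0 \<notin> a ` S" using assms by (auto simp: sgeneric_def intro: finite_subset)
  then show ?thesis using finite_meets_scaled[of "a ` ({..<n} - S)" "a ` S"] by simp
qed

text \<open>By the weight bound the numerator is divisible by the power of \<xi> contained in the
  discriminant; after cancelling, both can be evaluated at 0.\<close>

lemma lim0_rep:
  assumes rep: "rep n F P" and a: "sgeneric n S a"
    and low: "\<And>m. m \<in> Poly_Mapping.keys P \<Longrightarrow> card S * (card S - 1) \<le> wt S m"
  shows "lim0 (\<lambda>x. F (a ` ({..<n} - S) \<union> (*) x ` (a ` S)))
    (ev (part S (card S * (card S - 1)) P) a / poly (reg_part n S a) 0)"
proof -
  let ?k = "card S * (card S - 1)"
  have fin: "finite S" using a by (auto simp: sgeneric_def intro: finite_subset)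
  have "coeff (scaled S a P) j = 0" if "j < ?k" for j
  proof -
    have "part S j P = 0" unfolding part_0_iff using low that by fastforce
    then show ?thesis by (simp add: coeff_scaled[OF fin])
  qed
  then obtain N where N: "scaled S a P = monom 1 ?k * N" "\<And>j. coeff N j = coeff (scaled S a P) (j + ?k)"
    using low_coeffs_factor[of ?k "scaled S a P"] by blast
  have N0: "poly N 0 = ev (part S ?k P) a"
    using N(2)[of 0] by (simp add: poly_0_coeff_0 coeff_scaled[OF fin])
  have nz: "poly (reg_part n S a) 0 \<noteq> 0" by (rule poly_reg_part_0_nz[OF a])
  show ?thesis
  proof (rule lim0_cong)
    show "lim0 (\<lambda>x. poly N x / poly (reg_part n S a) x) (ev (part S ?k P) a / poly (reg_part n S a) 0)"
      unfolding N0[symmetric] by (rule lim0_poly_quot[OF nz])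
    let ?B = "({0} \<union> {x. a ` ({..<n} - S) \<inter> (*) x ` (a ` S) \<noteq> {}}) \<union> {x. poly (reg_part n S a) x = 0}"
    have "F (a ` ({..<n} - S) \<union> (*) x ` (a ` S)) = poly N x / poly (reg_part n S a) x" if "x \<notin> ?B" for x
      using rep_scaled[OF rep a, of x] that by (simp add: N(1) poly_monom field_simps)
    then have "{x. F (a ` ({..<n} - S) \<union> (*) x ` (a ` S)) \<noteq> poly N x / poly (reg_part n S a) x} \<subseteq> ?B"
      by blast
    moreover have "finite ?B" using finite_bad_scales[OF a] finite_poly_zeros[OF nz] by simp
    ultimately show "finite {x. F (a ` ({..<n} - S) \<union> (*) x ` (a ` S)) \<noteq> poly N x / poly (reg_part n S a) x}"
      by (rule finite_subset)
  qed
qed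

lemma enumerate:
  assumes "finite Y" "finite Z" "(0::coef) \<notin> Y" "0 \<notin> Z" "S \<subseteq> {..<n}" "card S = card Z" "card Y + card Z = n"
  obtains a where "sgeneric n S a" "a ` ({..<n} - S) = Y" "a ` S = Z"
proof -
  have fin: "finite S" using assms finite_subset by blast
  have "card ({..<n} - S) = card Y" using assms fin by (simp add: card_Diff_subset)
  then obtain f where f: "bij_betw f ({..<n} - S) Y"
    using assms by (metis finite_Diff finite_lessThan finite_same_card_bij)
  obtain g where g: "bij_betw g S Z" using assms fin by (metis finite_same_card_bij)
  define a where "a i = (if i \<in> S then g i else f i)" for i
  have 1: "a ` ({..<n} - S) = f ` ({..<n} - S)" "a ` S = g ` S"
    by (auto simp: a_def)
  have im: "a ` ({..<n} - S) = Y" "a ` S = Z"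
    unfolding 1 using f g by (simp_all add: bij_betw_def)
  have "inj_on a S" "inj_on a ({..<n} - S)"
    using f g by (auto simp: bij_betw_def a_def inj_on_def)
  moreover have "a i \<noteq> 0" if "i < n" for i
    using im that assms(3,4) by (cases "i \<in> S") auto
  ultimately show ?thesis using im assms(5) by (intro that) (auto simp: sgeneric_def)
qed

lemma low_weightD:
  "adm n P \<Longrightarrow> m \<in> Poly_Mapping.keys P \<Longrightarrow> S \<subseteq> {..<n} \<Longrightarrow> card S * (card S - 1) \<le> wt S m"
  by (simp add: adm_def)

text \<open>The points may be enumerated in any order, so one index set of each cardinality is
  enough. The limit conditions on rational functions supply such a set, a final segment.\<close>

lemma has_lims_of_weights:
  assumes "supp n F" "rep n F P"
    and low: "\<And>k. k \<le> n \<Longrightarrow> \<exists>S\<subseteq>{..<n}. card S = k \<and>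
      (\<forall>m\<in>Poly_Mapping.keys P. card S * (card S - 1) \<le> wt S m)"
  shows "has_lims F"
proof (rule has_limsI[OF assms(1)])
  fix Y Z :: "coef set" assume YZ: "finite Y" "finite Z" "0 \<notin> Y" "0 \<notin> Z" "card Y + card Z = n"
  obtain S where S: "S \<subseteq> {..<n}" "card S = card Z"
      "\<And>m. m \<in> Poly_Mapping.keys P \<Longrightarrow> card S * (card S - 1) \<le> wt S m"
    using low[of "card Z"] YZ(5) by auto
  obtain a where "sgeneric n S a" "a ` ({..<n} - S) = Y" "a ` S = Z"
    using enumerate[OF YZ(1-4) S(1,2) YZ(5)] by blast
  then show "\<exists>L. lim0 (\<lambda>x. F (Y \<union> (*) x ` Z)) L"
    using lim0_rep[OF assms(2) _ S(3)] by metis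
qed

lemma has_lims_rep:
  assumes "supp n F" "rep n F P" "adm n P"
  shows "has_lims F"
proof (rule has_lims_of_weights[OF assms(1,2)])
  fix k assume "k \<le> n"
  then show "\<exists>S\<subseteq>{..<n}. card S = k \<and> (\<forall>m\<in>Poly_Mapping.keys P. card S * (card S - 1) \<le> wt S m)"
    using low_weightD[OF assms(3), of _ "{..<k}"] by (intro exI[of _ "{..<k}"]) auto
qed

lemma delta_rep:
  assumes "rep n F P" "adm n P" "sgeneric n S a"
  shows "delta F (a ` ({..<n} - S)) (a ` S) = ev (part S (card S * (card S - 1)) P) a / poly (reg_part n S a) 0"
  by (rule delta_eqI, rule lim0_rep) (use assms low_weightD in \<open>auto simp: sgeneric_def\<close>)

lemma part_total:
  assumes "\<And>m. m \<in> Poly_Mapping.keys P \<Longrightarrow> wt {..<n} m = n * (n - 1)"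
  shows "part {..<n} (n * (n - 1)) P = P"
  by (rule poly_mapping_eqI) (use assms in \<open>auto simp: part_def lookup_pfilter in_keys_iff\<close>)

text \<open>Numerator and discriminant have the same total degree, so a common scale
  cancels.\<close>

lemma homog_of_total:
  assumes "supp n F" "rep n F P"
    and total: "\<And>m. m \<in> Poly_Mapping.keys P \<Longrightarrow> wt {..<n} m = n * (n - 1)"
  shows "homog F"
  unfolding homog_def
proof (intro allI impI)
  fix V and c :: coef assume c: "c \<noteq> 0"
  show "F ((*) c ` V) = F V"
  proof (cases "finite V \<and> 0 \<notin> V \<and> card V = n")
    case True
    obtain a where a: "sgeneric n {..<n} a" "a ` ({..<n} - {..<n}) = {}" "a ` {..<n} = V"
      using enumerate[of "{}" V "{..<n}" n] True by auto
    have gen: "generic n a" using a by (simp add: generic_def sgeneric_def)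
    have "F V * dsc {..<n} a = ev P a" unfolding a(3)[symmetric] using assms(2) gen by (simp add: rep_def)
    moreover have W: "poly (reg_part n {..<n} a) c = dsc {..<n} a"
      by (simp add: reg_part_def mixed_def dsc_def)
    have "F ((*) c ` V) * (c ^ (n * (n - 1)) * dsc {..<n} a) = poly (scaled {..<n} a P) c"
      using rep_scaled[OF assms(2) a(1) c] a W by simp
    moreover have "scaled {..<n} a P = monom (ev P a) (n * (n - 1))"
    proof (rule poly_eqI)
      fix j
      have "part {..<n} j P = 0" if "j \<noteq> n * (n - 1)"
        using total that unfolding part_0_iff by metis
      then show "coeff (scaled {..<n} a P) j = coeff (monom (ev P a) (n * (n - 1))) j"
        using part_total[OF total] by (cases "j = n * (n - 1)") (simp_all add: coeff_scaled)
    qed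
    moreover have "dsc {..<n} a \<noteq> 0" using gen by (simp add: dsc_nz generic_def)
    ultimately have "F ((*) c ` V) * dsc {..<n} a = F V * dsc {..<n} a"
      using c by (auto simp: poly_monom)
    then show ?thesis using \<open>dsc {..<n} a \<noteq> 0\<close> by simp
  next
    case False
    have "finite ((*) c ` V) = finite V" "card ((*) c ` V) = card V"
      by (simp_all add: finite_image_iff card_image inj_on_scale c)
    moreover have "0 \<in> (*) c ` V \<longleftrightarrow> 0 \<in> V" using c by (auto simp: image_iff)
    ultimately have "F V = 0" "F ((*) c ` V) = 0" using assms(1) False unfolding supp_def by metis+
    then show ?thesis by simp
  qed
qed

lemma homog_rep: "supp n F \<Longrightarrow> rep n F P \<Longrightarrow> adm n P \<Longrightarrow> homog F"
  by (rule homog_of_total) (auto simp: adm_def)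

lemma monom_dvd_cancel:
  fixes p v :: "'b::idom poly"
  assumes "monom 1 k dvd p * v" "poly v 0 \<noteq> 0"
  shows "monom 1 k dvd p"
proof -
  have m: "monom 1 k = [:- 0, 1 :: 'b:] ^ k" by (simp add: monom_altdef)
  have "p * v = 0 \<or> k \<le> order 0 (p * v)" using assms(1) unfolding m order_divides .
  moreover have "order 0 v = 0" "v \<noteq> 0" using assms(2) by (auto intro: order_0I)
  ultimately have "p = 0 \<or> k \<le> order 0 p"
    by (cases "p = 0") (simp_all add: order_mult)
  then show ?thesis unfolding m order_divides .
qed

text \<open>At a generic point the existence of the limit forces the power of \<xi> in the
  discriminant to divide the rescaled numerator. So the components of smaller weight vanish at all
  generic points, hence identically. Homogeneity fixes the total weight by the same comparison of
  coefficients.\<close>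

lemma adm_of_lims:
  assumes rep: "rep n F P" and hom: "homog F" and lims: "has_lims F"
  shows "adm n P"
proof -
  have vars: "mpol_vars P \<subseteq> {..<n}"
  proof (rule mpol_varsI)
    fix a b :: "nat \<Rightarrow> coef" assume a: "generic n a" and eq: "\<And>i. i < n \<Longrightarrow> a i = b i"
    have "generic n b" using a eq by (auto simp: generic_def inj_on_def)
    moreover have "dsc {..<n} a = dsc {..<n} b" using eq by (intro dsc_cong) simp
    moreover have "a ` {..<n} = b ` {..<n}" using eq by auto
    ultimately show "ev P a = ev P b" using a rep unfolding rep_def by metis
  qed
  have low: "card S * (card S - 1) \<le> wt S m" if m: "m \<in> Poly_Mapping.keys P" and S: "S \<subseteq> {..<n}" for m S
  proof (rule ccontr)
    let ?k = "card S * (card S - 1)" and ?j = "wt S m"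
    assume less: "\<not> ?k \<le> ?j"
    have fin: "finite S" using S finite_subset by blast
    have "ev (part S ?j P) a = 0" if a: "generic n a" for a
    proof -
      have sg: "sgeneric n S a" by (rule generic_imp_sgeneric[OF a S])
      let ?\<phi> = "\<lambda>x. F (a ` ({..<n} - S) \<union> (*) x ` (a ` S))"
      obtain L where "lim0 ?\<phi> L" using lims by (auto simp: has_lims_def)
      then obtain u v where uv: "poly v 0 \<noteq> 0" "finite {x. ?\<phi> x \<noteq> poly u x / poly v x}"
        by (auto simp: lim0_def)
      let ?B = "({0} \<union> {x. a ` ({..<n} - S) \<inter> (*) x ` (a ` S) \<noteq> {}}) \<union>
        ({x. poly v x = 0} \<union> {x. ?\<phi> x \<noteq> poly u x / poly v x})"
      have "poly (u * (monom 1 ?k * reg_part n S a)) x = poly (scaled S a P * v) x" if "x \<notin> ?B" for x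
      proof -
        have 1: "?\<phi> x * (x ^ ?k * poly (reg_part n S a) x) = poly (scaled S a P) x"
          using that by (intro rep_scaled[OF rep sg]) auto
        have 2: "?\<phi> x * poly v x = poly u x" using that by (simp add: field_simps)
        have "poly (u * (monom 1 ?k * reg_part n S a)) x =
            poly u x * (x ^ ?k * poly (reg_part n S a) x)" by (simp add: poly_monom)
        also have "\<dots> = poly (scaled S a P * v) x"
          by (simp only: 1[symmetric] 2[symmetric] poly_mult mult_ac)
        finally show ?thesis .
      qed
      then have "{x. poly (u * (monom 1 ?k * reg_part n S a)) x \<noteq> poly (scaled S a P * v) x} \<subseteq> ?B" by blast
      moreover have "finite ?B" using finite_bad_scales[OF sg] finite_poly_zeros[OF uv(1)] uv(2) by blast
      ultimately have "u * (monom 1 ?k * reg_part n S a) = scaled S a P * v"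
        by (intro poly_eqI_cofinite) (rule finite_subset)
      then have "monom 1 ?k dvd scaled S a P * v" by (metis dvd_triv_left dvd_mult)
      then have "monom 1 ?k dvd scaled S a P" by (rule monom_dvd_cancel[OF _ uv(1)])
      then obtain w where w: "scaled S a P = monom 1 ?k * w" by (rule dvdE)
      have "coeff (scaled S a P) ?j = 0" unfolding w using less by (simp add: coeff_monom_mult)
      then show ?thesis by (simp add: coeff_scaled[OF fin])
    qed
    then have "part S ?j P = 0" by (rule mpol_eq_0I)
    then show False using m unfolding part_0_iff by blast
  qed
  have total: "wt {..<n} m = n * (n - 1)" if m: "m \<in> Poly_Mapping.keys P" for m
  proof (rule ccontr)
    let ?j = "wt {..<n} m"
    assume ne: "?j \<noteq> n * (n - 1)"
    have "ev (part {..<n} ?j P) a = 0" if a: "generic n a" for a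
    proof -
      have sg: "sgeneric n {..<n} a" by (rule generic_imp_sgeneric[OF a]) simp
      have W: "poly (reg_part n {..<n} a) x = dsc {..<n} a" for x
        by (simp add: reg_part_def mixed_def dsc_def)
      have "poly (scaled {..<n} a P) x = poly (monom (ev P a) (n * (n - 1))) x" if "x \<noteq> 0" for x
      proof -
        have "poly (scaled {..<n} a P) x = F ((*) x ` (a ` {..<n})) * (x ^ (n * (n - 1)) * dsc {..<n} a)"
          using rep_scaled[OF rep sg that] by (simp add: W)
        also have "\<dots> = (F (a ` {..<n}) * dsc {..<n} a) * x ^ (n * (n - 1))"
          using hom that by (simp add: homog_def)
        also have "\<dots> = ev P a * x ^ (n * (n - 1))" using rep a by (simp add: rep_def)
        finally show ?thesis by (simp add: poly_monom)
      qed
      then have "{x. poly (scaled {..<n} a P) x \<noteq> poly (monom (ev P a) (n * (n - 1))) x} \<subseteq> {0}" by blast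
      then have "scaled {..<n} a P = monom (ev P a) (n * (n - 1))"
        by (intro poly_eqI_cofinite) (rule finite_subset[OF _ finite.insertI[OF finite.emptyI]])
      then have "coeff (scaled {..<n} a P) ?j = 0" using ne by simp
      then show ?thesis by (simp add: coeff_scaled)
    qed
    then have "part {..<n} ?j P = 0" by (rule mpol_eq_0I)
    then show False using m unfolding part_0_iff by blast
  qed
  show ?thesis unfolding adm_def using vars low total by (auto simp: mpol_vars_def)
qed

lemma BspI:
  assumes "supp n F" "wheel F" "rep n F P" "homog F" "has_lims F"
  shows "F \<in> Bsp n"
  using assms adm_of_lims unfolding Bsp_def by blast

lemma BspD:
  assumes "F \<in> Bsp n"
  shows "supp n F" "wheel F" "homog F" "has_lims F"
  using assms homog_rep has_lims_rep unfolding Bsp_def by blast+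

section \<open>The operators \<open>\<Theta>\<^sub>p\<close> on the enlarged spaces\<close>

definition strpt :: "nat \<Rightarrow> (nat \<Rightarrow> coef) \<Rightarrow> nat \<Rightarrow> coef" where
  "strpt p b i = (if i < p then q1 ^ i else b (i - p))"

lemma interval_shift: "(p::nat) \<le> n \<Longrightarrow> {p..<n} = (\<lambda>j. j + p) ` {..<n - p}"
  using image_add_atLeastLessThan'[of p 0 "n - p"] by (simp add: atLeast0LessThan)

lemma strpt_image:
  assumes "p \<le> n"
  shows "strpt p b ` ({..<n} - {p..<n}) = str p" "strpt p b ` {p..<n} = b ` {..<n - p}"
proof -
  have "{..<n} - {p..<n} = {..<p}" using assms by auto
  then show "strpt p b ` ({..<n} - {p..<n}) = str p" by (simp add: str_def strpt_def)
  show "strpt p b ` {p..<n} = b ` {..<n - p}"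
    unfolding interval_shift[OF assms] image_image by (simp add: strpt_def)
qed

lemma strpt_sgeneric:
  assumes "p \<le> n" "generic (n - p) b"
  shows "sgeneric n {p..<n} (strpt p b)"
proof -
  have *: "{..<n} - {p..<n} = {..<p}" using assms by auto
  have "inj_on (strpt p b) {p..<n}"
  proof (rule inj_onI)
    fix i j assume ij: "i \<in> {p..<n}" "j \<in> {p..<n}" and "strpt p b i = strpt p b j"
    then have "b (i - p) = b (j - p)" by (simp add: strpt_def)
    then have "i - p = j - p" using assms ij by (auto simp: generic_def dest!: inj_onD)
    then show "i = j" using ij by auto
  qed
  moreover have "inj_on (strpt p b) {..<p}" by (auto simp: strpt_def inj_on_def q1_power_inj)
  ultimately show ?thesis using assms unfolding sgeneric_def * by (auto simp: strpt_def generic_def)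
qed

text \<open>Drops the first \<open>p\<close> exponents, which become part of the coefficient once
  the string is substituted.\<close>

definition shf :: "nat \<Rightarrow> (nat \<Rightarrow>\<^sub>0 nat) \<Rightarrow> (nat \<Rightarrow>\<^sub>0 nat)" where
  "shf p m = Poly_Mapping.map_key (\<lambda>j. j + p) m"

lemma lookup_shf: "Poly_Mapping.lookup (shf p m) j = Poly_Mapping.lookup m (j + p)"
  by (simp add: shf_def map_key.rep_eq)

lemma wt_shf: "wt S (shf p m) = wt ((\<lambda>j. j + p) ` S) m"
  by (simp add: wt_def lookup_shf sum.reindex)

lemma mmon_strpt:
  assumes "Poly_Mapping.keys m \<subseteq> {..<n}" "p \<le> n"
  shows "mmon (strpt p b) m = (\<Prod>i<p. (q1 ^ i) ^ Poly_Mapping.lookup m i) * mmon b (shf p m)"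
proof -
  have n: "{..<n} = {..<p} \<union> (\<lambda>j. j + p) ` {..<n - p}"
    using assms(2) interval_shift[OF assms(2)] by auto
  have "mmon (strpt p b) m = (\<Prod>i\<in>{..<p} \<union> (\<lambda>j. j + p) ` {..<n - p}. strpt p b i ^ Poly_Mapping.lookup m i)"
    by (rule mmon_superset) (use assms n in auto)
  also have "\<dots> = (\<Prod>i<p. strpt p b i ^ Poly_Mapping.lookup m i) *
      (\<Prod>i\<in>(\<lambda>j. j + p) ` {..<n - p}. strpt p b i ^ Poly_Mapping.lookup m i)"
    by (rule prod.union_disjoint) auto
  also have "(\<Prod>i\<in>(\<lambda>j. j + p) ` {..<n - p}. strpt p b i ^ Poly_Mapping.lookup m i) =
      (\<Prod>j<n - p. b j ^ Poly_Mapping.lookup (shf p m) j)"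
    by (simp add: prod.reindex strpt_def lookup_shf)
  also have "\<dots> = mmon b (shf p m)"
  proof (rule mmon_superset[symmetric])
    show "Poly_Mapping.keys (shf p m) \<subseteq> {..<n - p}"
    proof
      fix j assume "j \<in> Poly_Mapping.keys (shf p m)"
      then have "j + p \<in> Poly_Mapping.keys m" by (simp add: in_keys_iff lookup_shf)
      then show "j \<in> {..<n - p}" using assms by auto
    qed
  qed simp
  also have "(\<Prod>i<p. strpt p b i ^ Poly_Mapping.lookup m i) = (\<Prod>i<p. (q1 ^ i) ^ Poly_Mapping.lookup m i)"
    by (simp add: strpt_def)
  finally show ?thesis .
qed

lemma keys_shf:
  assumes "Poly_Mapping.keys m \<subseteq> {..<n}"
  shows "Poly_Mapping.keys (shf p m) \<subseteq> {..<n - p}"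
proof
  fix j assume "j \<in> Poly_Mapping.keys (shf p m)"
  then have "j + p \<in> Poly_Mapping.keys m" by (simp add: in_keys_iff lookup_shf)
  then show "j \<in> {..<n - p}" using assms by auto
qed

text \<open>At \<xi> = 0 the mixed pairs, like the pairs inside the string, involve only string
  points, which are fixed. So the denominator of \<open>Th p F\<close> is again a discriminant up to
  a constant.\<close>

lemma reg_part_strpt:
  assumes "p \<le> n"
  obtains C where "C \<noteq> 0" "\<And>b. poly (reg_part n {p..<n} (strpt p b)) 0 = C * dsc {..<n - p} b"
proof -
  let ?C = "dsc {..<p} (\<lambda>i. q1 ^ i) * (\<Prod>i<p. \<Prod>j\<in>{p..<n}. - (q1 ^ i * q1 ^ i))"
  have "inj_on (\<lambda>i. q1 ^ i) {..<p}" by (auto simp: inj_on_def q1_power_inj)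
  then have nz: "?C \<noteq> 0" by (simp add: dsc_nz)
  have *: "{..<n} - {p..<n} = {..<p}" using assms by auto
  have 1: "dsc {..<p} (strpt p b) = dsc {..<p} (\<lambda>i. q1 ^ i)"
    for b
    by (rule dsc_cong) (simp add: strpt_def)
  have 2: "dsc {p..<n} (strpt p b) = dsc {..<n - p} b" for b
    unfolding interval_shift[OF assms] by (subst dsc_reindex) (auto simp: strpt_def)
  have 3: "(\<Prod>i<p. \<Prod>j\<in>{p..<n}. - (strpt p b i * strpt p b i)) = (\<Prod>i<p. \<Prod>j\<in>{p..<n}. - (q1 ^ i * q1 ^ i))" for b
    by (intro prod.cong refl) (simp add: strpt_def)
  have "poly (reg_part n {p..<n} (strpt p b)) 0 = ?C * dsc {..<n - p} b" for b
    unfolding poly_reg_part_0 * 1 2 3 by (simp only: mult_ac)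
  with nz show ?thesis by (rule that)
qed

lemma Th_rep:
  assumes "rep n F P" "adm n P" "p \<le> n" "generic (n - p) b"
  shows "Th p F (b ` {..<n - p}) =
    ev (part {p..<n} ((n - p) * (n - p - 1)) P) (strpt p b) / poly (reg_part n {p..<n} (strpt p b)) 0"
  using delta_rep[OF assms(1,2) strpt_sgeneric[OF assms(3,4)]] strpt_image[OF assms(3)]
  by (simp add: Th_def)

lemma Bsp_zero: "(\<lambda>V. 0) \<in> Bsp n"
  unfolding Bsp_def
  by (auto simp: supp_def wheel_def adm_def rep_def id.eval_0 intro!: exI[of _ 0])

text \<open>The numerator of \<open>Th p F\<close> is the component of \<open>P\<close> of least
  admissible weight in the free variables, with the string substituted for the others. Its weight
  bounds are those of \<open>P\<close> for shifted index sets, and its total weight is the selected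
  one.\<close>

lemma Th_Bsp:
  assumes F: "F \<in> Bsp n"
  shows "Th p F \<in> Bsp (n - p)"
proof (cases "p \<le> n")
  case False
  then show ?thesis using Th_eq_0[OF BspD(1)[OF F]] Bsp_zero by simp
next
  case p: True
  from F obtain P where P: "adm n P" "rep n F P" by (auto simp: Bsp_def)
  let ?S = "{p..<n}" and ?k = "n - p"
  let ?Q = "part ?S (?k * (?k - 1)) P"
  obtain C where C: "C \<noteq> 0" "\<And>b. poly (reg_part n ?S (strpt p b)) 0 = C * dsc {..<?k} b"
    using reg_part_strpt[OF p] by blast
  define P' where "P' = (\<Sum>m\<in>Poly_Mapping.keys ?Q. Poly_Mapping.single (shf p m)
    (Poly_Mapping.lookup ?Q m * (\<Prod>i<p. (q1 ^ i) ^ Poly_Mapping.lookup m i) / C))"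
  have Q: "m \<in> Poly_Mapping.keys P" "wt ?S m = ?k * (?k - 1)" if "m \<in> Poly_Mapping.keys ?Q" for m
    using that by (auto simp: part_def keys_pfilter)
  have keys: "Poly_Mapping.keys m \<subseteq> {..<n}" if "m \<in> Poly_Mapping.keys ?Q" for m
    using Q(1)[OF that] P(1) by (auto simp: adm_def)
  have ev: "ev P' b = ev ?Q (strpt p b) / C" for b
    unfolding P'_def id.eval_alt[of _ ?Q]
    by (simp add: mmon_strpt[OF keys p] sum_divide_distrib mult.assoc)
  have "rep ?k (Th p F) P'"
    unfolding rep_def
  proof (intro allI impI)
    fix b :: "nat \<Rightarrow> coef" assume b: "generic ?k b"
    have "dsc {..<?k} b \<noteq> 0" using b by (simp add: dsc_nz generic_def)
    then show "Th p F (b ` {..<?k}) * dsc {..<?k} b = ev P' b"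
      unfolding Th_rep[OF P(2,1) p b] ev C(2) using C(1) by (simp add: field_simps)
  qed
  moreover have "adm ?k P'"
    unfolding adm_def
  proof
    fix m' assume "m' \<in> Poly_Mapping.keys P'"
    then have "m' \<in> (\<Union>m\<in>Poly_Mapping.keys ?Q. Poly_Mapping.keys (Poly_Mapping.single (shf p m)
        (Poly_Mapping.lookup ?Q m * (\<Prod>i<p. (q1 ^ i) ^ Poly_Mapping.lookup m i) / C)))"
      unfolding P'_def by (rule subsetD[OF Poly_Mapping.keys_sum])
    then obtain m where m: "m \<in> Poly_Mapping.keys ?Q" "m' \<in> Poly_Mapping.keys (Poly_Mapping.single (shf p m)
        (Poly_Mapping.lookup ?Q m * (\<Prod>i<p. (q1 ^ i) ^ Poly_Mapping.lookup m i) / C))"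
      by (rule UN_E)
    then have m': "m' = shf p m" by (simp split: if_splits)
    have "card S * (card S - 1) \<le> wt S (shf p m)" if "S \<subseteq> {..<?k}" for S
    proof -
      have "(\<lambda>j. j + p) ` S \<subseteq> {..<n}" using that by auto
      moreover have "card ((\<lambda>j. j + p) ` S) = card S" by (simp add: card_image)
      ultimately show ?thesis using low_weightD[OF P(1) Q(1)[OF m(1)]] unfolding wt_shf by metis
    qed
    moreover have "wt {..<?k} (shf p m) = ?k * (?k - 1)"
      using Q(2)[OF m(1)] unfolding wt_shf interval_shift[OF p] .
    ultimately show "Poly_Mapping.keys m' \<subseteq> {..<?k} \<and>
        (\<forall>S\<subseteq>{..<?k}. card S * (card S - 1) \<le> wt S m') \<and> wt {..<?k} m' = ?k * (?k - 1)"
      unfolding m' using keys_shf[OF keys[OF m(1)]] by blast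
  qed
  ultimately show ?thesis
    using supp_Th[OF BspD(1)[OF F]] wheel_Th[OF BspD(1,2)[OF F]] unfolding Bsp_def by blast
qed

section \<open>Vanishing on strings\<close>

text \<open>The exponents of those \<open>x = q\<^sub>1^i q\<^sub>2^j\<close> for which \<open>str p \<union> {x}\<close> contains a wheel or a longer
  string.\<close>

definition string_zeros :: "nat \<Rightarrow> (int \<times> int) set" where
  "string_zeros p = (\<lambda>a. (int a + 1, 1)) ` {..<p - 1} \<union> (\<lambda>a. (int a, -1)) ` {..<p - 1} \<union> {(int p, 0), (-1, 0)}"

lemma card_string_zeros:
  assumes "p \<ge> 1"
  shows "card (string_zeros p) = 2 * p" "finite (string_zeros p)"
proof -
  have "card ((\<lambda>a. (int a + 1, 1::int)) ` {..<p - 1}) = p - 1" "card ((\<lambda>a. (int a, -1::int)) ` {..<p - 1}) = p - 1"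
    by (simp_all add: card_image inj_on_def)
  moreover have "card {(int p, 0::int), (-1, 0)} = 2" by simp
  moreover have "((\<lambda>a. (int a + 1, 1::int)) ` {..<p - 1} \<union> (\<lambda>a. (int a, -1)) ` {..<p - 1}) \<inter> {(int p, 0), (-1, 0)} = {}"
    by auto
  moreover have "(\<lambda>a. (int a + 1, 1::int)) ` {..<p - 1} \<inter> (\<lambda>a. (int a, -1)) ` {..<p - 1} = {}"
    by auto
  ultimately show "card (string_zeros p) = 2 * p"
    unfolding string_zeros_def using assms by (simp add: card_Un_disjoint)
qed (simp add: string_zeros_def)

text \<open>The point \<open>q1 ^ (a + 1) * q2\<close> completes one kind of wheel through
  \<open>q1 ^ a\<close> and \<open>q1 ^ (a + 1)\<close>, and \<open>q1 ^ a / q2\<close> completes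
  the other kind through the same two; \<open>q1 ^ p\<close> and \<open>1 / q1\<close> lengthen the
  string.\<close>

lemma string_zero_vanish:
  assumes "wheel F" "vstr (Suc p) F" "p \<ge> 1" "str p \<subseteq> V" "(i, j) \<in> string_zeros p" "qm i j \<in> V"
  shows "F V = 0"
proof -
  have st: "q1 ^ a \<in> V" if "a < p" for a using that assms(4) by (auto simp: str_in_iff subset_iff)
  consider a where "a < p - 1" "i = int a + 1" "j = 1" | a where "a < p - 1" "i = int a" "j = -1"
    | "i = int p" "j = 0" | "i = -1" "j = 0"
    using assms(5) by (auto simp: string_zeros_def)
  then show ?thesis
  proof cases
    case 1
    then have "qm i j = q1 * q2 * q1 ^ a" by (simp add: qm_def power_int_add)
    then show ?thesis using assms(1,6) st[of a] st[of "Suc a"] 1(1)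
      by (intro wheelD[of F q1 q2 "q1 ^ a"]) auto
  next
    case 2
    then have x: "q2 * qm i j = q1 ^ a" "q1 * q2 * qm i j = q1 ^ Suc a"
      by (simp_all add: qm_def power_int_minus)
    have "q1 * q2 * qm i j \<in> V" unfolding x(2) using st[of "Suc a"] 2(1) by simp
    moreover have "q2 * qm i j \<in> V" unfolding x(1) using st[of a] 2(1) by simp
    ultimately show ?thesis
      using wheelD[OF assms(1), of q2 q1 "qm i j" V] assms(6) by (simp add: insert_commute)
  next
    case 3
    then have "qm i j = q1 ^ p" by (simp add: qm_def)
    then have "(*) 1 ` str (Suc p) \<subseteq> V" using st assms(6) by (auto simp: str_def less_Suc_eq)
    then show ?thesis using assms(2) unfolding vstr_def by (metis zero_neq_one)
  next
    case 4
    then have q: "qm i j = 1 / q1" by (simp add: qm_def power_int_minus field_simps)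
    have "(*) (1 / q1) ` str (Suc p) \<subseteq> V"
    proof
      fix x assume "x \<in> (*) (1 / q1) ` str (Suc p)"
      then obtain a where a: "a < Suc p" "x = 1 / q1 * q1 ^ a" by (auto simp: str_def)
      show "x \<in> V"
      proof (cases a)
        case 0
        then show ?thesis using a assms(6) q by simp
      next
        case (Suc a')
        then show ?thesis using a st[of a'] by simp
      qed
    qed
    then show ?thesis using assms(2) unfolding vstr_def by (metis divide_eq_0_iff q1_nz zero_neq_one)
  qed
qed

text \<open>Rescaling the free points \<open>Z\<close> by \<open>\<xi>\<close>, the numerator of \<open>F(str p \<union> \<xi>Z)\<close> is, up to a power
  of \<open>\<xi>\<close>, a polynomial of degree at most \<open>2pk\<close> for \<open>k = card Z\<close>. The wheel condition and the
  vanishing on longer strings give \<open>2pk\<close> zeros, which are distinct when \<open>Z\<close> consists of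
  distinct positive integers; \<open>\<Theta>\<^sub>p F = 0\<close> adds the zero \<open>\<xi> = 0\<close>.\<close>

lemma string_numerator_zero:
  assumes F: "F \<in> Bsp n" and P: "adm n P" "rep n F P" and p: "1 \<le> p" "p \<le> n"
    and v: "vstr (Suc p) F" and Th: "Th p F = (\<lambda>Z. 0)"
    and b: "inj b" "\<And>i. b i > (0::nat)"
  shows "ev P (strpt p (\<lambda>i. of_nat (b i))) = 0"
proof -
  let ?S = "{p..<n}" and ?k = "n - p"
  let ?a = "strpt p (\<lambda>i. of_nat (b i))" and ?lo = "?k * (?k - 1)"
  define N where "N = scaled ?S ?a P"
  have gen: "generic ?k (\<lambda>i. of_nat (b i) :: coef)" using b by (rule generic_of_nat)
  have sg: "sgeneric n ?S ?a" by (rule strpt_sgeneric[OF p(2) gen])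
  have coeff: "coeff N j = ev (part ?S j P) ?a" for j by (simp add: N_def coeff_scaled)
  \<comment> \<open>One more than the weight condition gives; the gain is the vanishing of the limit
    \<open>Th p F\<close>.\<close>
  have low: "coeff N j = 0" if "j < Suc ?lo" for j
  proof (cases "j = ?lo")
    case True
    have "ev (part ?S ?lo P) ?a = 0"
      using Th_rep[OF P(2,1) p(2) gen] poly_reg_part_0_nz[OF sg] by (simp add: Th)
    then show ?thesis using True coeff by simp
  next
    case False
    have "?lo \<le> wt ?S m" if "m \<in> Poly_Mapping.keys P" for m
      using low_weightD[OF P(1) that, of ?S] by (simp add: subset_iff)
    then have "part ?S j P = 0" unfolding part_0_iff using that False by fastforce
    then show ?thesis by (simp add: coeff)
  qed
  \<comment> \<open>The first \<open>p\<close> variables take at least \<open>p * (p - 1)\<close> of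
    the total weight \<open>n * (n - 1)\<close>, so the weight in the free variables exceeds
    \<open>?lo\<close> by at most \<open>2 * p * ?k\<close>.\<close>
  have high: "coeff N j = 0" if j: "j \<ge> Suc ?lo + 2 * p * ?k" for j
  proof -
    have "wt ?S m \<noteq> j" if m: "m \<in> Poly_Mapping.keys P" for m
    proof -
      have "wt {..<n} m = wt {..<p} m + wt ?S m"
        unfolding wt_def using p(2) by (metis lessThan_atLeast0 sum.atLeastLessThan_concat zero_le)
      moreover have "p * (p - 1) \<le> wt {..<p} m"
        using low_weightD[OF P(1) m, of "{..<p}"] p(2) by auto
      moreover have "wt {..<n} m = n * (n - 1)" using P(1) m by (simp add: adm_def)
      moreover have "n * (n - 1) = p * (p - 1) + (?lo + 2 * p * ?k)"
      proof -
        obtain d where d: "n = p + d" using p(2) le_Suc_ex by blast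
        obtain p' where p': "p = Suc p'" using p(1) by (cases p) auto
        show ?thesis unfolding d p' by (cases d) (simp_all add: algebra_simps)
      qed
      ultimately show ?thesis using j by linarith
    qed
    then have "part ?S j P = 0" by (simp add: part_0_iff)
    then show ?thesis by (simp add: coeff)
  qed
  obtain N' where N': "N = monom 1 (Suc ?lo) * N'" "\<And>j. coeff N' j = coeff N (j + Suc ?lo)"
    using low_coeffs_factor[of "Suc ?lo" N] low by blast
  \<comment> \<open>The scale \<open>qm i j / of_nat (b l)\<close> carries the free point
    \<open>b l\<close> to the exceptional position \<open>qm i j\<close>.\<close>
  define R where "R = (\<lambda>((i, j), l). qm i j / of_nat (b l)) ` (string_zeros p \<times> {..<?k})"
  have inj: "inj_on (\<lambda>((i, j), l). qm i j / of_nat (b l)) (string_zeros p \<times> {..<?k})"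
  proof (rule inj_onI)
    fix u v
    assume uv: "(\<lambda>((i, j), l). qm i j / of_nat (b l)) u = (\<lambda>((i, j), l). qm i j / of_nat (b l)) v"
    obtain i j l where u: "u = ((i, j), l)" by (metis surj_pair)
    obtain i' j' l' where v: "v = ((i', j'), l')" by (metis surj_pair)
    have "of_nat (b l') * qm i j = of_nat (b l) * qm i' j'"
      using uv b(2)[of l] b(2)[of l'] by (simp add: u v field_simps)
    then have "b l' = b l \<and> i = i' \<and> j = j'" using b(2) by (intro qm_independent) auto
    then show "u = v" using b(1) by (auto simp: u v dest: injD)
  qed
  have cardR: "card R = 2 * p * ?k"
    unfolding R_def by (simp add: card_image[OF inj] card_cartesian_product card_string_zeros[OF p(1)])
  have root: "poly N' x = 0" if "x \<in> R" for x
  proof -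
    obtain i j l where ij: "(i, j) \<in> string_zeros p" "l < ?k" "x = qm i j / of_nat (b l)"
      using \<open>x \<in> R\<close> by (auto simp: R_def)
    have x: "x \<noteq> 0" "x * of_nat (b l) = qm i j" using ij b(2)[of l] by simp_all
    \<comment> \<open>No scaled free point may fall on the string, since \<open>rep\<close> speaks
      of \<open>F\<close> only on configurations of \<open>n\<close> distinct points.\<close>
    have disj: "?a ` ({..<n} - ?S) \<inter> (*) x ` (?a ` ?S) = {}"
    proof -
      have "q1 ^ s \<noteq> x * of_nat (b t)" if "s < p" for s t
      proof
        assume "q1 ^ s = x * of_nat (b t)"
        then have "of_nat (b l) * qm (int s) 0 = of_nat (b t) * qm i j"
          unfolding x(2)[symmetric] by (simp add: qm_def mult_ac)
        then have "b l = b t \<and> int s = i \<and> 0 = j" using b(2) by (intro qm_independent) auto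
        then show False using ij(1) \<open>s < p\<close> by (auto simp: string_zeros_def)
      qed
      then show ?thesis unfolding strpt_image[OF p(2)] by (auto simp: str_def)
    qed
    have "F (?a ` ({..<n} - ?S) \<union> (*) x ` (?a ` ?S)) = 0"
    proof (rule string_zero_vanish[OF BspD(2)[OF F] v p(1) _ ij(1)])
      show "qm i j \<in> ?a ` ({..<n} - ?S) \<union> (*) x ` (?a ` ?S)"
        unfolding strpt_image[OF p(2)] x(2)[symmetric] using ij(2) by blast
    qed (simp add: strpt_image[OF p(2)])
    then have "poly N x = 0" using rep_scaled[OF P(2) sg x(1) disj] by (simp add: N_def)
    then show ?thesis using x(1) by (simp add: N'(1) poly_monom)
  qed
  have "N' = 0"
  proof (rule ccontr)
    assume nz: "N' \<noteq> 0"
    have "degree N' < 2 * p * ?k"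
    proof (rule ccontr)
      assume "\<not> degree N' < 2 * p * ?k"
      then have "coeff N' (degree N') = 0" unfolding N'(2) by (intro high) simp
      then show False using nz by simp
    qed
    moreover have "card R \<le> card {x. poly N' x = 0}"
      by (rule card_mono) (use root poly_roots_finite[OF nz] in auto)
    moreover have "card {x. poly N' x = 0} \<le> degree N'"
      using nz by (rule card_poly_roots_bound)
    ultimately show False using cardR by simp
  qed
  then have "poly N 1 = 0" by (simp add: N'(1))
  then show ?thesis by (simp add: N_def poly_scaled cong: if_cong)
qed

text \<open>Integer free points are enough: with the string substituted, the numerator is a
  polynomial in the free points, and a nonzero one would have a nonzero value at some distinct
  positive integers. Homogeneity moves the start of a string from \<open>y\<close> to 1.\<close>

lemma vstr_step:
  assumes F: "F \<in> Bsp n" and p: "1 \<le> p" "p \<le> n"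
    and v: "vstr (Suc p) F" and Th: "Th p F = (\<lambda>Z. 0)"
  shows "vstr p F"
  unfolding vstr_def
proof (intro allI impI, rule ccontr)
  fix V and y :: coef assume y: "y \<noteq> 0 \<and> (*) y ` str p \<subseteq> V" and nz: "F V \<noteq> 0"
  from F obtain P where P: "adm n P" "rep n F P" by (auto simp: Bsp_def)
  define P' where "P' = mpol_eval Cm (\<lambda>i. if i < p then Cm (q1 ^ i) else Xm (i - p)) P"
  have ev: "ev P' b = ev P (strpt p b)" for b
    unfolding P'_def eval_compose[OF id.coef_hom_axioms]
    by (rule arg_cong[where f = "\<lambda>a. ev P a"]) (auto simp: strpt_def)
  have "P' = 0"
  proof (rule ccontr)
    assume "P' \<noteq> 0"
    then obtain b :: "nat \<Rightarrow> nat" where "inj b" "\<And>i. b i > 0" "ev P' (\<lambda>i. of_nat (b i)) \<noteq> 0"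
      using mpol_nonzero_value by metis
    then show False using string_numerator_zero[OF F P p v Th] ev by metis
  qed
  let ?V = "(*) (1 / y) ` V"
  have V: "finite V" "card V = n" "0 \<notin> V" using nz BspD(1)[OF F] by (auto simp: supp_def)
  have "1 / y \<noteq> 0" using y by simp
  then have FV: "F ?V = F V" using BspD(3)[OF F] unfolding homog_def by blast
  have finV: "finite ?V" "card ?V = n" "0 \<notin> ?V"
    using V y card_image[OF inj_on_scale[OF \<open>1 / y \<noteq> 0\<close>], of V] by auto
  have strV: "str p \<subseteq> ?V"
  proof
    fix x assume "x \<in> str p"
    then have "y * x \<in> V" using y by auto
    then show "x \<in> ?V" using y by (auto simp: image_iff intro!: bexI[of _ "y * x"])
  qed
  have "card (?V - str p) = n - p" using strV finV by (simp add: card_Diff_subset)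
  then obtain b where b: "bij_betw b {..<n - p} (?V - str p)"
    using finV(1) by (metis finite_Diff ex_bij_betw_nat_finite lessThan_atLeast0)
  have gb: "generic (n - p) b" using b finV by (auto simp: generic_def bij_betw_def)
  have im: "b ` {..<n - p} = ?V - str p" using b by (simp add: bij_betw_def)
  have sg: "sgeneric n {p..<n} (strpt p b)" by (rule strpt_sgeneric[OF p(2) gb])
  have "generic n (strpt p b)" "strpt p b ` {..<n} = ?V"
  proof -
    have g: "generic n (\<lambda>i. if i \<in> {p..<n} then 1 * strpt p b i else strpt p b i)"
      by (rule generic_scaled[OF sg]) (auto simp: strpt_image[OF p(2)] im)
    then show "generic n (strpt p b)" by (simp cong: if_cong)
    have "{..<n} = ({..<n} - {p..<n}) \<union> {p..<n}" using p by auto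
    then have "strpt p b ` {..<n} = strpt p b ` ({..<n} - {p..<n}) \<union> strpt p b ` {p..<n}"
      by (metis image_Un)
    then show "strpt p b ` {..<n} = ?V" unfolding strpt_image[OF p(2)] im using strV by auto
  qed
  then have "F ?V * dsc {..<n} (strpt p b) = 0" "dsc {..<n} (strpt p b) \<noteq> 0"
    using P(2) ev[of b] \<open>P' = 0\<close> by (auto simp: rep_def dsc_nz generic_def)
  then show False using FV nz by simp
qed

text \<open>Descending induction from \<open>n + 1\<close>, where the string does not fit into
  \<open>n\<close> points.\<close>

lemma vstr_of_Th:
  assumes F: "F \<in> Bsp n" and Th: "\<And>r. r > p \<Longrightarrow> Th r F = (\<lambda>Z. 0)"
  shows "vstr (Suc p) F"
proof -
  have big: "vstr r F" if r: "r > n" for r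
    unfolding vstr_def
  proof (intro allI impI, rule ccontr)
    fix V and y :: coef assume y: "y \<noteq> 0 \<and> (*) y ` str r \<subseteq> V" and "F V \<noteq> 0"
    then have "finite V" "card V = n" using BspD(1)[OF F] by (auto simp: supp_def)
    moreover have "card ((*) y ` str r) = r" using y by (simp add: card_image inj_on_scale)
    ultimately show False using y r by (metis card_mono not_le)
  qed
  show ?thesis
  proof (cases "p < n")
    case True
    then have "Suc p \<le> Suc n" by simp
    then show ?thesis
    proof (induction rule: inc_induct)
      case (step r)
      then show ?case using vstr_step[OF F, of r] Th by simp
    qed (simp add: big)
  qed (simp add: big)
qed

text \<open>Every nonempty set of nonzero points contains a string of length 1, where the descent
  ends; \<open>n \<ge> 1\<close> excludes the value at the empty set.\<close>

lemma Bsp_eq_0I: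
  assumes F: "F \<in> Bsp n" and n: "n \<ge> 1" and Th: "\<And>r. r \<ge> 1 \<Longrightarrow> Th r F = (\<lambda>Z. 0)"
  shows "F = (\<lambda>V. 0)"
proof (rule ext, rule ccontr)
  fix V assume nz: "F V \<noteq> 0"
  then have "finite V" "card V = n" "0 \<notin> V" using BspD(1)[OF F] by (auto simp: supp_def)
  with n obtain y where y: "y \<in> V" "y \<noteq> 0" by (metis card.empty ex_in_conv not_one_le_zero)
  have "vstr (Suc 0) F" by (rule vstr_of_Th[OF F]) (simp add: Th)
  moreover have "(*) y ` str (Suc 0) \<subseteq> V" using y by (simp add: str_def lessThan_Suc)
  ultimately show False using y nz by (auto simp: vstr_def)
qed

section \<open>The star product on the enlarged spaces\<close>

definition pairs :: "nat \<Rightarrow> (nat \<times> nat) set" where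
  "pairs n = {(i, j). i < j \<and> j < n}"

lemma finite_pairs [simp]: "finite (pairs n)"
  by (rule finite_subset[of _ "{..<n} \<times> {..<n}"]) (auto simp: pairs_def)

definition vd :: "(nat \<times> nat) set \<Rightarrow> (nat \<Rightarrow> 'b::comm_ring_1) \<Rightarrow> 'b" where
  "vd E a = (\<Prod>(i, j)\<in>E. a i - a j)"

lemma (in coef_hom) eval_vd: "mpol_eval h A (vd E B) = vd E (\<lambda>i. mpol_eval h A (B i))"
  by (simp add: vd_def case_prod_unfold)

lemma Xm_eq_iff: "Xm i = Xm j \<longleftrightarrow> i = j"
proof
  assume "Xm i = Xm j"
  then have "ev (Xm i) (\<lambda>k. of_nat k) = ev (Xm j) (\<lambda>k. of_nat k)" by simp
  then show "i = j" by simp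
qed simp

text \<open>A symmetric function whose product with \<open>x\<^sub>i - x\<^sub>j\<close> is polynomial is itself polynomial:
  the product is antisymmetric, hence vanishes on \<open>x\<^sub>i = x\<^sub>j\<close>.\<close>

lemma clear_simple_poles:
  assumes "E \<subseteq> pairs n"
    and sym: "\<And>a i j. generic n a \<Longrightarrow> (i, j) \<in> pairs n \<Longrightarrow> T (a \<circ> Transposition.transpose i j) = T a"
    and "\<And>a. generic n a \<Longrightarrow> T a * vd E a = ev Q a"
  shows "\<exists>Q'. \<forall>a. generic n a \<longrightarrow> T a = ev Q' a"
proof -
  have "finite E" using assms(1) finite_pairs finite_subset by blast
  then show ?thesis using assms(1,3)
  proof (induction E arbitrary: Q)
    case empty
    then show ?case by (auto simp: vd_def)
  next
    case (insert p E)
    obtain i j where p: "p = (i, j)" by (cases p)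
    have ij: "i < j" "j < n" "(i, j) \<in> pairs n" using insert.prems(1) by (auto simp: p pairs_def)
    have vdi: "vd (insert p E) a = (a i - a j) * vd E a" for a :: "nat \<Rightarrow> coef"
      using insert.hyps by (simp add: vd_def p)
    let ?\<tau> = "Transposition.transpose i j"
    define Q\<tau> where "Q\<tau> = mpol_eval Cm (\<lambda>k. Xm (?\<tau> k)) Q"
    have evQ\<tau>: "ev Q\<tau> a = ev Q (a \<circ> ?\<tau>)" for a
      unfolding Q\<tau>_def eval_compose[OF id.coef_hom_axioms] by (simp add: o_def)
    \<comment> \<open>Antisymmetry of the product, cross-multiplied because the transposition need
      not preserve the remaining differences \<open>E\<close>.\<close>
    have eqn: "Q * vd E (\<lambda>k. Xm (?\<tau> k)) + Q\<tau> * vd E Xm = 0"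
    proof (rule mpol_eq_0I[of n])
      fix a :: "nat \<Rightarrow> coef" assume a: "generic n a"
      have "?\<tau> permutes {..<n}" using ij by (simp add: permutes_swap_id)
      then have gen: "generic n (a \<circ> ?\<tau>)"
        using a unfolding generic_def
        by (auto simp: permutes_in_image permutes_inj_on permutes_image intro!: comp_inj_on) (meson lessThan_iff permutes_in_image)
      have e1: "T a * ((a \<circ> ?\<tau>) i - (a \<circ> ?\<tau>) j) * vd E (a \<circ> ?\<tau>) = ev Q (a \<circ> ?\<tau>)"
        by (rule insert.prems(2)[OF gen, unfolded vdi sym[OF a ij(3)] mult.assoc[symmetric]])
      have e2: "T a * (a i - a j) * vd E a = ev Q a"
        using insert.prems(2)[OF a] by (simp add: vdi)
      have "ev Q a * vd E (a \<circ> ?\<tau>) + ev Q (a \<circ> ?\<tau>) * vd E a = 0"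
        unfolding e1[symmetric] e2[symmetric] by (simp add: algebra_simps)
      then show "ev (Q * vd E (\<lambda>k. Xm (?\<tau> k)) + Q\<tau> * vd E Xm) a = 0"
        by (simp add: evQ\<tau> id.eval_vd o_def)
    qed
    have anti: "ev Q a * vd E (a \<circ> ?\<tau>) + ev Q (a \<circ> ?\<tau>) * vd E a = 0" for a
      using arg_cong[OF eqn, of "\<lambda>P. ev P a"] by (simp add: evQ\<tau> id.eval_vd o_def)
    \<comment> \<open>Identifies the variable \<open>i\<close> with \<open>j\<close>. The
      transposition fixes such points, so the relation above reads twice a product equals 0.\<close>
    define \<sigma> where "\<sigma> = (\<lambda>k. if k = i then j else k)"
    define Q0 where "Q0 = mpol_eval Cm (\<lambda>k. Xm (\<sigma> k)) Q"
    have "Q0 * vd E (\<lambda>k. Xm (\<sigma> k)) = 0"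
    proof (rule mpol_eq_0I[of n])
      fix a :: "nat \<Rightarrow> coef"
      have "(a \<circ> \<sigma>) \<circ> ?\<tau> = a \<circ> \<sigma>" by (auto simp: \<sigma>_def Transposition.transpose_def fun_eq_iff)
      then have "2 * (ev Q (a \<circ> \<sigma>) * vd E (a \<circ> \<sigma>)) = 0" using anti[of "a \<circ> \<sigma>"] by auto
      then show "ev (Q0 * vd E (\<lambda>k. Xm (\<sigma> k))) a = 0"
        by (simp add: Q0_def eval_compose[OF id.coef_hom_axioms] id.eval_vd o_def)
    qed
    moreover have "vd E (\<lambda>k. Xm (\<sigma> k)) \<noteq> 0"
    proof -
      \<comment> \<open>Only the difference for \<open>(i, j)\<close> could become 0, and this pair
        is not in \<open>E\<close>.\<close>
      have "\<sigma> k \<noteq> \<sigma> l" if "(k, l) \<in> E" for k l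
      proof -
        have "(k, l) \<noteq> (i, j)" "k < l" using that insert.hyps insert.prems(1) by (auto simp: p pairs_def)
        then show ?thesis using ij by (auto simp: \<sigma>_def)
      qed
      then show ?thesis using insert.hyps by (auto simp: vd_def Xm_eq_iff)
    qed
    ultimately have "Q0 = 0" by simp
    moreover have "Xm i - Xm j dvd mpol_eval Cm Xm Q - Q0"
      unfolding Q0_def by (rule Cm.eval_dvd_diff) (simp add: \<sigma>_def)
    ultimately obtain Q1 where Q1: "Q = (Xm i - Xm j) * Q1" by (auto simp: mpol_eval_Cm_Xm)
    have "T a * vd E a = ev Q1 a" if a: "generic n a" for a
    proof -
      have "a i - a j \<noteq> 0" using a ij by (auto simp: generic_def inj_on_def)
      moreover have "(a i - a j) * (T a * vd E a) = (a i - a j) * ev Q1 a"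
        using insert.prems(2)[OF a] by (simp add: vdi Q1 mult_ac)
      ultimately show ?thesis by simp
    qed
    then show ?case using insert.IH insert.prems(1) by blast
  qed
qed

section \<open>Poles of the terms of a product\<close>

definition split_pair :: "nat set \<Rightarrow> nat \<times> nat \<Rightarrow> bool" where
  "split_pair I p \<longleftrightarrow> (fst p \<in> I) \<noteq> (snd p \<in> I)"

lemma prod_split_pairs:
  assumes "I \<subseteq> {..<n}"
  shows "(\<Prod>i\<in>I. \<Prod>j\<in>{..<n} - I. g i j) =
    (\<Prod>(i, j) | (i, j) \<in> pairs n \<and> split_pair I (i, j). if i \<in> I then g i j else g j i)"
proof -
  have "(\<Prod>i\<in>I. \<Prod>j\<in>{..<n} - I. g i j) = (\<Prod>(i, j)\<in>I \<times> ({..<n} - I). g i j)"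
    by (rule prod.cartesian_product)
  also have "\<dots> = (\<Prod>(i, j)\<in>{p \<in> pairs n. split_pair I p}. if i \<in> I then g i j else g j i)"
    by (rule prod.reindex_bij_witness[where
          i = "\<lambda>(i, j). if i \<in> I then (i, j) else (j, i)" and j = "\<lambda>(i, j). if i < j then (i, j) else (j, i)"])
      (use assms in \<open>auto simp: pairs_def split_pair_def split: if_splits\<close>, (metis lessThan_iff linorder_neqE_nat subsetD)+)
  finally show ?thesis by (simp add: case_prod_unfold)
qed

definition numX :: "nat \<Rightarrow> nat \<Rightarrow> mpol" where
  "numX i j = (Xm i - Cm q1 * Xm j) * (Xm i - Cm q2 * Xm j) * (Xm i - Cm q3 * Xm j)"

lemma om_numX: "x \<noteq> y \<Longrightarrow> a i = x \<Longrightarrow> a j = y \<Longrightarrow> om x y * (x - y) ^ 3 = ev (numX i j) a"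
  by (simp add: om_def numX_def)

lemma rep_enum:
  assumes "rep m F P" "generic n a" "bij_betw e {..<m} I" "I \<subseteq> {..<n}"
  shows "F (a ` I) * dsc I a = ev (mpol_eval Cm (\<lambda>k. Xm (e k)) P) a"
proof -
  have e: "inj_on e {..<m}" "e ` {..<m} = I" using assms(3) by (auto simp: bij_betw_def)
  have "inj_on a (e ` {..<m})" using assms(2,4) e(2) by (auto simp: generic_def inj_on_subset)
  then have "inj_on (a \<circ> e) {..<m}" using e(1) by (rule comp_inj_on[rotated])
  moreover have "e k < n" if "k < m" for k using e(2) assms(4) that by blast
  ultimately have "generic m (\<lambda>k. a (e k))"
    using assms(2) by (simp add: generic_def o_def)
  then have "F ((\<lambda>k. a (e k)) ` {..<m}) * dsc {..<m} (\<lambda>k. a (e k)) = ev P (\<lambda>k. a (e k))"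
    using assms(1) by (simp add: rep_def)
  moreover have "(\<lambda>k. a (e k)) ` {..<m} = a ` I" using e(2) by auto
  moreover have "dsc {..<m} (\<lambda>k. a (e k)) = dsc I a" by (simp only: dsc_reindex[OF e(1), unfolded e(2)])
  ultimately show ?thesis by (simp add: eval_compose[OF id.coef_hom_axioms])
qed

text \<open>Across the division \<open>om\<close> has poles of order three: the discriminant clears
  two orders and \<open>vd\<close> the third. Inside the two parts the discriminant clears the
  denominators of \<open>F\<close> and \<open>G\<close>.\<close>

lemma conv_term_rep:
  assumes F: "rep m F P" and G: "rep n G Q" and I: "I \<subseteq> {..<m + n}" "card I = m"
  shows "\<exists>K. \<forall>a. generic (m + n) a \<longrightarrow>
    F (a ` I) * G (a ` ({..<m + n} - I)) * Om (a ` I) (a ` ({..<m + n} - I)) *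
      dsc {..<m + n} a * vd (pairs (m + n)) a = ev K a"
proof -
  let ?N = "m + n" and ?J = "{..<m + n} - I"
  have finI: "finite I" using I finite_subset by blast
  obtain e where e: "bij_betw e {..<m} I"
    using ex_bij_betw_nat_finite[OF finI] I(2) by (auto simp: lessThan_atLeast0)
  have "card ?J = n" using I finI by (simp add: card_Diff_subset)
  then obtain e' where e': "bij_betw e' {..<n} ?J"
    using ex_bij_betw_nat_finite[of ?J] by (auto simp: lessThan_atLeast0)
  \<comment> \<open>For a divided pair the three differences multiply to
    \<open>- ((a i - a j) ^ 3)\<close> if \<open>i \<in> I\<close> and to
    \<open>(a j - a i) ^ 3\<close> otherwise; hence the sign. Undivided pairs keep their factor of
    \<open>vd\<close>.\<close>
  define K where "K = mpol_eval Cm (\<lambda>k. Xm (e k)) P * mpol_eval Cm (\<lambda>k. Xm (e' k)) Q *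
    (\<Prod>(i, j)\<in>pairs ?N. if split_pair I (i, j) then (if i \<in> I then - numX i j else numX j i) else Xm i - Xm j)"
  have "F (a ` I) * G (a ` ?J) * Om (a ` I) (a ` ?J) * dsc {..<?N} a * vd (pairs ?N) a = ev K a"
    if a: "generic ?N a" for a
  proof -
    have inj: "inj_on a {..<?N}" using a by (simp add: generic_def)
    have ne: "a i \<noteq> a j" if "i < ?N" "j < ?N" "i \<noteq> j" for i j
      using inj that by (auto simp: inj_on_def)
    have "{..<?N} = I \<union> ?J" using I by auto
    then have dsc: "dsc {..<?N} a = dsc I a * dsc ?J a * mixed I ?J a"
      using dsc_Un[of I ?J a] finI by auto
    have inj': "inj_on a I" "inj_on a ?J" using inj I(1) by (auto simp: inj_on_def)
    have "Om (a ` I) (a ` ?J) * mixed I ?J a = (\<Prod>i\<in>I. \<Prod>j\<in>?J. om (a i) (a j) * ((a i - a j) * (a j - a i)))"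
      by (simp add: Om_def mixed_def prod.reindex[OF inj'(1)] prod.reindex[OF inj'(2)] prod.distrib)
    also have "\<dots> = (\<Prod>(i, j) | (i, j) \<in> pairs ?N \<and> split_pair I (i, j).
        if i \<in> I then om (a i) (a j) * ((a i - a j) * (a j - a i)) else om (a j) (a i) * ((a j - a i) * (a i - a j)))"
      by (rule prod_split_pairs[OF I(1)])
    also have "\<dots> = (\<Prod>(i, j)\<in>pairs ?N. if split_pair I (i, j) then
        (if i \<in> I then om (a i) (a j) * ((a i - a j) * (a j - a i)) else om (a j) (a i) * ((a j - a i) * (a i - a j))) else 1)"
      by (simp add: case_prod_unfold prod.inter_filter[symmetric])
    finally have "Om (a ` I) (a ` ?J) * mixed I ?J a * vd (pairs ?N) a =
      (\<Prod>(i, j)\<in>pairs ?N. (if split_pair I (i, j) then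
        (if i \<in> I then om (a i) (a j) * ((a i - a j) * (a j - a i)) else om (a j) (a i) * ((a j - a i) * (a i - a j))) else 1)
        * (a i - a j))"
      by (simp add: vd_def case_prod_unfold prod.distrib)
    also have "\<dots> = (\<Prod>(i, j)\<in>pairs ?N.
        ev (if split_pair I (i, j) then (if i \<in> I then - numX i j else numX j i) else Xm i - Xm j) a)"
    proof (rule prod.cong[OF refl], clarify)
      fix i j assume "(i, j) \<in> pairs ?N"
      then have "a i \<noteq> a j" by (intro ne) (auto simp: pairs_def)
      then have "om (a i) (a j) * (a i - a j) ^ 3 = ev (numX i j) a" "om (a j) (a i) * (a j - a i) ^ 3 = ev (numX j i) a"
        by (auto intro!: om_numX)
      moreover have "om (a i) (a j) * ((a i - a j) * (a j - a i)) * (a i - a j) = - (om (a i) (a j) * (a i - a j) ^ 3)"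
        "om (a j) (a i) * ((a j - a i) * (a i - a j)) * (a i - a j) = om (a j) (a i) * (a j - a i) ^ 3"
        by (simp_all add: power3_eq_cube algebra_simps)
      ultimately show "(if split_pair I (i, j) then (if i \<in> I then om (a i) (a j) * ((a i - a j) * (a j - a i))
          else om (a j) (a i) * ((a j - a i) * (a i - a j))) else 1) * (a i - a j) =
        ev (if split_pair I (i, j) then (if i \<in> I then - numX i j else numX j i) else Xm i - Xm j) a"
        by simp
    qed
    finally have *: "Om (a ` I) (a ` ?J) * mixed I ?J a * vd (pairs ?N) a =
      ev (\<Prod>(i, j)\<in>pairs ?N. if split_pair I (i, j) then (if i \<in> I then - numX i j else numX j i) else Xm i - Xm j) a"
      by (simp add: case_prod_unfold)
    have "F (a ` I) * G (a ` ?J) * Om (a ` I) (a ` ?J) * dsc {..<?N} a * vd (pairs ?N) a =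
        (F (a ` I) * dsc I a) * (G (a ` ?J) * dsc ?J a) * (Om (a ` I) (a ` ?J) * mixed I ?J a * vd (pairs ?N) a)"
      by (simp add: dsc mult_ac)
    also have "\<dots> = ev K a"
      unfolding * rep_enum[OF F a e I(1)] rep_enum[OF G a e' Diff_subset] K_def by simp
    finally show ?thesis .
  qed
  then show ?thesis by blast
qed

lemma conv_image:
  fixes a :: "nat \<Rightarrow> coef"
  assumes supp: "supp m F" and inj: "inj_on a {..<N}"
  shows "conv F G (a ` {..<N}) = (\<Sum>I | I \<subseteq> {..<N} \<and> card I = m.
    F (a ` I) * G (a ` ({..<N} - I)) * Om (a ` I) (a ` ({..<N} - I)))"
proof -
  have "conv F G (a ` {..<N}) = (\<Sum>S\<in>(`) a ` Pow {..<N}. F S * G (a ` {..<N} - S) * Om S (a ` {..<N} - S))"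
    by (simp add: conv_def image_Pow_surj)
  also have "\<dots> = (\<Sum>I\<in>Pow {..<N}. F (a ` I) * G (a ` {..<N} - a ` I) * Om (a ` I) (a ` {..<N} - a ` I))"
    by (simp add: sum.reindex[OF inj_on_image_Pow[OF inj]])
  also have "\<dots> = (\<Sum>I\<in>{I. I \<subseteq> {..<N} \<and> card I = m}. F (a ` I) * G (a ` {..<N} - a ` I) * Om (a ` I) (a ` {..<N} - a ` I))"
  proof (rule sum.mono_neutral_right)
    show "\<forall>I\<in>Pow {..<N} - {I. I \<subseteq> {..<N} \<and> card I = m}. F (a ` I) * G (a ` {..<N} - a ` I) * Om (a ` I) (a ` {..<N} - a ` I) = 0"
    proof
      fix I assume I: "I \<in> Pow {..<N} - {I. I \<subseteq> {..<N} \<and> card I = m}"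
      then have "card (a ` I) \<noteq> m" using inj by (auto simp: card_image inj_on_subset)
      then have "F (a ` I) = 0" using supp by (auto simp: supp_def)
      then show "F (a ` I) * G (a ` {..<N} - a ` I) * Om (a ` I) (a ` {..<N} - a ` I) = 0" by simp
    qed
  qed auto
  also have "\<dots> = (\<Sum>I\<in>{I. I \<subseteq> {..<N} \<and> card I = m}. F (a ` I) * G (a ` ({..<N} - I)) * Om (a ` I) (a ` ({..<N} - I)))"
    using inj by (intro sum.cong refl) (auto simp: inj_on_image_set_diff[where C = "{..<N}"])
  finally show ?thesis .
qed

text \<open>Single terms may keep simple poles after multiplication with the discriminant. Their sum
  is symmetric, and a symmetric function has no simple pole on a diagonal.\<close>

lemma conv_rep:
  assumes supp: "supp m F" and F: "rep m F P" and G: "rep n G Q"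
  shows "\<exists>R. rep (m + n) (conv F G) R"
proof -
  let ?N = "m + n"
  let ?T = "\<lambda>a. conv F G (a ` {..<?N}) * dsc {..<?N} a"
  let ?Is = "{I. I \<subseteq> {..<?N} \<and> card I = m}"
  have "\<forall>I\<in>?Is. \<exists>K. \<forall>a. generic ?N a \<longrightarrow>
      F (a ` I) * G (a ` ({..<?N} - I)) * Om (a ` I) (a ` ({..<?N} - I)) * dsc {..<?N} a * vd (pairs ?N) a = ev K a"
    using conv_term_rep[OF F G] by simp
  from bchoice[OF this] obtain K where K: "\<And>I a. I \<in> ?Is \<Longrightarrow> generic ?N a \<Longrightarrow>
      F (a ` I) * G (a ` ({..<?N} - I)) * Om (a ` I) (a ` ({..<?N} - I)) * dsc {..<?N} a * vd (pairs ?N) a = ev (K I) a"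
    by auto
  have eq: "?T a * vd (pairs ?N) a = ev (\<Sum>I\<in>?Is. K I) a" if a: "generic ?N a" for a
  proof -
    have inj: "inj_on a {..<?N}" using a by (simp add: generic_def)
    have "?T a * vd (pairs ?N) a = (\<Sum>I\<in>?Is. F (a ` I) * G (a ` ({..<?N} - I)) *
        Om (a ` I) (a ` ({..<?N} - I)) * dsc {..<?N} a * vd (pairs ?N) a)"
      by (simp add: conv_image[OF supp inj] sum_distrib_right mult.assoc)
    also have "\<dots> = ev (\<Sum>I\<in>?Is. K I) a" using K a by simp
    finally show ?thesis .
  qed
  have "\<exists>Q'. \<forall>a. generic ?N a \<longrightarrow> ?T a = ev Q' a"
  proof (rule clear_simple_poles[OF order_refl _ eq])
    fix a :: "nat \<Rightarrow> coef" and i j assume "(i, j) \<in> pairs ?N"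
    then have perm: "Transposition.transpose i j permutes {..<?N}"
      by (auto simp: pairs_def permutes_swap_id)
    have "(a \<circ> Transposition.transpose i j) ` {..<?N} = a ` {..<?N}"
      unfolding image_comp[symmetric] permutes_image[OF perm] ..
    moreover have "dsc {..<?N} (a \<circ> Transposition.transpose i j) = dsc {..<?N} a"
      using dsc_reindex[OF permutes_inj_on[OF perm], of "{..<?N}" a] permutes_image[OF perm] by (simp add: o_def)
    ultimately show "conv F G ((a \<circ> Transposition.transpose i j) ` {..<?N}) * dsc {..<?N} (a \<circ> Transposition.transpose i j) = ?T a"
      by simp
  qed
  then show ?thesis by (auto simp: rep_def)
qed

lemma conv_Bsp:
  assumes "F \<in> Bsp m" "G \<in> Bsp n"
  shows "conv F G \<in> Bsp (m + n)"
proof -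
  obtain P Q where "rep m F P" "rep n G Q" using assms by (auto simp: Bsp_def)
  then obtain R where "rep (m + n) (conv F G) R" using conv_rep BspD(1)[OF assms(1)] by blast
  then show ?thesis
    by (intro BspI conv_supp conv_wheel conv_homog conv_has_lims)
      (use BspD[OF assms(1)] BspD[OF assms(2)] in blast)+
qed

lemma lincomb_Bsp:
  assumes F: "F \<in> Bsp n" and G: "G \<in> Bsp n"
  shows "(\<lambda>V. c * F V + G V) \<in> Bsp n"
proof -
  obtain P Q where PQ: "rep n F P" "rep n G Q" using assms by (auto simp: Bsp_def)
  have "rep n (\<lambda>V. c * F V + G V) (Cm c * P + Q)"
    using PQ by (auto simp: rep_def algebra_simps)
  moreover have "supp n (\<lambda>V. c * F V + G V)"
    using BspD(1)[OF F] BspD(1)[OF G] unfolding supp_def by (metis add_0 mult_zero_right)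
  moreover have "wheel (\<lambda>V. c * F V + G V)"
    using BspD(2)[OF F] BspD(2)[OF G] unfolding wheel_def by (metis add_0 mult_zero_right)
  moreover have "homog (\<lambda>V. c * F V + G V)"
    using BspD(3)[OF F] BspD(3)[OF G] unfolding homog_def by simp
  ultimately show ?thesis
    using BspI has_lims_lincomb BspD(4)[OF F] BspD(4)[OF G] by blast
qed

lemma conv_zero [simp]: "conv (\<lambda>V. 0) G = (\<lambda>V. 0)" "conv F (\<lambda>V. 0) = (\<lambda>V. 0)"
  by (auto simp: conv_def fun_eq_iff)

text \<open>The difference of the two products is killed by all \<open>\<Theta>\<^sub>r\<close>, by induction on the degree.\<close>

lemma conv_commute:
  assumes "F \<in> Bsp m" "G \<in> Bsp n"
  shows "conv F G = conv G F"
  using assms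
proof (induction "m + n" arbitrary: m n F G rule: less_induct)
  case less
  note F = BspD[OF less.prems(1)] and G = BspD[OF less.prems(2)]
  show ?case
  proof (cases "m + n = 0")
    \<comment> \<open>The vanishing criterion needs positive degree. In degree 0 only the empty set
      matters, where both products are \<open>F {} * G {}\<close>.\<close>
    case True
    have "conv F G V = conv G F V" for V
    proof (cases "V = {}")
      case False
      then have "finite V \<Longrightarrow> card V \<noteq> 0" by auto
      then have "conv F G V = 0" "conv G F V = 0"
        using True conv_supp[OF F(1) G(1)] conv_supp[OF G(1) F(1)] unfolding supp_def
        by (metis add_is_0)+
      then show ?thesis by simp
    qed (simp add: conv_def)
    then show ?thesis by blast
  next
    case False
    define H where "H = (\<lambda>V. (-1) * conv G F V + conv F G V)"
    have FG: "conv F G \<in> Bsp (m + n)" using less.prems by (rule conv_Bsp)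
    have GF: "conv G F \<in> Bsp (m + n)" using conv_Bsp[OF less.prems(2,1)] by (simp add: add.commute)
    have ThH: "Th r H = (\<lambda>Z. 0)" if r: "r \<ge> 1" for r
    proof -
      \<comment> \<open>Since \<open>a + b \<ge> 1\<close>, the total degree drops when both degrees
        are in range; otherwise one factor is 0.\<close>
      have comm: "conv (Th a F) (Th b G) = conv (Th b G) (Th a F)" if "a + b = r" for a b
      proof (cases "a \<le> m \<and> b \<le> n")
        case True
        then show ?thesis
          using Th_Bsp[OF less.prems(1)] Th_Bsp[OF less.prems(2)] r that by (intro less.hyps) auto
      next
        case False
        then have "Th a F = (\<lambda>Z. 0) \<or> Th b G = (\<lambda>Z. 0)" using Th_eq_0 F(1) G(1) by (meson not_le)
        then show ?thesis by auto
      qed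
      have "Th r (conv F G) = Th r (conv G F)"
      proof
        fix Z
        have "Th r (conv F G) Z = (\<Sum>a\<le>r. gam a (r - a) * conv (Th a F) (Th (r - a) G) Z)"
          using Th_conv[OF F(1) G(1) F(4) G(4) G(3)] by metis
        also have "\<dots> = (\<Sum>a\<le>r. gam (r - a) a * conv (Th (r - a) F) (Th a G) Z)"
          by (rule sum.reindex_bij_witness[where i = "\<lambda>a. r - a" and j = "\<lambda>a. r - a"]) auto
        also have "\<dots> = (\<Sum>a\<le>r. gam a (r - a) * conv (Th a G) (Th (r - a) F) Z)"
          by (intro sum.cong refl) (simp add: comm gam_commute)
        also have "\<dots> = Th r (conv G F) Z"
          using Th_conv[OF G(1) F(1) G(4) F(4) F(3)] by metis
        finally show "Th r (conv F G) Z = Th r (conv G F) Z" .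
      qed
      then show ?thesis
        unfolding H_def by (subst Th_lincomb) (use BspD(4)[OF FG] BspD(4)[OF GF] in auto)
    qed
    have HB: "H \<in> Bsp (m + n)" unfolding H_def by (rule lincomb_Bsp[OF GF FG])
    have H: "H = (\<lambda>V. 0)" by (rule Bsp_eq_0I[OF HB _ ThH]) (use False in linarith)
    have "conv F G V = conv G F V" for V using fun_cong[OF H, of V] by (simp add: H_def)
    then show ?thesis by blast
  qed
qed

section \<open>The generators\<close>

definition pp :: "coef set \<Rightarrow> coef" where
  "pp V = (\<Prod>x\<in>V. \<Prod>y\<in>V - {x}. (x - q1 * y) / (x - y))"

definition en :: "nat \<Rightarrow> coef set \<Rightarrow> coef" where
  "en n V = (if finite V \<and> card V = n \<and> 0 \<notin> V then pp V else 0)"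

text \<open>One factor of the product is 0. Every wheel, and every string of length at least two,
  contains two points with ratio \<open>q1\<close>; this gives the wheel condition and
  \<open>Th p (en n) = 0\<close> for \<open>p \<ge> 2\<close>.\<close>

lemma pp_zero:
  assumes "finite V" "y \<in> V" "q1 * y \<in> V" "y \<noteq> 0"
  shows "pp V = 0"
proof -
  have "q1 \<noteq> 1" using q1_power_inj[of 1 0] by simp
  then have "q1 * y \<noteq> y" using assms by simp
  then have "\<exists>y'\<in>V - {q1 * y}. (q1 * y - q1 * y') / (q1 * y - y') = 0" using assms by auto
  then have z: "(\<Prod>y'\<in>V - {q1 * y}. (q1 * y - q1 * y') / (q1 * y - y')) = 0"
    using assms(1) by (intro prod_zero) simp_all
  then show ?thesis
    unfolding pp_def by (intro prod_zero[OF assms(1)] bexI[OF _ assms(3)])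
qed

lemma pp_Un:
  assumes "finite T" "finite S" "T \<inter> S = {}"
  shows "pp (T \<union> S) = pp T * pp S *
    (\<Prod>x\<in>T. \<Prod>y\<in>S. (x - q1 * y) / (x - y) * ((y - q1 * x) / (y - x)))"
  unfolding pp_def by (rule prod_pairs_Un[OF assms])

lemma pp_scale:
  assumes "c \<noteq> 0"
  shows "pp ((*) c ` V) = pp V"
proof -
  have "(*) c ` V - {c * x} = (*) c ` (V - {x})" for x using assms by auto
  moreover have "(c * x - q1 * (c * y)) / (c * x - c * y) = (x - q1 * y) / (x - y)" for x y
    using assms by (simp add: mult.left_commute[of q1 c] flip: right_diff_distrib)
  ultimately show ?thesis by (simp add: pp_def prod.reindex inj_on_scale assms)
qed

lemma supp_en: "supp n (en n)"
  by (simp add: supp_def en_def)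

lemma wheel_en: "wheel (en n)"
  unfolding wheel_def
proof (intro allI impI, rule ccontr)
  fix V and x :: coef assume x: "x \<in> V \<and> (q1 * x \<in> V \<or> q2 * x \<in> V) \<and> q1 * q2 * x \<in> V" and "en n V \<noteq> 0"
  then have "finite V" "0 \<notin> V" "pp V \<noteq> 0" by (auto simp: en_def split: if_splits)
  then show False using x pp_zero[of V x] pp_zero[of V "q2 * x"] by (auto simp: mult.assoc)
qed

lemma homog_en: "homog (en n)"
  unfolding homog_def
proof (intro allI impI)
  fix V and c :: coef assume c: "c \<noteq> 0"
  have "finite ((*) c ` V) = finite V" "card ((*) c ` V) = card V" "0 \<in> (*) c ` V \<longleftrightarrow> 0 \<in> V"
    using c by (auto simp: finite_image_iff card_image inj_on_scale image_iff)
  then show "en n ((*) c ` V) = en n V" by (simp add: en_def pp_scale[OF c])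
qed

text \<open>For a pair in different clusters one of the two factors tends to 1 and the other to
  \<open>q1\<close>. The limit is therefore symmetric in \<open>Y\<close> and
  \<open>Z\<close>.\<close>

lemma en_lim:
  assumes "finite Y" "finite Z" "0 \<notin> Y" "0 \<notin> Z" "card Y + card Z = n"
  shows "lim0 (\<lambda>x. en n (Y \<union> (*) x ` Z)) (pp Y * pp Z * q1 ^ (card Y * card Z))"
proof (rule lim0_cong)
  let ?\<psi> = "\<lambda>x. pp Y * pp Z * (\<Prod>y\<in>Y. \<Prod>z\<in>Z.
    (y - q1 * (x * z)) / (y - x * z) * ((x * z - q1 * y) / (x * z - y)))"
  have "lim0 ?\<psi> (pp Y * pp Z * (\<Prod>y\<in>Y. \<Prod>z\<in>Z.
    (y - q1 * (0 * z)) / (y - 0 * z) * ((0 * z - q1 * y) / (0 * z - y))))"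
    by (intro lim0_mult lim0_prod lim0_divide lim0_diff lim0_const lim0_ident) (use assms in auto)
  moreover have "(\<Prod>y\<in>Y. \<Prod>z\<in>Z. (y - q1 * (0 * z)) / (y - 0 * z) * ((0 * z - q1 * y) / (0 * z - y))) =
      (\<Prod>y\<in>Y. \<Prod>z\<in>Z. q1)"
    by (intro prod.cong refl) (use assms in auto)
  ultimately show "lim0 ?\<psi> (pp Y * pp Z * q1 ^ (card Y * card Z))"
    by (simp add: mult.commute flip: power_mult)
  have "en n (Y \<union> (*) x ` Z) = ?\<psi> x" if x: "x \<noteq> 0" "Y \<inter> (*) x ` Z = {}" for x
  proof -
    have "finite (Y \<union> (*) x ` Z)" "card (Y \<union> (*) x ` Z) = n" "0 \<notin> Y \<union> (*) x ` Z"
      using assms x by (auto simp: card_Un_disjoint card_image inj_on_scale)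
    then have "en n (Y \<union> (*) x ` Z) = pp (Y \<union> (*) x ` Z)" by (simp add: en_def)
    also have "\<dots> = ?\<psi> x"
      using assms x by (simp add: pp_Un pp_scale prod.reindex inj_on_scale)
    finally show ?thesis .
  qed
  then have "{x. en n (Y \<union> (*) x ` Z) \<noteq> ?\<psi> x} \<subseteq> {0} \<union> {x. Y \<inter> (*) x ` Z \<noteq> {}}" by blast
  then show "finite {x. en n (Y \<union> (*) x ` Z) \<noteq> ?\<psi> x}"
    by (rule finite_subset) (use finite_meets_scaled assms in simp)
qed

lemma has_lims_en: "has_lims (en n)"
  by (rule has_limsI[OF supp_en]) (use en_lim in blast)

lemma rep_en: "\<exists>P. rep n (en n) P"
proof
  show "rep n (en n) (\<Prod>i<n. \<Prod>j\<in>{..<n} - {i}. Xm i - Cm q1 * Xm j)"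
    unfolding rep_def
  proof (intro allI impI)
    fix a :: "nat \<Rightarrow> coef" assume a: "generic n a"
    then have inj: "inj_on a {..<n}" and nz: "0 \<notin> a ` {..<n}" by (auto simp: generic_def)
    have im: "a ` {..<n} - {a i} = a ` ({..<n} - {i})" if "i < n" for i
      using inj that by (auto simp: inj_on_def)
    have inj': "inj_on a ({..<n} - {i})" for i using inj by (auto intro: inj_on_subset)
    have ne: "a i \<noteq> a j" if "i < n" "j \<in> {..<n} - {i}" for i j using inj that by (auto simp: inj_on_def)
    have "en n (a ` {..<n}) = pp (a ` {..<n})" using inj nz by (simp add: en_def card_image)
    also have "\<dots> = (\<Prod>i<n. \<Prod>j\<in>{..<n} - {i}. (a i - q1 * a j) / (a i - a j))"
      unfolding pp_def by (simp add: prod.reindex[OF inj] im prod.reindex[OF inj'])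
    finally have "en n (a ` {..<n}) * dsc {..<n} a =
        (\<Prod>i<n. \<Prod>j\<in>{..<n} - {i}. (a i - q1 * a j) / (a i - a j) * (a i - a j))"
      by (simp only: dsc_def prod.distrib)
    also have "\<dots> = (\<Prod>i<n. \<Prod>j\<in>{..<n} - {i}. a i - q1 * a j)"
    proof (intro prod.cong refl)
      fix i j assume "i \<in> {..<n}" "j \<in> {..<n} - {i}"
      then have "a i - a j \<noteq> 0" using ne by simp
      then show "(a i - q1 * a j) / (a i - a j) * (a i - a j) = a i - q1 * a j" by simp
    qed
    finally show "en n (a ` {..<n}) * dsc {..<n} a = ev (\<Prod>i<n. \<Prod>j\<in>{..<n} - {i}. Xm i - Cm q1 * Xm j) a"
      by simp
  qed
qed

lemma en_Bsp: "en n \<in> Bsp n"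
  using BspI supp_en wheel_en rep_en homog_en has_lims_en by metis

lemma Th_0:
  assumes "F \<in> Bsp n"
  shows "Th 0 F = F"
proof
  fix Z
  have "F ({} \<union> (*) x ` Z) = F Z" if "x \<noteq> 0" for x
    using BspD(3)[OF assms] that by (simp add: homog_def)
  then have "{x. F ({} \<union> (*) x ` Z) \<noteq> F Z} \<subseteq> {0}" by blast
  then have "finite {x. F ({} \<union> (*) x ` Z) \<noteq> F Z}" by (rule finite_subset) simp
  then have "lim0 (\<lambda>x. F ({} \<union> (*) x ` Z)) (F Z)" by (rule lim0_cong[OF _ lim0_const])
  then show "Th 0 F Z = F Z" by (simp add: Th_def delta_eqI)
qed

lemma Th_1_en: "Th 1 (en (Suc n)) = (\<lambda>Z. q1 ^ n * en n Z)"
proof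
  fix Z
  show "Th 1 (en (Suc n)) Z = q1 ^ n * en n Z"
  proof (cases "finite Z \<and> 0 \<notin> Z \<and> card Z = n")
    case True
    have "delta (en (Suc n)) (str 1) Z = pp (str 1) * pp Z * q1 ^ (card (str 1) * card Z)"
      by (rule delta_eqI, rule en_lim) (use True in auto)
    moreover have "pp (str 1) = 1" by (simp add: str_def pp_def lessThan_Suc)
    ultimately show ?thesis using True by (simp add: Th_def en_def)
  next
    case False
    then have "Th 1 (en (Suc n)) Z = 0" using Th_supp[OF supp_en, of 1 "Suc n" Z] by auto
    moreover have "en n Z = 0" using False by (auto simp: en_def)
    ultimately show ?thesis by simp
  qed
qed

lemma Th_en_zero: "p \<ge> 2 \<Longrightarrow> Th p (en n) = (\<lambda>Z. 0)"
proof
  fix Z assume p: "p \<ge> 2"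
  show "Th p (en n) Z = 0"
  proof (rule Th_zeroI[OF supp_en])
    fix x :: coef
    have "1 \<in> str p" "q1 * 1 \<in> str p" using str_in_iff[of 0 p] str_in_iff[of 1 p] p by auto
    then show "en n (str p \<union> (*) x ` Z) = 0"
      using pp_zero[of "str p \<union> (*) x ` Z" 1] by (auto simp: en_def)
  qed
qed

text \<open>\<open>en 0\<close> is the indicator of the empty set. The hypothesis covers infinite
  sets, where \<open>conv\<close> is a sum over an infinite set and hence 0.\<close>

lemma conv_en_0:
  assumes inf: "\<And>V. infinite V \<Longrightarrow> F V = 0"
  shows "conv (en 0) F = F" "conv F (en 0) = F"
proof -
  have e0: "en 0 S = (if S = {} then 1 else 0)" for S by (auto simp: en_def pp_def)
  show "conv (en 0) F = F"
  proof
    fix V show "conv (en 0) F V = F V"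
    proof (cases "finite V")
      case True
      have "conv (en 0) F V = (\<Sum>S\<in>Pow V. if S = {} then F V else 0)"
        unfolding conv_def by (intro sum.cong refl) (simp add: e0)
      then show ?thesis using True by simp
    qed (simp add: conv_def inf)
  qed
  show "conv F (en 0) = F"
  proof
    fix V show "conv F (en 0) V = F V"
    proof (cases "finite V")
      case True
      have "conv F (en 0) V = (\<Sum>S\<in>Pow V. if S = V then F V else 0)"
        unfolding conv_def by (intro sum.cong refl) (auto simp: e0)
      then show ?thesis using True by simp
    qed (simp add: conv_def inf)
  qed
qed

text \<open>By homogeneity, sending \<xi> to infinity on \<open>Z\<close> is sending it to 0 on
  \<open>Y\<close>; this is the equality of the limits at 0 and infinity.\<close>

definition lim_sym :: "(coef set \<Rightarrow> coef) \<Rightarrow> bool" where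
  "lim_sym F \<longleftrightarrow> (\<forall>Y Z. finite Y \<longrightarrow> finite Z \<longrightarrow> 0 \<notin> Y \<longrightarrow> 0 \<notin> Z \<longrightarrow> delta F Y Z = delta F Z Y)"

lemma lim_sym_en: "lim_sym (en n)"
  unfolding lim_sym_def
proof (intro allI impI)
  fix Y Z :: "coef set" assume YZ: "finite Y" "finite Z" "0 \<notin> Y" "0 \<notin> Z"
  have zero: "delta (en n) Y Z = 0" if YZ: "finite Y" "finite Z" "0 \<notin> Z" "card Y + card Z \<noteq> n" for Y Z
  proof (rule delta_zeroI)
    fix x :: coef assume "x \<noteq> 0" "Y \<inter> (*) x ` Z = {}"
    then have "card (Y \<union> (*) x ` Z) = card Y + card Z"
      using YZ by (simp add: card_Un_disjoint card_image inj_on_scale)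
    then show "en n (Y \<union> (*) x ` Z) = 0" using YZ by (simp add: en_def)
  qed (use YZ in auto)
  show "delta (en n) Y Z = delta (en n) Z Y"
  proof (cases "card Y + card Z = n")
    case True
    then have "delta (en n) Y Z = pp Y * pp Z * q1 ^ (card Y * card Z)"
      "delta (en n) Z Y = pp Z * pp Y * q1 ^ (card Z * card Y)"
      using YZ by (auto intro!: delta_eqI en_lim)
    then show ?thesis by (simp add: mult_ac)
  next
    case False
    then show ?thesis using zero[of Y Z] zero[of Z Y] YZ by (simp add: add.commute)
  qed
qed

text \<open>The limit in \<open>conv_lim\<close> is a sum over subsets of \<open>Y\<close> and of
  \<open>Z\<close> in which the two clusters play the same role.\<close>

lemma lim_sym_conv:
  assumes "has_lims F" "has_lims G" "lim_sym F" "lim_sym G"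
  shows "lim_sym (conv F G)"
  unfolding lim_sym_def
proof (intro allI impI)
  fix Y Z :: "coef set" assume YZ: "finite Y" "finite Z" "0 \<notin> Y" "0 \<notin> Z"
  have sub: "finite A \<and> 0 \<notin> A \<and> finite (Y - A) \<and> 0 \<notin> Y - A" if "A \<in> Pow Y" for A
    using YZ that finite_subset by auto
  have sub': "finite B \<and> 0 \<notin> B \<and> finite (Z - B) \<and> 0 \<notin> Z - B" if "B \<in> Pow Z" for B
    using YZ that finite_subset by auto
  have "delta (conv F G) Y Z =
      (\<Sum>A\<in>Pow Y. \<Sum>B\<in>Pow Z. delta F A B * delta G (Y - A) (Z - B) * (Om A (Y - A) * Om B (Z - B)))"
    by (rule delta_eqI, rule conv_lim) (use assms YZ in auto)
  also have "\<dots> = (\<Sum>A\<in>Pow Y. \<Sum>B\<in>Pow Z. delta F B A * delta G (Z - B) (Y - A) * (Om B (Z - B) * Om A (Y - A)))"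
  proof (intro sum.cong refl)
    fix A B assume "A \<in> Pow Y" "B \<in> Pow Z"
    then have "delta F A B = delta F B A" "delta G (Y - A) (Z - B) = delta G (Z - B) (Y - A)"
      using assms(3,4) sub sub' unfolding lim_sym_def by metis+
    then show "delta F A B * delta G (Y - A) (Z - B) * (Om A (Y - A) * Om B (Z - B)) =
      delta F B A * delta G (Z - B) (Y - A) * (Om B (Z - B) * Om A (Y - A))" by simp
  qed
  also have "\<dots> = (\<Sum>B\<in>Pow Z. \<Sum>A\<in>Pow Y. delta F B A * delta G (Z - B) (Y - A) * (Om B (Z - B) * Om A (Y - A)))"
    by (rule sum.swap)
  also have "\<dots> = delta (conv F G) Z Y"
    by (rule delta_eqI[symmetric], rule conv_lim) (use assms YZ in auto)
  finally show "delta (conv F G) Y Z = delta (conv F G) Z Y" .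
qed

lemma lim_sym_lincomb:
  assumes "has_lims F" "has_lims G" "lim_sym F" "lim_sym G"
  shows "lim_sym (\<lambda>V. c * F V + G V)"
  using assms(3,4) unfolding lim_sym_def delta_lincomb[OF assms(1,2)] by metis

section \<open>The spaces are spanned by products of generators\<close>

definition Efun :: "nat list \<Rightarrow> coef set \<Rightarrow> coef" where
  "Efun ks = foldr (\<lambda>k. conv (en k)) ks (en 0)"

lemma Efun_Nil: "Efun [] = en 0" and Efun_Cons: "Efun (k # ks) = conv (en k) (Efun ks)"
  by (simp_all add: Efun_def)

lemma Efun_Bsp: "Efun ks \<in> Bsp (sum_list ks)"
  by (induction ks) (simp_all add: Efun_Nil Efun_Cons en_Bsp conv_Bsp)

lemma Efun_lim_sym: "lim_sym (Efun ks)"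
  by (induction ks)
    (simp_all add: Efun_Nil Efun_Cons lim_sym_en lim_sym_conv has_lims_en BspD(4)[OF Efun_Bsp])

lemma Th_Efun_Cons:
  "Th r (Efun (k # ks)) = (\<lambda>Z. \<Sum>a\<le>r. gam a (r - a) * conv (Th a (en k)) (Th (r - a) (Efun ks)) Z)"
  unfolding Efun_Cons
  by (rule Th_conv[OF supp_en BspD(1)[OF Efun_Bsp] has_lims_en BspD(4)[OF Efun_Bsp] BspD(3)[OF Efun_Bsp]])

text \<open>In the product formula each generator takes at most 1 out of \<open>r\<close>, since
  higher operators kill it.\<close>

lemma Th_Efun_zero: "r > length ks \<Longrightarrow> Th r (Efun ks) = (\<lambda>Z. 0)"
proof (induction ks arbitrary: r)
  case Nil
  then show ?case using Th_eq_0[OF supp_en[of 0]] by (simp add: Efun_Nil)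
next
  case (Cons k ks)
  have "conv (Th a (en k)) (Th (r - a) (Efun ks)) = (\<lambda>Z. 0)" for a
  proof (cases "a \<ge> 2")
    case True
    then show ?thesis by (simp add: Th_en_zero)
  next
    case False
    then have "r - a > length ks" using Cons.prems by simp
    then show ?thesis by (simp add: Cons.IH)
  qed
  then show ?case unfolding Th_Efun_Cons by simp
qed

lemma conv_scale: "conv (\<lambda>V. c * F V) (\<lambda>V. d * G V) = (\<lambda>V. c * d * conv F G V)"
  by (auto simp: conv_def sum_distrib_left fun_eq_iff intro!: sum.cong)

text \<open>When \<open>r\<close> equals the number of factors, each must take exactly 1. All
  indices drop by one, and the constant collects values of \<open>gam\<close> and powers of
  \<open>q1\<close>.\<close>

lemma Th_Efun_length:
  "\<exists>c. c \<noteq> 0 \<and> Th (length ks) (Efun (map Suc ks)) = (\<lambda>Z. c * Efun ks Z)"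
proof (induction ks)
  case Nil
  show ?case by (rule exI[of _ 1]) (simp add: Efun_Nil Th_0[OF en_Bsp])
next
  case (Cons k ks)
  let ?l = "length ks"
  obtain c where c: "c \<noteq> 0" "Th ?l (Efun (map Suc ks)) = (\<lambda>Z. c * Efun ks Z)" using Cons by blast
  \<comment> \<open>For \<open>a = 0\<close> the remaining factors would have to take more than
    their number; for \<open>a \<ge> 2\<close> the generator is killed.\<close>
  have term0: "conv (Th a (en (Suc k))) (Th (Suc ?l - a) (Efun (map Suc ks))) = (\<lambda>Z. 0)" if "a \<noteq> 1" for a
  proof (cases "a = 0")
    case True
    then show ?thesis using Th_Efun_zero[of "map Suc ks" "Suc ?l"] by simp
  next
    case False
    then show ?thesis using that by (simp add: Th_en_zero)
  qed
  have "Th (Suc ?l) (Efun (map Suc (k # ks))) Z = gam 1 ?l * (q1 ^ k * c) * Efun (k # ks) Z" for Z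
  proof -
    have "Th (Suc ?l) (Efun (Suc k # map Suc ks)) Z =
        (\<Sum>a\<le>Suc ?l. if a = 1 then gam 1 ?l * conv (Th 1 (en (Suc k))) (Th ?l (Efun (map Suc ks))) Z else 0)"
      unfolding Th_Efun_Cons by (intro sum.cong refl) (auto simp: term0)
    also have "\<dots> = gam 1 ?l * conv (Th 1 (en (Suc k))) (Th ?l (Efun (map Suc ks))) Z"
      by (simp add: sum.delta del: sum.atMost_Suc)
    also have "\<dots> = gam 1 ?l * (q1 ^ k * c) * Efun (k # ks) Z"
      unfolding Th_1_en c(2) conv_scale by (simp add: Efun_Cons)
    finally show ?thesis by simp
  qed
  then show ?case using c(1) gam_nz[of 1 ?l]
    by (intro exI[of _ "gam 1 ?l * (q1 ^ k * c)"]) (simp add: fun_eq_iff)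
qed

text \<open>The span of the products of \<open>p\<close> generators of total degree
  \<open>n\<close>. Indices 0 are allowed, so shorter products are included. One product is added at
  a time, which suits the lifting through \<open>Th p\<close>.\<close>

inductive_set Esp :: "nat \<Rightarrow> nat \<Rightarrow> (coef set \<Rightarrow> coef) set" for n p where
  zero: "(\<lambda>V. 0) \<in> Esp n p"
| add: "F \<in> Esp n p \<Longrightarrow> length ks = p \<Longrightarrow> sum_list ks = n \<Longrightarrow> (\<lambda>V. c * Efun ks V + F V) \<in> Esp n p"

section \<open>The filtration by the operators \<open>Th\<close>\<close>

definition Bp :: "nat \<Rightarrow> nat \<Rightarrow> (coef set \<Rightarrow> coef) set" where
  "Bp n p = {F \<in> Bsp n. \<forall>r>p. Th r F = (\<lambda>Z. 0)}"

lemma Bp_lincomb: "F \<in> Bp n p \<Longrightarrow> G \<in> Bp n p \<Longrightarrow> (\<lambda>V. c * F V + G V) \<in> Bp n p"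
  unfolding Bp_def using Th_lincomb[OF BspD(4) BspD(4), of F n G n] by (simp add: lincomb_Bsp)

lemma Bp_zero: "(\<lambda>V. 0) \<in> Bp n p"
proof -
  have "Th r (\<lambda>V. 0) Z = 0" for r Z
    by (rule Th_zeroI[of 0]) (simp_all add: supp_def)
  then show ?thesis by (simp add: Bp_def Bsp_zero fun_eq_iff)
qed

lemma Efun_Bp: "length ks = p \<Longrightarrow> sum_list ks = n \<Longrightarrow> Efun ks \<in> Bp n p"
  unfolding Bp_def using Efun_Bsp[of ks] Th_Efun_zero[of ks] by auto

lemma Esp_sub_Bp: "F \<in> Esp n p \<Longrightarrow> F \<in> Bp n p"
  by (induction rule: Esp.induct) (simp_all add: Bp_zero Bp_lincomb Efun_Bp)

lemma Esp_lim_sym: "F \<in> Esp n p \<Longrightarrow> lim_sym F"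
proof (induction rule: Esp.induct)
  case zero
  have "delta (\<lambda>V. 0) Y Z = 0" for Y Z by (rule delta_zeroI') simp
  then show ?case by (simp add: lim_sym_def)
next
  case (add F ks c)
  have "F \<in> Bsp n" using Esp_sub_Bp[OF add(1)] by (simp add: Bp_def)
  then show ?case
    using lim_sym_lincomb[OF BspD(4)[OF Efun_Bsp] BspD(4) Efun_lim_sym add.IH] by blast
qed

lemma Esp_add: "F \<in> Esp n p \<Longrightarrow> G \<in> Esp n p \<Longrightarrow> (\<lambda>V. F V + G V) \<in> Esp n p"
proof (induction rule: Esp.induct)
  case (add F ks c)
  then have "(\<lambda>V. c * Efun ks V + (F V + G V)) \<in> Esp n p" by (intro Esp.add) auto
  then show ?case by (simp add: add.assoc)
qed simp

lemma Esp_mono: "F \<in> Esp n p \<Longrightarrow> F \<in> Esp n (Suc p)"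
proof (induction rule: Esp.induct)
  case (add F ks c)
  have "Efun (0 # ks) = Efun ks"
    unfolding Efun_Cons
    by (rule conv_en_0) (use BspD(1)[OF Efun_Bsp] in \<open>auto simp: supp_def\<close>)
  moreover have "(\<lambda>V. c * Efun (0 # ks) V + F V) \<in> Esp n (Suc p)"
    using add by (intro Esp.add) auto
  ultimately show ?case by simp
qed (rule Esp.zero)

text \<open>Raising every index by one gives a preimage of a product up to a nonzero constant, and
  the degree grows by the number \<open>p\<close> of factors.\<close>

lemma Esp_lift:
  assumes "F \<in> Esp n p"
  shows "\<exists>G\<in>Esp (n + p) p. Th p G = F"
  using assms
proof (induction rule: Esp.induct)
  case zero
  then show ?case using Esp.zero[of "n + p" p] Bp_zero[of 0 0]
    by (intro bexI[of _ "\<lambda>V. 0"]) (auto simp: fun_eq_iff intro!: Th_zeroI[of 0] simp: supp_def)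
next
  case (add F ks c)
  then obtain G where G: "G \<in> Esp (n + p) p" "Th p G = F" by blast
  obtain d where d: "d \<noteq> 0" "Th p (Efun (map Suc ks)) = (\<lambda>Z. d * Efun ks Z)"
    using Th_Efun_length[of ks] add.hyps by blast
  have s: "sum_list (map Suc ks) = sum_list ks + length ks" by (induction ks) simp_all
  have "(\<lambda>V. c / d * Efun (map Suc ks) V + G V) \<in> Esp (n + p) p"
    by (rule Esp.add[OF G(1)]) (use add.hyps s in auto)
  moreover have "Th p (\<lambda>V. c / d * Efun (map Suc ks) V + G V) = (\<lambda>V. c * Efun ks V + F V)"
  proof -
    have "G \<in> Bsp (n + p)" using Esp_sub_Bp[OF G(1)] by (simp add: Bp_def)
    then have "Th p (\<lambda>V. c / d * Efun (map Suc ks) V + G V) =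
        (\<lambda>Z. c / d * Th p (Efun (map Suc ks)) Z + Th p G Z)"
      by (intro Th_lincomb BspD(4)[OF Efun_Bsp] BspD(4))
    then show ?thesis using d by (simp add: G(2))
  qed
  ultimately show ?case by blast
qed

text \<open>Vanishing on strings of length \<open>p + 1\<close> passes to \<open>Th p F\<close>. For
  \<open>r > p\<close> the string in the definition of \<open>Th r\<close> contains such a string,
  so the limit is one of zeros.\<close>

lemma Th_Bp:
  assumes "F \<in> Bp n p"
  shows "Th p F \<in> Bp (n - p) p"
proof -
  have F: "F \<in> Bsp n" using assms by (simp add: Bp_def)
  have v: "vstr (Suc p) F" by (rule vstr_of_Th[OF F]) (use assms in \<open>simp add: Bp_def\<close>)
  have ThF: "Th p F \<in> Bsp (n - p)" by (rule Th_Bsp[OF F])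
  have "Th r (Th p F) = (\<lambda>Z. 0)" if "r > p" for r
  proof
    fix Z
    show "Th r (Th p F) Z = 0"
    proof (rule Th_zeroI[OF BspD(1)[OF ThF]])
      fix x :: coef
      have "(*) 1 ` str (Suc p) \<subseteq> str r \<union> (*) x ` Z" using str_mono[of "Suc p" r] that by auto
      then show "Th p F (str r \<union> (*) x ` Z) = 0"
        using vstr_Th[OF BspD(1)[OF F] v, of p] unfolding vstr_def by (metis zero_neq_one)
    qed
  qed
  then show ?thesis using ThF by (simp add: Bp_def)
qed

lemma Bp_0:
  assumes "F \<in> Bp n 0"
  shows "F = (\<lambda>V. (if n = 0 then F {} else 0) * en 0 V)"
proof (cases "n = 0")
  case True
  have "F V = 0" if "V \<noteq> {}" for V
  proof -
    have "supp 0 F" using assms BspD(1)[of F n] True by (simp add: Bp_def)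
    then show ?thesis using that unfolding supp_def by (metis card_0_eq)
  qed
  moreover have "en 0 V = (if V = {} then 1 else 0)" for V by (auto simp: en_def pp_def)
  ultimately show ?thesis using True by (auto simp: fun_eq_iff)
next
  case False
  then have "F = (\<lambda>V. 0)" using assms by (intro Bsp_eq_0I[of F n]) (auto simp: Bp_def)
  then show ?thesis using False by simp
qed

lemma Bp_kernel:
  assumes "F \<in> Bp n (Suc p)" "Th (Suc p) F = (\<lambda>Z. 0)"
  shows "F \<in> Bp n p"
  using assms unfolding Bp_def by (auto simp: Suc_lessI) (metis Suc_lessI)

text \<open>Subtracting from \<open>F\<close> an element of the span with the same image under
  \<open>Th p\<close> leaves an element of \<open>Bp n (p - 1)\<close>. The induction is on
  \<open>n + p\<close>, since the image has smaller degree but the same \<open>p\<close>.\<close>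

lemma Bp_eq_Esp: "Bp n p = Esp n p"
proof
  show "Esp n p \<subseteq> Bp n p" using Esp_sub_Bp by blast
  show "Bp n p \<subseteq> Esp n p"
  proof (induction "n + p" arbitrary: n p rule: less_induct)
    case less
    show ?case
    proof
      fix F assume F: "F \<in> Bp n p"
      show "F \<in> Esp n p"
      proof (cases p)
        case 0
        show ?thesis
        proof (cases "n = 0")
          case True
          have "(\<lambda>V. F {} * Efun [] V + 0) \<in> Esp n p" by (rule Esp.add[OF Esp.zero]) (simp_all add: 0 True)
          moreover have "F = (\<lambda>V. F {} * Efun [] V + 0)"
            using Bp_0[of F n] F 0 True by (simp add: Efun_Nil)
          ultimately show ?thesis by metis
        next
          case False
          then have "F = (\<lambda>V. 0)" using Bp_0[of F n] F 0 by simp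
          then show ?thesis using Esp.zero by metis
        qed
      next
        case (Suc p')
        have IH: "Bp n p' \<subseteq> Esp n p'" using less.hyps[of n p'] Suc by simp
        show ?thesis
        proof (cases "p \<le> n")
          case True
          have "Th p F \<in> Esp (n - p) p" using less.hyps[of "n - p" p] Th_Bp[OF F] Suc True by auto
          then obtain G where G: "G \<in> Esp n p" "Th p G = Th p F"
            using Esp_lift[of "Th p F" "n - p" p] True by auto
          have GB: "G \<in> Bp n p" using Esp_sub_Bp[OF G(1)] .
          define H where "H = (\<lambda>V. (-1) * G V + F V)"
          have "H \<in> Bp n p" unfolding H_def by (rule Bp_lincomb[OF GB F])
          moreover have "Th p H = (\<lambda>Z. 0)"
            unfolding H_def using GB F G(2) by (subst Th_lincomb) (auto simp: Bp_def BspD(4))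
          ultimately have "H \<in> Bp n p'" using Bp_kernel Suc by simp
          then have "H \<in> Esp n p" using IH Esp_mono Suc by blast
          then have "(\<lambda>V. G V + H V) \<in> Esp n p" using G(1) by (intro Esp_add)
          then show ?thesis by (simp add: H_def)
        next
          case False
          then have "Th p F = (\<lambda>Z. 0)" using Th_eq_0[OF BspD(1), of F n] F by (simp add: Bp_def)
          then have "F \<in> Bp n p'" using Bp_kernel F Suc by simp
          then show ?thesis using IH Esp_mono Suc by blast
        qed
      qed
    qed
  qed
qed

lemma Bsp_eq_Bp: "Bsp n = Bp n n"
  unfolding Bp_def using Th_eq_0 BspD(1) by blast

lemma Bsp_lim_sym: "F \<in> Bsp n \<Longrightarrow> lim_sym F"
  using Bsp_eq_Bp Bp_eq_Esp Esp_lim_sym by blast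

section \<open>Values of rational functions\<close>

locale coef_field_hom = coef_hom h for h :: "coef \<Rightarrow> 'b::field"
begin

text \<open>Cross-multiplication with a fraction whose denominator does not vanish at the point. The
  result is valid even where \<open>Q\<close> itself vanishes.\<close>

lemma has_value_Fract:
  assumes "has_value_at h a (Fract P Q) v" "Q \<noteq> 0"
  shows "mpol_eval h a P = v * mpol_eval h a Q"
proof -
  obtain R S where RS: "Fract P Q = Fract R S" "mpol_eval h a S \<noteq> 0" "v = mpol_eval h a R / mpol_eval h a S"
    using assms(1) by (auto simp: has_value_at_def)
  then have "S \<noteq> 0" by auto
  then have "P * S = R * Q" using RS(1) assms(2) by (simp add: eq_fract)
  then have "mpol_eval h a P * mpol_eval h a S = mpol_eval h a R * mpol_eval h a Q"
    by (metis eval_mult)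
  also have "\<dots> = v * mpol_eval h a Q * mpol_eval h a S" using RS(2,3) by simp
  finally show ?thesis using RS(2) by simp
qed

lemma has_value_unique: "has_value_at h a f v \<Longrightarrow> has_value_at h a f w \<Longrightarrow> v = w"
proof -
  assume v: "has_value_at h a f v" and w: "has_value_at h a f w"
  obtain P Q where PQ: "f = Fract P Q" "mpol_eval h a Q \<noteq> 0" using v by (auto simp: has_value_at_def)
  then have "Q \<noteq> 0" by auto
  then have "v * mpol_eval h a Q = w * mpol_eval h a Q"
    using has_value_Fract v w PQ(1) by metis
  then show "v = w" using PQ(2) by simp
qed

lemma has_value_quot:
  "mpol_eval h a Q \<noteq> 0 \<Longrightarrow> has_value_at h a (to_fract P / to_fract Q) (mpol_eval h a P / mpol_eval h a Q)"
  unfolding has_value_at_def Fract_conv_to_fract by blast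

lemma has_valueE:
  assumes "has_value_at h a f v"
  obtains P Q where "f = to_fract P / to_fract Q" "mpol_eval h a Q \<noteq> 0" "v = mpol_eval h a P / mpol_eval h a Q" "Q \<noteq> 0"
proof -
  obtain P Q where "f = Fract P Q" "mpol_eval h a Q \<noteq> 0" "v = mpol_eval h a P / mpol_eval h a Q"
    using assms by (auto simp: has_value_at_def)
  moreover from this have "Q \<noteq> 0" by auto
  ultimately show ?thesis using that by (simp add: Fract_conv_to_fract)
qed

lemma has_value_to_fract: "has_value_at h a (to_fract P) (mpol_eval h a P)"
  using has_value_quot[of a 1 P] by simp

lemma has_value_const: "has_value_at h a (const c) (h c)"
  using has_value_to_fract[of a "Cm c"] by (simp add: to_fract_Cm)

lemma has_value_xvar: "has_value_at h a (xvar i) (a i)"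
  using has_value_to_fract[of a "Xm i"] by (simp add: to_fract_Xm)

lemma has_value_add:
  assumes "has_value_at h a f v" "has_value_at h a g w"
  shows "has_value_at h a (f + g) (v + w)"
proof -
  obtain P Q where PQ: "f = to_fract P / to_fract Q" "mpol_eval h a Q \<noteq> 0" "v = mpol_eval h a P / mpol_eval h a Q" "Q \<noteq> 0"
    using assms(1) by (rule has_valueE)
  obtain R S where RS: "g = to_fract R / to_fract S" "mpol_eval h a S \<noteq> 0" "w = mpol_eval h a R / mpol_eval h a S" "S \<noteq> 0"
    using assms(2) by (rule has_valueE)
  have "has_value_at h a (to_fract (P * S + R * Q) / to_fract (Q * S))
      (mpol_eval h a (P * S + R * Q) / mpol_eval h a (Q * S))"
    by (rule has_value_quot) (use PQ RS in simp)
  then show ?thesis using PQ RS by (simp add: add_frac_eq)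
qed

lemma has_value_mult:
  assumes "has_value_at h a f v" "has_value_at h a g w"
  shows "has_value_at h a (f * g) (v * w)"
proof -
  obtain P Q where PQ: "f = to_fract P / to_fract Q" "mpol_eval h a Q \<noteq> 0" "v = mpol_eval h a P / mpol_eval h a Q" "Q \<noteq> 0"
    using assms(1) by (rule has_valueE)
  obtain R S where RS: "g = to_fract R / to_fract S" "mpol_eval h a S \<noteq> 0" "w = mpol_eval h a R / mpol_eval h a S" "S \<noteq> 0"
    using assms(2) by (rule has_valueE)
  have "has_value_at h a (to_fract (P * R) / to_fract (Q * S))
      (mpol_eval h a (P * R) / mpol_eval h a (Q * S))"
    by (rule has_value_quot) (use PQ RS in simp)
  then show ?thesis using PQ RS by simp
qed

lemma has_value_inverse:
  assumes "has_value_at h a f v" "v \<noteq> 0"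
  shows "has_value_at h a (inverse f) (inverse v)"
proof -
  obtain P Q where PQ: "f = to_fract P / to_fract Q" "mpol_eval h a Q \<noteq> 0" "v = mpol_eval h a P / mpol_eval h a Q" "Q \<noteq> 0"
    using assms(1) by (rule has_valueE)
  have "has_value_at h a (to_fract Q / to_fract P) (mpol_eval h a Q / mpol_eval h a P)"
    by (rule has_value_quot) (use PQ assms(2) in auto)
  then show ?thesis using PQ by simp
qed

lemma has_value_divide:
  "has_value_at h a f v \<Longrightarrow> has_value_at h a g w \<Longrightarrow> w \<noteq> 0 \<Longrightarrow> has_value_at h a (f / g) (v / w)"
  unfolding divide_inverse by (intro has_value_mult has_value_inverse)

lemma has_value_diff:
  "has_value_at h a f v \<Longrightarrow> has_value_at h a g w \<Longrightarrow> has_value_at h a (f - g) (v - w)"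
  using has_value_add[of a f v "const (-1) * g" "h (-1) * w"]
    has_value_mult[OF has_value_const, of a g w "-1"] by simp

lemma has_value_power: "has_value_at h a f v \<Longrightarrow> has_value_at h a (f ^ k) (v ^ k)"
  using has_value_const[of a 1] by (induction k) (simp_all add: has_value_mult)

lemma has_value_sum:
  "(\<And>i. i \<in> I \<Longrightarrow> has_value_at h a (f i) (v i)) \<Longrightarrow> has_value_at h a (\<Sum>i\<in>I. f i) (\<Sum>i\<in>I. v i)"
  using has_value_const[of a 0] by (induction I rule: infinite_finite_induct) (simp_all add: has_value_add)

lemma has_value_prod:
  "(\<And>i. i \<in> I \<Longrightarrow> has_value_at h a (f i) (v i)) \<Longrightarrow> has_value_at h a (\<Prod>i\<in>I. f i) (\<Prod>i\<in>I. v i)"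
  using has_value_const[of a 1] by (induction I rule: infinite_finite_induct) (simp_all add: has_value_mult)

lemma has_value_of_nat: "has_value_at h a (of_nat k) (of_nat k)"
  using has_value_const[of a "of_nat k"] by simp

end

interpretation id: coef_field_hom id ..
interpretation const: coef_field_hom const ..
interpretation constpf: coef_field_hom "\<lambda>c. to_fract [:const c:]" ..

abbreviation val_at :: "(nat \<Rightarrow> coef) \<Rightarrow> ratf \<Rightarrow> coef \<Rightarrow> bool" where
  "val_at \<equiv> has_value_at id"

lemma ratf_eqI:
  assumes "\<And>a. generic n a \<Longrightarrow> \<exists>v. val_at a f v \<and> val_at a g v"
  shows "f = g"
proof -
  obtain P Q where PQ: "f = Fract P Q" "Q \<noteq> 0" by (cases f)
  obtain R S where RS: "g = Fract R S" "S \<noteq> 0" by (cases g)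
  have "P * S = R * Q"
  proof (rule mpol_eqI[of n])
    fix a :: "nat \<Rightarrow> coef" assume "generic n a"
    then obtain v where v: "val_at a f v" "val_at a g v" using assms by blast
    then have "ev P a = v * ev Q a" "ev R a = v * ev S a"
      using id.has_value_Fract PQ RS by metis+
    then show "ev (P * S) a = ev (R * Q) a" by simp
  qed
  then show ?thesis using PQ RS by (simp add: eq_fract)
qed

lemma rename_mpol_nz:
  assumes "inj s" "Q \<noteq> 0"
  shows "mpol_eval Cm (\<lambda>i. Xm (s i)) Q \<noteq> 0"
proof
  assume eq: "mpol_eval Cm (\<lambda>i. Xm (s i)) Q = 0"
  have "Q = 0"
  proof (rule mpol_eq_0I[of 0])
    fix b :: "nat \<Rightarrow> coef"
    have "ev (mpol_eval Cm (\<lambda>i. Xm (s i)) Q) (b \<circ> inv_into UNIV s) = ev Q b"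
      unfolding eval_compose[OF id.coef_hom_axioms] using assms(1) by simp
    then show "ev Q b = 0" using eq by simp
  qed
  then show False using assms(2) by simp
qed

lemma rename_quot:
  assumes "inj s" "Q \<noteq> 0"
  shows "rename s (to_fract P / to_fract Q) =
    to_fract (mpol_eval Cm (\<lambda>i. Xm (s i)) P) / to_fract (mpol_eval Cm (\<lambda>i. Xm (s i)) Q)"
proof -
  have *: "to_fract (mpol_eval Cm (\<lambda>i. Xm (s i)) R) = mpol_eval const (\<lambda>i. xvar (s i)) R" for R
    by (simp add: to_fract_eval to_fract_Xm)
  have hv: "has_value_at const (\<lambda>i. xvar (s i)) (to_fract P / to_fract Q)
      (mpol_eval const (\<lambda>i. xvar (s i)) P / mpol_eval const (\<lambda>i. xvar (s i)) Q)"
    by (rule const.has_value_quot) (use rename_mpol_nz[OF assms] in \<open>simp flip: *\<close>)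
  show ?thesis
    unfolding rename_def * by (rule the_equality, rule hv) (rule const.has_value_unique[OF _ hv])
qed

lemma val_at_rename:
  assumes "inj s" "val_at (a \<circ> s) f v"
  shows "val_at a (rename s f) v"
proof -
  obtain P Q where PQ: "f = to_fract P / to_fract Q" "ev Q (a \<circ> s) \<noteq> 0" "v = ev P (a \<circ> s) / ev Q (a \<circ> s)" "Q \<noteq> 0"
    using assms(2) by (rule id.has_valueE)
  have e: "ev (mpol_eval Cm (\<lambda>i. Xm (s i)) R) a = ev R (a \<circ> s)" for R
    by (simp add: eval_compose[OF id.coef_hom_axioms] o_def)
  show ?thesis
    unfolding PQ(1) rename_quot[OF assms(1) PQ(4)] PQ(3) e[symmetric]
    by (rule id.has_value_quot) (use PQ(2) e in simp)
qed

lemma xvar_eq_iff: "xvar i = xvar j \<longleftrightarrow> i = j"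
  by (simp add: Xm_eq_iff flip: to_fract_Xm)

lemma xvar_nz: "xvar i \<noteq> 0"
proof
  assume "xvar i = 0"
  then have "Xm i = 0" by (simp flip: to_fract_Xm)
  then have "ev (Xm i) (\<lambda>_. 1) = 0" by simp
  then show False by simp
qed

text \<open>The link between rational functions and functions of sets. Since \<open>F\<close> sees
  only the set of coordinates, \<open>f\<close> is forced to be symmetric.\<close>

definition val :: "nat \<Rightarrow> ratf \<Rightarrow> (coef set \<Rightarrow> coef) \<Rightarrow> bool" where
  "val n f F \<longleftrightarrow> supp n F \<and> (\<forall>a. generic n a \<longrightarrow> val_at a f (F (a ` {..<n})))"

lemma val_inj: "val n f F \<Longrightarrow> val n g F \<Longrightarrow> f = g"
  by (rule ratf_eqI[of n]) (auto simp: val_def)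

lemma good_enum:
  assumes "finite V" "card V = n" "(0::coef) \<notin> V"
  obtains a where "generic n a" "a ` {..<n} = V"
proof -
  obtain a where "bij_betw a {..<n} V"
    using ex_bij_betw_nat_finite[OF assms(1)] assms(2) by (auto simp: lessThan_atLeast0)
  then show ?thesis using assms(3) by (intro that) (auto simp: generic_def bij_betw_def)
qed

lemma val_unique:
  assumes "val n f F" "val n f G"
  shows "F = G"
proof
  fix V
  show "F V = G V"
  proof (cases "finite V \<and> card V = n \<and> 0 \<notin> V")
    case True
    then obtain a where "generic n a" "a ` {..<n} = V" using good_enum by metis
    then show ?thesis using assms id.has_value_unique unfolding val_def by metis
  next
    case False
    then show ?thesis using assms unfolding val_def supp_def by metis
  qed
qed

section \<open>From rational functions to functions of finite sets\<close>

definition Dp :: "nat \<Rightarrow> mpol" where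
  "Dp n = dsc {..<n} Xm"

lemma (in coef_hom) eval_Dp: "mpol_eval h A (Dp n) = dsc {..<n} A"
  by (simp add: Dp_def eval_dsc)

lemma Dp_nz [simp]: "Dp n \<noteq> 0"
  by (simp add: Dp_def dsc_nz inj_on_def Xm_eq_iff)

lemma dsc_generic_nz: "generic n (a :: nat \<Rightarrow> coef) \<Longrightarrow> dsc {..<n} a \<noteq> 0"
  by (simp add: dsc_nz generic_def)

lemma val_at_std: "generic n a \<Longrightarrow> val_at a (to_fract P / to_fract (Dp n)) (ev P a / dsc {..<n} a)"
  using id.has_value_quot[of a "Dp n" P] by (simp add: id.eval_Dp dsc_generic_nz)

lemma rep_val_at:
  assumes "rep n F P" "generic n a"
  shows "val_at a (to_fract P / to_fract (Dp n)) (F (a ` {..<n}))"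
proof -
  have "F (a ` {..<n}) = ev P a / dsc {..<n} a"
    using assms dsc_generic_nz[OF assms(2)] by (simp add: rep_def field_simps)
  then show ?thesis using val_at_std[OF assms(2)] by simp
qed

lemma rep_val: "rep n F P \<Longrightarrow> supp n F \<Longrightarrow> val n (to_fract P / to_fract (Dp n)) F"
  by (simp add: val_def rep_val_at)

lemma Dp_pairs: "dsc {..<n} A = (\<Prod>(i, j)\<in>pairs n. (A i - A j) * (A j - A i))"
proof (induction n)
  case 0
  then show ?case by (simp add: dsc_def pairs_def)
next
  case (Suc n)
  have "pairs (Suc n) = pairs n \<union> (\<lambda>i. (i, n)) ` {..<n}" by (auto simp: pairs_def less_Suc_eq)
  moreover have "pairs n \<inter> (\<lambda>i. (i, n)) ` {..<n} = {}" by (auto simp: pairs_def)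
  ultimately have "(\<Prod>(i, j)\<in>pairs (Suc n). (A i - A j) * (A j - A i)) =
      dsc {..<n} A * (\<Prod>i<n. (A i - A n) * (A n - A i))"
    by (simp add: prod.union_disjoint prod.reindex inj_on_def Suc)
  also have "\<dots> = dsc ({..<n} \<union> {n}) A"
    by (subst dsc_Un) (auto simp: mixed_def dsc_def)
  finally show ?case by (simp add: lessThan_Suc)
qed

text \<open>Each pair contributes minus a square to the discriminant, whereas
  \<open>diagonal_poles\<close> is stated with powers of one difference; the signs are collected
  here.\<close>

definition signX :: "nat \<Rightarrow> mpol" where
  "signX n = (\<Prod>p\<in>pairs n. - 1)"

lemma signX_sq: "signX n * signX n = 1"
  by (simp add: signX_def flip: prod.distrib)

lemma Dp_squares: "Dp n = signX n * (\<Prod>(i, j)\<in>pairs n. (Xm i - Xm j) ^ 2)"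
  unfolding Dp_def Dp_pairs signX_def prod.distrib[symmetric]
  by (rule prod.cong) (auto simp: power2_eq_square algebra_simps)

lemma to_fract_prod: "to_fract (\<Prod>i\<in>I. f i) = (\<Prod>i\<in>I. to_fract (f i))"
  by (induction I rule: infinite_finite_induct) simp_all

lemma diagonal_polesE:
  assumes "diagonal_poles n f"
  obtains P where "f = to_fract P / to_fract (Dp n)"
proof -
  obtain P e where e: "\<And>i j. e i j \<le> (2::nat)"
    and f: "f = to_fract P / (\<Prod>(i, j)\<in>pairs n. (xvar i - xvar j) ^ e i j)"
    using assms by (auto simp: diagonal_poles_def pairs_def)
  define E where "E = (\<Prod>(i, j)\<in>pairs n. (Xm i - Xm j) ^ e i j)"
  define E' where "E' = signX n * (\<Prod>(i, j)\<in>pairs n. (Xm i - Xm j) ^ (2 - e i j))"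
  have fE: "f = to_fract P / to_fract E"
    unfolding f E_def by (simp add: to_fract_prod case_prod_unfold to_fract_power to_fract_Xm)
  have "E * E' = Dp n"
    unfolding E_def E'_def Dp_squares using e
    by (simp add: case_prod_unfold mult.left_commute flip: prod.distrib power_add)
  then have D: "to_fract (Dp n) = to_fract E * to_fract E'" by (metis to_fract_mult)
  then have "to_fract E' \<noteq> 0" using Dp_nz[of n] by (metis mult_zero_right to_fract_eq_0_iff)
  then have "f = to_fract (P * E') / to_fract (Dp n)" by (simp add: fE D)
  then show ?thesis by (rule that)
qed

lemma diagonal_polesI: "diagonal_poles n (to_fract P / to_fract (Dp n))"
proof -
  have "to_fract (Dp n) = to_fract (signX n) * (\<Prod>(i, j)\<in>pairs n. (xvar i - xvar j) ^ 2)"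
    unfolding Dp_squares by (simp add: to_fract_prod case_prod_unfold to_fract_power to_fract_Xm)
  moreover have "to_fract (signX n) * to_fract (signX n) = 1" by (simp add: signX_sq flip: to_fract_mult)
  ultimately have "to_fract P / to_fract (Dp n) =
      to_fract (P * signX n) / (\<Prod>(i, j)\<in>pairs n. (xvar i - xvar j) ^ 2)"
    by (simp add: divide_inverse inverse_unique mult_ac)
  then show ?thesis unfolding diagonal_poles_def
    by (intro exI[of _ "P * signX n"] exI[of _ "\<lambda>i j. 2"]) (simp add: pairs_def)
qed

lemma same_image_perm:
  assumes "inj_on a {..<n}" "inj_on b {..<n}" "a ` {..<n} = b ` {..<n}"
  obtains s where "s permutes {..<n}" "\<And>i. i < n \<Longrightarrow> b i = a (s i)"
proof -
  define s where "s i = (if i < n then the_inv_into {..<n} a (b i) else i)" for i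
  have bb: "bij_betw (the_inv_into {..<n} a \<circ> b) {..<n} {..<n}"
  proof (rule bij_betw_trans)
    show "bij_betw b {..<n} (a ` {..<n})" using assms by (simp add: bij_betw_def)
    show "bij_betw (the_inv_into {..<n} a) (a ` {..<n}) {..<n}"
      by (rule bij_betw_the_inv_into) (use assms in \<open>simp add: bij_betw_def\<close>)
  qed
  then have "bij_betw s {..<n} {..<n}"
    by (rule bij_betw_cong[THEN iffD1, rotated]) (simp add: s_def)
  then have "s permutes {..<n}" by (rule bij_imp_permutes) (simp add: s_def)
  moreover have "b i = a (s i)" if "i < n" for i
  proof -
    have "b i \<in> a ` {..<n}" using assms(3) that by auto
    then show ?thesis using f_the_inv_into_f[OF assms(1)] that by (simp add: s_def)
  qed
  ultimately show ?thesis by (rule that)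
qed

text \<open>Setting all further variables to 0 fixes the discriminant and some fraction in
  \<open>n\<close> variables equal to \<open>f\<close>. Cancelling in the cross-multiplied identity
  shows that it fixes \<open>P\<close>, too.\<close>

lemma ratfuns_vars:
  assumes "f \<in> ratfuns n" "f = to_fract P / to_fract (Dp n)"
  shows "mpol_vars P \<subseteq> {..<n}"
proof -
  obtain R S where RS: "f = Fract R S" "S \<noteq> 0" "mpol_vars R \<subseteq> {..<n}" "mpol_vars S \<subseteq> {..<n}"
    using assms(1) by (auto simp: ratfuns_def)
  let ?\<sigma> = "mpol_eval Cm (\<lambda>i. if i < n then Xm i else 0)"
  have "Fract P (Dp n) = Fract R S" using assms(2) RS(1) by (simp add: Fract_conv_to_fract)
  then have eq: "P * S = R * Dp n" using RS(2) by (simp add: eq_fract)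
  have closed: "?\<sigma> Q = Q" if "mpol_vars Q \<subseteq> {..<n}" for Q
  proof -
    have "?\<sigma> Q = mpol_eval Cm Xm Q" by (rule Cm.eval_cong) (use that in auto)
    then show ?thesis by (simp add: mpol_eval_Cm_Xm)
  qed
  have D: "?\<sigma> (Dp n) = Dp n" unfolding Cm.eval_Dp by (simp add: Dp_def dsc_def)
  have "?\<sigma> P * ?\<sigma> S = ?\<sigma> R * ?\<sigma> (Dp n)"
    using arg_cong[OF eq, of ?\<sigma>] by (simp only: Cm.eval_mult)
  then have "?\<sigma> P * S = P * S" unfolding closed[OF RS(3)] closed[OF RS(4)] D eq .
  then have "?\<sigma> P = P" using RS(2) by simp
  then have ev: "ev P a = ev P (\<lambda>i. if i < n then a i else 0)" for a
    using eval_compose[OF id.coef_hom_axioms, of a "\<lambda>i. if i < n then Xm i else 0" P]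
    by (simp add: if_distrib[of "\<lambda>Q. ev Q a"] cong: if_cong)
  show ?thesis
  proof (rule mpol_varsI)
    fix a b :: "nat \<Rightarrow> coef" assume "\<And>i. i < n \<Longrightarrow> a i = b i"
    then have "(\<lambda>i. if i < n then a i else 0) = (\<lambda>i. if i < n then b i else 0)" by auto
    then show "ev P a = ev P b" using ev[of a] ev[of b] by simp
  qed
qed

text \<open>Wheel conditions are stated for the variables 0, 1 and 2, so an enumeration has to put
  the three points there.\<close>

lemma three_enum:
  assumes "finite V" "card V = n" "(0::coef) \<notin> V" "x \<in> V" "y \<in> V" "z \<in> V" "distinct [x, y, z]"
  obtains a where "generic n a" "a ` {..<n} = V" "a 0 = x" "a 1 = y" "a 2 = z"
proof -
  obtain xs where xs: "distinct xs" "set xs = V - {x, y, z}"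
    using finite_distinct_list[of "V - {x, y, z}"] assms(1) by auto
  let ?l = "x # y # z # xs"
  have d: "distinct ?l" and s: "set ?l = V" using assms xs by auto
  then have len: "length ?l = n" using assms(2) distinct_card[OF d] by simp
  have img: "(!) ?l ` {..<n} = V"
    unfolding s[symmetric] set_conv_nth len[symmetric] by auto
  have "generic n ((!) ?l)"
    unfolding generic_def using inj_on_nth[OF d, of "{..<n}"] len img assms(3) by (metis imageI lessThan_iff)
  then show ?thesis by (rule that[OF _ img]) (simp_all add: numeral_2_eq_2)
qed

lemma q_ratios: "q1 \<noteq> 1" "q2 \<noteq> 1" "q1 * q2 \<noteq> 1" "q1 * q2 \<noteq> q1" "q1 * q2 \<noteq> q2" "q1 \<noteq> q2"
proof -
  have ne: "qm i j \<noteq> qm i' j'" if "(i, j) \<noteq> (i', j')" for i j i' j'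
    using qm_independent[of 1 i j 1 i' j'] that by auto
  then show "q1 \<noteq> 1" "q2 \<noteq> 1" "q1 * q2 \<noteq> 1" "q1 * q2 \<noteq> q1" "q1 * q2 \<noteq> q2" "q1 \<noteq> q2"
    using ne[of 1 0 0 0] ne[of 0 1 0 0] ne[of 1 1 0 0] ne[of 1 1 1 0] ne[of 1 1 0 1] ne[of 1 0 0 1]
    by (simp_all add: qm_def)
qed

lemma rescaled_point:
  "(\<lambda>i. if n - k \<le> i \<and> i < n then to_fract [:0, xvar i:] else to_fract [:xvar i:]) =
    (\<lambda>i. to_fract (resc {n - k..<n} xvar i))"
  by (auto simp: resc_def fun_eq_iff)

lemma eval_constpf:
  "mpol_eval (\<lambda>c. to_fract [:const c:]) (\<lambda>i. to_fract (A i)) P = to_fract (mpol_eval (\<lambda>c. [:const c:]) A P)"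
  by (subst constp.eval_hom[where \<phi> = to_fract]) simp_all

lemma sgeneric_xvar: "S \<subseteq> {..<n} \<Longrightarrow> sgeneric n S xvar"
  by (simp add: sgeneric_def inj_on_def xvar_eq_iff xvar_nz)

lemma coeff_eval_resc_xvar:
  "finite S \<Longrightarrow> coeff (mpol_eval (\<lambda>c. [:const c:]) (resc S xvar) P) j = to_fract (part S j P)"
  by (simp add: const.coeff_eval_resc eval_xvar)

lemma A_space_val:
  assumes "f \<in> A_space n"
  shows "\<exists>F\<in>Bsp n. val n f F"
proof (cases "n = 0")
  case True
  then obtain c where c: "f = const c" using assms by (auto simp: A_space_def)
  have "(\<lambda>V. c * en 0 V + 0) \<in> Bsp 0" by (rule lincomb_Bsp[OF en_Bsp Bsp_zero])
  moreover have "val_at a f (c * en 0 (a ` {..<0}) + 0)" for a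
    using id.has_value_const[of a c] by (simp add: c en_def pp_def)
  ultimately show ?thesis using True BspD(1) unfolding val_def by blast
next
  case n: False
  then have f: "f \<in> ratfuns n" "symmetric n f" "diagonal_poles n f"
      "\<And>k. k \<le> n \<Longrightarrow> \<exists>g. partial_infty n k f g \<and> partial_zero n k f g"
      "n \<ge> 3 \<Longrightarrow> vanishes_at_wheel q1 (q1 * q2) f \<and> vanishes_at_wheel q2 (q1 * q2) f"
    using assms by (auto simp: A_space_def)
  obtain P where P: "f = to_fract P / to_fract (Dp n)" using f(3) by (rule diagonal_polesE)
  have fF: "f = Fract P (Dp n)" using P by (simp add: Fract_conv_to_fract)
  have vars: "mpol_vars P \<subseteq> {..<n}" by (rule ratfuns_vars[OF f(1) P])
  \<comment> \<open>The chosen enumeration does not matter, by the symmetry of \<open>f\<close>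
    (fact \<open>sym\<close> below).\<close>
  define F where "F V = (if finite V \<and> card V = n \<and> 0 \<notin> V
    then (let a = (SOME a. generic n a \<and> a ` {..<n} = V) in ev P a / dsc {..<n} a) else 0)" for V
  have supp: "supp n F" by (simp add: F_def supp_def)
  have sym: "ev P a / dsc {..<n} a = ev P b / dsc {..<n} b"
    if ab: "generic n a" "generic n b" "a ` {..<n} = b ` {..<n}" for a b
  proof -
    obtain s where s: "s permutes {..<n}" "\<And>i. i < n \<Longrightarrow> b i = a (s i)"
      using same_image_perm[of a n b] ab by (auto simp: generic_def)
    have "generic n (a \<circ> s)" using ab(2) s(2) by (auto simp: generic_def inj_on_def)
    then have "val_at a (rename s f) (ev P (a \<circ> s) / dsc {..<n} (a \<circ> s))"
      unfolding P by (intro val_at_rename permutes_inj[OF s(1)] val_at_std)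
    moreover have "rename s f = f" using f(2) s(1) by (simp add: symmetric_def)
    moreover have "val_at a f (ev P a / dsc {..<n} a)" unfolding P by (rule val_at_std[OF ab(1)])
    ultimately have "ev P a / dsc {..<n} a = ev P (a \<circ> s) / dsc {..<n} (a \<circ> s)"
      using id.has_value_unique by metis
    moreover have "ev P (a \<circ> s) = ev P b" by (rule id.eval_cong) (use vars s(2) in auto)
    moreover have "dsc {..<n} (a \<circ> s) = dsc {..<n} b" by (rule dsc_cong) (simp add: s(2))
    ultimately show ?thesis by simp
  qed
  have rep: "rep n F P"
    unfolding rep_def
  proof (intro allI impI)
    fix a :: "nat \<Rightarrow> coef" assume a: "generic n a"
    let ?Q = "\<lambda>b. generic n b \<and> b ` {..<n} = a ` {..<n}"
    have good: "finite (a ` {..<n})" "card (a ` {..<n}) = n" "0 \<notin> a ` {..<n}"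
      using a by (auto simp: generic_def card_image)
    have "?Q (SOME b. ?Q b)" by (rule someI[of ?Q a]) (simp add: a)
    then have "F (a ` {..<n}) = ev P a / dsc {..<n} a"
      using sym[OF a, of "SOME b. ?Q b"] good by (simp add: F_def Let_def)
    then show "F (a ` {..<n}) * dsc {..<n} a = ev P a" using dsc_generic_nz[OF a] by simp
  qed
  have wheel: "wheel F"
    unfolding wheel_def
  proof (intro allI impI, rule ccontr)
    fix V x assume x: "x \<in> V \<and> (q1 * x \<in> V \<or> q2 * x \<in> V) \<and> q1 * q2 * x \<in> V" and nz: "F V \<noteq> 0"
    then obtain q where q: "q \<in> {q1, q2}" "q * x \<in> V" by auto
    have V: "finite V" "card V = n" "0 \<notin> V" using nz supp by (auto simp: supp_def)
    then have "x \<noteq> 0" using x by auto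
    then have d: "distinct [x, q * x, q1 * q2 * x]" using q(1) q_ratios by auto
    then have "card {x, q * x, q1 * q2 * x} = 3" by simp
    then have n3: "n \<ge> 3" using V x q(2) card_mono[of V "{x, q * x, q1 * q2 * x}"] by auto
    obtain a where a: "generic n a" "a ` {..<n} = V" "a 0 = x" "a 1 = q * x" "a 2 = q1 * q2 * x"
      using three_enum[OF V _ q(2) _ d] x by blast
    let ?A = "xvar(1 := const q * xvar 0, 2 := const (q1 * q2) * xvar 0)"
    let ?B = "Xm(1 := Cm q * Xm 0, 2 := Cm (q1 * q2) * Xm 0)"
    have "vanishes_at_wheel q (q1 * q2) f" using f(5)[OF n3] q(1) by auto
    then have "has_value_at const ?A (Fract P (Dp n)) 0" by (simp add: vanishes_at_wheel_def fF)
    then have "mpol_eval const ?A P = 0" using const.has_value_Fract by fastforce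
    moreover have "(\<lambda>i. to_fract (?B i)) = ?A"
      by (auto simp: fun_eq_iff to_fract_Xm to_fract_Cm)
    ultimately have "mpol_eval Cm ?B P = 0" using to_fract_eval[of ?B P] by simp
    then have "ev (mpol_eval Cm ?B P) a = 0" by simp
    moreover have "(\<lambda>i. ev (?B i) a) = a" using a by (auto simp: fun_eq_iff)
    ultimately have "ev P a = 0" by (simp add: eval_compose[OF id.coef_hom_axioms])
    then show False using rep a nz dsc_generic_nz[OF a(1)] by (auto simp: rep_def)
  qed
  \<comment> \<open>The limits at 0 give lower bounds for the weights. For \<open>k = n\<close> all
    variables are rescaled, and the limit at infinity adds the matching upper bound, which fixes the
    total degree.\<close>
  have lims: "(\<forall>m\<in>Poly_Mapping.keys P. k * (k - 1) \<le> wt {n - k..<n} m) \<and>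
      (k = n \<longrightarrow> (\<forall>m\<in>Poly_Mapping.keys P. wt {..<n} m \<le> n * (n - 1)))"
    if k: "1 \<le> k" "k \<le> n" for k
  proof -
    let ?S = "{n - k..<n}" and ?lo = "k * (k - 1)"
    have S: "?S \<subseteq> {..<n}" "card ?S = k" "finite ?S" using k by auto
    define pP where "pP = mpol_eval (\<lambda>c. [:const c:]) (resc ?S xvar) P"
    define pD where "pD = mpol_eval (\<lambda>c. [:const c:]) (resc ?S xvar) (Dp n)"
    let ?R = "reg_part n ?S xvar"
    have pD: "pD = monom 1 ?lo * ?R"
      unfolding pD_def constp.eval_Dp using dsc_resc[OF S(1)] S(2) by metis
    have R0: "poly ?R 0 \<noteq> 0" by (rule poly_reg_part_0_nz[OF sgeneric_xvar[OF S(1)]])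
    have coeff: "coeff pP j = to_fract (part ?S j P)" for j
      unfolding pP_def by (rule coeff_eval_resc_xvar[OF S(3)])
    obtain g where g: "partial_infty n k f g" "partial_zero n k f g" using f(4) k by blast
    have cross: "pP * v = u * pD" if "rescaled n k f (Fract u v)" "v \<noteq> 0" for u v
    proof -
      have "has_value_at (\<lambda>c. to_fract [:const c:]) (\<lambda>i. to_fract (resc ?S xvar i)) (Fract P (Dp n)) (Fract u v)"
        using that(1) unfolding rescaled_def rescaled_point fF .
      then have "to_fract pP = Fract u v * to_fract pD"
        unfolding pP_def pD_def eval_constpf[symmetric] by (rule constpf.has_value_Fract[OF _ Dp_nz])
      then have "to_fract pP * to_fract v = to_fract u * to_fract pD"
        using that(2) by (simp add: Fract_conv_to_fract field_simps)
      then show ?thesis by (simp flip: to_fract_mult)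
    qed
    obtain u v where uv: "rescaled n k f (Fract u v)" "poly v 0 \<noteq> 0"
      using g(2) k by (auto simp: partial_zero_def lim_at_zero_def)
    then have "v \<noteq> 0" by auto
    then have "pP * v = monom 1 ?lo * (u * ?R)" using cross[OF uv(1)] pD by (simp add: mult_ac)
    then have "monom 1 ?lo dvd pP" using monom_dvd_cancel[OF _ uv(2)] by (metis dvd_triv_left)
    then obtain w where w: "pP = monom 1 ?lo * w" by (rule dvdE)
    have low: "?lo \<le> wt ?S m" if m: "m \<in> Poly_Mapping.keys P" for m
    proof (rule ccontr)
      assume "\<not> ?lo \<le> wt ?S m"
      then have "coeff pP (wt ?S m) = 0" unfolding w by (simp add: coeff_monom_mult)
      then have "part ?S (wt ?S m) P = 0" by (simp add: coeff)
      then show False using m unfolding part_0_iff by blast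
    qed
    have "wt {..<n} m \<le> n * (n - 1)" if kn: "k = n" and m: "m \<in> Poly_Mapping.keys P" for m
    proof (rule ccontr)
      assume gt: "\<not> wt {..<n} m \<le> n * (n - 1)"
      have Sn: "?S = {..<n}" using kn by auto
      obtain u v where uv: "rescaled n k f (Fract u v)" "v \<noteq> 0" "degree u \<le> degree v"
        using g(1) k by (auto simp: partial_infty_def lim_at_infty_def)
      have "degree ?R = 0" unfolding Sn by (simp add: reg_part_def mixed_def)
      then have dD: "degree pD \<le> n * (n - 1)"
        unfolding pD kn using degree_mult_le[of "monom 1 (n * (n - 1))" ?R] degree_monom_le[of "1::ratf" "n * (n - 1)"]
        by (simp add: kn)
      have nz: "pP \<noteq> 0"
      proof
        assume "pP = 0"
        then have "part ?S (wt ?S m) P = 0" using coeff[of "wt ?S m"] by simp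
        then show False using m unfolding part_0_iff by blast
      qed
      have "degree pP + degree v = degree (u * pD)" using cross[OF uv(1,2)] nz uv(2) by (metis degree_mult_eq)
      also have "\<dots> \<le> degree v + n * (n - 1)" using degree_mult_le[of u pD] uv(3) dD by linarith
      finally have "coeff pP (wt {..<n} m) = 0" using gt by (intro coeff_eq_0) linarith
      then have "part {..<n} (wt {..<n} m) P = 0" unfolding coeff Sn by simp
      then show False using m unfolding part_0_iff by blast
    qed
    then show ?thesis using low by blast
  qed
  have total: "wt {..<n} m = n * (n - 1)" if m: "m \<in> Poly_Mapping.keys P" for m
  proof -
    have "{n - n..<n} = {..<n}" by auto
    then show ?thesis using lims[of n] n m by (metis Suc_leI eq_imp_le le_antisym neq0_conv One_nat_def)
  qed
  have hom: "homog F" by (rule homog_of_total[OF supp rep total])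
  have "has_lims F"
  proof (rule has_lims_of_weights[OF supp rep])
    fix k assume k: "k \<le> n"
    show "\<exists>S\<subseteq>{..<n}. card S = k \<and> (\<forall>m\<in>Poly_Mapping.keys P. card S * (card S - 1) \<le> wt S m)"
    proof (cases "k = 0")
      case True
      then show ?thesis by (intro exI[of _ "{}"]) auto
    next
      case False
      then show ?thesis using lims[of k] k by (intro exI[of _ "{n - k..<n}"]) auto
    qed
  qed
  then have "F \<in> Bsp n" using BspI[OF supp wheel rep hom] by blast
  then show ?thesis using rep_val[OF rep supp] unfolding P by blast
qed

section \<open>From functions of finite sets to rational functions\<close>

lemma (in coef_hom) eval_part_Dp:
  assumes "S \<subseteq> {..<n}"
  shows "mpol_eval h A (part S (card S * (card S - 1)) (Dp n)) = poly (reg_part n S A) 0"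
proof -
  interpret p: coef_hom "\<lambda>c. [:h c:]" by (rule coef_hom_pCons)
  have "finite S" using assms finite_subset by blast
  then have "mpol_eval h A (part S (card S * (card S - 1)) (Dp n)) =
      coeff (mpol_eval (\<lambda>c. [:h c:]) (resc S A) (Dp n)) (card S * (card S - 1))"
    by (simp add: coeff_eval_resc)
  also have "\<dots> = coeff (monom 1 (card S * (card S - 1)) * reg_part n S A) (card S * (card S - 1))"
    by (simp only: p.eval_Dp dsc_resc[OF assms])
  finally show ?thesis by (simp add: coeff_monom_mult poly_0_coeff_0)
qed

text \<open>The discriminant is the numerator of the function with value 1 on all sets of
  \<open>n\<close> nonzero points, whose limits exist.\<close>

lemma adm_Dp: "adm n (Dp n)"
proof -
  let ?F = "\<lambda>V::coef set. if finite V \<and> card V = n \<and> 0 \<notin> V then 1 else (0::coef)"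
  have "rep n ?F (Dp n)"
    unfolding rep_def by (auto simp: id.eval_Dp generic_def card_image)
  moreover have "homog ?F"
    unfolding homog_def
    by (auto simp: finite_image_iff card_image inj_on_scale image_iff)
  moreover have "has_lims ?F"
  proof (rule has_limsI[where n = n])
    show "supp n ?F" by (simp add: supp_def)
    fix Y Z :: "coef set" assume YZ: "finite Y" "finite Z" "0 \<notin> Y" "0 \<notin> Z" "card Y + card Z = n"
    have "?F (Y \<union> (*) x ` Z) = 1" if "x \<noteq> 0" "Y \<inter> (*) x ` Z = {}" for x
      using YZ that by (auto simp: card_Un_disjoint card_image inj_on_scale)
    then have "{x. ?F (Y \<union> (*) x ` Z) \<noteq> 1} \<subseteq> {0} \<union> {x. Y \<inter> (*) x ` Z \<noteq> {}}" by blast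
    then have "finite {x. ?F (Y \<union> (*) x ` Z) \<noteq> 1}"
      by (rule finite_subset) (use YZ finite_meets_scaled in simp)
    then show "\<exists>L. lim0 (\<lambda>x. ?F (Y \<union> (*) x ` Z)) L"
      by (intro exI[of _ 1]) (rule lim0_cong[OF _ lim0_const])
  qed
  ultimately show ?thesis by (rule adm_of_lims)
qed

lemma wt_complement:
  assumes "S \<subseteq> {..<n}"
  shows "wt S m + wt ({..<n} - S) m = wt {..<n} m"
  unfolding wt_def using assms by (metis finite_lessThan sum.subset_diff add.commute)

text \<open>As the total weight is fixed, high weight in \<open>S\<close> is low weight in the
  complement. This turns a limit at infinity into a limit at 0.\<close>

lemma part_complement:
  assumes "adm n P" "S \<subseteq> {..<n}" "j + j' = n * (n - 1)"
  shows "part ({..<n} - S) j' P = part S j P"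
proof (rule poly_mapping_eqI)
  fix m
  show "Poly_Mapping.lookup (part ({..<n} - S) j' P) m = Poly_Mapping.lookup (part S j P) m"
  proof (cases "m \<in> Poly_Mapping.keys P")
    case True
    then have "wt S m + wt ({..<n} - S) m = n * (n - 1)"
      using assms(1) wt_complement[OF assms(2), of m] by (simp add: adm_def)
    then have "wt ({..<n} - S) m = j' \<longleftrightarrow> wt S m = j" using assms(3) by linarith
    then show ?thesis by (simp add: part_def lookup_pfilter)
  next
    case False
    then show ?thesis by (simp add: part_def lookup_pfilter in_keys_iff)
  qed
qed

definition wheel_pt :: "coef \<Rightarrow> (nat \<Rightarrow> coef) \<Rightarrow> nat \<Rightarrow> coef" where
  "wheel_pt q b = b(1 := q * b 0, 2 := q1 * q2 * b 0)"

text \<open>Every coordinate is a positive integer times a monomial in \<open>q1\<close> and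
  \<open>q2\<close>. The three with integer \<open>b 0\<close> differ in the monomial, all others in
  the integer.\<close>

lemma wheel_pt_generic:
  assumes "inj b" "\<And>i. b i > (0::nat)" "q \<in> {q1, q2}"
  shows "generic n (wheel_pt q (\<lambda>i. of_nat (b i)))"
proof -
  define c where "c i = (if i = 1 then (if q = q1 then (1, 0) else (0, 1)) else if i = 2 then (1, 1) else (0::int, 0::int))" for i :: nat
  define r where "r i = (if i = 1 \<or> i = 2 then b 0 else b i)" for i
  have eq: "wheel_pt q (\<lambda>i. of_nat (b i)) i = of_nat (r i) * qm (fst (c i)) (snd (c i))" for i
    using assms(3) q_ratios by (auto simp: wheel_pt_def c_def r_def qm_def)
  have r: "r i > 0" for i using assms(2) by (simp add: r_def)
  have "inj (wheel_pt q (\<lambda>i. of_nat (b i)))"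
  proof (rule injI)
    fix i j assume "wheel_pt q (\<lambda>i. of_nat (b i)) i = wheel_pt q (\<lambda>i. of_nat (b i)) j"
    then have "r i = r j \<and> fst (c i) = fst (c j) \<and> snd (c i) = snd (c j)"
      unfolding eq by (rule qm_independent) (rule r)+
    then show "i = j" using assms(1) unfolding r_def c_def
      by (auto split: if_splits dest: injD)
  qed
  moreover have "wheel_pt q (\<lambda>i. of_nat (b i)) i \<noteq> 0" for i unfolding eq using r[of i] by simp
  ultimately show ?thesis by (auto simp: generic_def intro: inj_on_subset)
qed

text \<open>After the substitution both polynomials are tested at integer points: the numerator is 0
  there by the wheel condition, the discriminant is not, since such points are generic.\<close>

lemma vanishes_at_wheelI:
  assumes F: "F \<in> Bsp n" and P: "rep n F P" and n: "n \<ge> 3" and q: "q \<in> {q1, q2}"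
  shows "vanishes_at_wheel q (q1 * q2) (to_fract P / to_fract (Dp n))"
proof -
  let ?A = "xvar(1 := const q * xvar 0, 2 := const (q1 * q2) * xvar 0)"
  let ?B = "Xm(1 := Cm q * Xm 0, 2 := Cm (q1 * q2) * Xm 0)"
  have AB: "(\<lambda>i. to_fract (?B i)) = ?A"
    by (auto simp: fun_eq_iff to_fract_Xm to_fract_Cm)
  have ev: "ev (mpol_eval Cm ?B Q) b = ev Q (wheel_pt q b)" for Q b
  proof -
    have "(\<lambda>i. ev (?B i) b) = wheel_pt q b" by (auto simp: fun_eq_iff wheel_pt_def)
    then show ?thesis by (simp add: eval_compose[OF id.coef_hom_axioms])
  qed
  have "mpol_eval Cm ?B P = 0"
  proof (rule ccontr)
    assume "mpol_eval Cm ?B P \<noteq> 0"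
    then obtain b :: "nat \<Rightarrow> nat" where b: "inj b" "\<And>i. b i > 0" "ev (mpol_eval Cm ?B P) (\<lambda>i. of_nat (b i)) \<noteq> 0"
      using mpol_nonzero_value by metis
    let ?a = "wheel_pt q (\<lambda>i. of_nat (b i))"
    have gen: "generic n ?a" by (rule wheel_pt_generic[OF b(1,2) q])
    have mem: "?a 0 \<in> ?a ` {..<n}" "?a 1 \<in> ?a ` {..<n}" "?a 2 \<in> ?a ` {..<n}" using n by auto
    have a012: "?a 0 = of_nat (b 0)" "?a 1 = q * of_nat (b 0)" "?a 2 = q1 * q2 * of_nat (b 0)"
      by (simp_all add: wheel_pt_def)
    obtain q' where q': "{q, q'} = {q1, q2}" using q by auto
    have F0: "F (?a ` {..<n}) = 0"
      by (rule wheelD[OF BspD(2)[OF F] q']) (use mem in \<open>simp_all only: a012\<close>)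
    have "F (?a ` {..<n}) * dsc {..<n} ?a = ev P ?a" using P gen unfolding rep_def by blast
    then show False using b(3) unfolding ev F0 by simp
  qed
  then have 1: "mpol_eval const ?A P = 0" using to_fract_eval[of ?B P] AB by simp
  have "mpol_eval Cm ?B (Dp n) \<noteq> 0"
  proof
    assume eq: "mpol_eval Cm ?B (Dp n) = 0"
    let ?b = "\<lambda>i::nat. Suc i"
    have "dsc {..<n} (wheel_pt q (\<lambda>i. of_nat (?b i))) = 0"
      using ev[where Q = "Dp n" and b = "\<lambda>i. of_nat (?b i)"] eq by (simp add: id.eval_Dp)
    moreover have "generic n (wheel_pt q (\<lambda>i. of_nat (?b i)))"
      by (rule wheel_pt_generic[OF _ _ q]) simp_all
    ultimately show False using dsc_generic_nz by blast
  qed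
  then have "to_fract (mpol_eval Cm ?B (Dp n)) \<noteq> 0" unfolding to_fract_eq_0_iff .
  then have 2: "mpol_eval const ?A (Dp n) \<noteq> 0" unfolding to_fract_eval AB .
  show ?thesis
    unfolding vanishes_at_wheel_def using const.has_value_quot[OF 2, of P] 1 by simp
qed

lemma Bsp_val:
  assumes F: "F \<in> Bsp n"
  shows "\<exists>f\<in>A_space n. val n f F"
proof (cases "n = 0")
  case True
  have "supp 0 F" using BspD(1)[OF F] True by simp
  then have "val 0 (const (F {})) F" using id.has_value_const by (simp add: val_def)
  then show ?thesis using True by (auto simp: A_space_def)
next
  case n: False
  obtain P where P: "adm n P" "rep n F P" using F by (auto simp: Bsp_def)
  define f where "f = to_fract P / to_fract (Dp n)"
  have val: "val n f F" unfolding f_def by (rule rep_val[OF P(2) BspD(1)[OF F]])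
  have fF: "f = Fract P (Dp n)" by (simp add: f_def Fract_conv_to_fract)
  have vars: "f \<in> ratfuns n"
  proof -
    have "mpol_vars P \<subseteq> {..<n}" "mpol_vars (Dp n) \<subseteq> {..<n}"
      using P(1) adm_Dp[of n] by (auto simp: adm_def mpol_vars_def)
    then show ?thesis unfolding ratfuns_def fF using Dp_nz by blast
  qed
  have sym: "symmetric n f"
    unfolding symmetric_def
  proof (intro allI impI)
    fix s assume s: "s permutes {..<n}"
    show "rename s f = f"
    proof (rule ratf_eqI[of n])
      fix a :: "nat \<Rightarrow> coef" assume a: "generic n a"
      have "inj_on (a \<circ> s) {..<n}"
        using a permutes_inj_on[OF s] permutes_image[OF s] by (intro comp_inj_on) (auto simp: generic_def)
      moreover have im: "(a \<circ> s) ` {..<n} = a ` {..<n}"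
        unfolding image_comp[symmetric] permutes_image[OF s] ..
      moreover have "0 \<notin> a ` {..<n}" using a by (auto simp: generic_def)
      ultimately have "generic n (a \<circ> s)" unfolding generic_def by (metis imageI lessThan_iff)
      then have "val_at (a \<circ> s) f (F (a ` {..<n}))" using val im unfolding val_def by metis
      then have "val_at a (rename s f) (F (a ` {..<n}))" by (rule val_at_rename[OF permutes_inj[OF s]])
      moreover have "val_at a f (F (a ` {..<n}))" using val a by (simp add: val_def)
      ultimately show "\<exists>v. val_at a (rename s f) v \<and> val_at a f v" by blast
    qed
  qed
  have lims: "\<exists>g. partial_infty n k f g \<and> partial_zero n k f g" if k: "k \<le> n" for k
  proof (cases "k = 0")
    case True
    then show ?thesis by (auto simp: partial_infty_def partial_zero_def)
  next
    case k0: False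
    let ?S = "{n - k..<n}" and ?T = "{..<n} - {n - k..<n}" and ?lo = "k * (k - 1)"
    let ?lo' = "(n - k) * (n - k - 1)"
    \<comment> \<open>The largest possible weight in the last \<open>k\<close> variables: the total
      weight minus the least weight in the others. The discriminant attains it.\<close>
    define top where "top = n * (n - 1) - ?lo'"
    have S: "?S \<subseteq> {..<n}" "card ?S = k" "finite ?S" using k by auto
    have T: "?T \<subseteq> {..<n}" "card ?T = n - k" "{..<n} - ?T = ?S" using S by (auto simp: card_Diff_subset)
    have lo': "?lo' \<le> n * (n - 1)" by (intro mult_le_mono) auto
    then have tl: "top + ?lo' = n * (n - 1)" by (simp add: top_def)
    define pP where "pP = mpol_eval (\<lambda>c. [:const c:]) (resc ?S xvar) P"
    define pD where "pD = mpol_eval (\<lambda>c. [:const c:]) (resc ?S xvar) (Dp n)"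
    let ?R = "reg_part n ?S xvar"
    have pDR: "pD = monom 1 ?lo * ?R"
      unfolding pD_def constp.eval_Dp using dsc_resc[OF S(1)] S(2) by metis
    have R0: "poly ?R 0 \<noteq> 0" "poly (reg_part n ?T xvar) 0 \<noteq> 0"
      by (rule poly_reg_part_0_nz[OF sgeneric_xvar[OF S(1)]], rule poly_reg_part_0_nz[OF sgeneric_xvar[OF T(1)]])
    have coeffP: "coeff pP j = to_fract (part ?S j P)" and coeffD: "coeff pD j = to_fract (part ?S j (Dp n))" for j
      unfolding pP_def pD_def by (rule coeff_eval_resc_xvar[OF S(3)])+
    have D0: "to_fract (part ?S ?lo (Dp n)) = poly ?R 0" "to_fract (part ?T ?lo' (Dp n)) = poly (reg_part n ?T xvar) 0"
      using const.eval_part_Dp[OF S(1), of xvar] const.eval_part_Dp[OF T(1), of xvar] S(2) T(2)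
      by (simp_all add: eval_xvar)
    have pD_nz: "pD \<noteq> 0" using R0(1) pDR by auto
    have resc: "rescaled n k f (to_fract pP / to_fract pD)"
      unfolding rescaled_def rescaled_point f_def pP_def pD_def eval_constpf[symmetric]
      by (rule constpf.has_value_quot) (use pD_nz in \<open>simp add: eval_constpf flip: pD_def\<close>)
    have "coeff pP j = 0" if "j < ?lo" for j
    proof -
      have "?lo \<le> wt ?S m" if "m \<in> Poly_Mapping.keys P" for m using low_weightD[OF P(1) that S(1)] S(2) by simp
      then have "part ?S j P = 0" unfolding part_0_iff using that by fastforce
      then show ?thesis by (simp add: coeffP)
    qed
    then obtain N where N: "pP = monom 1 ?lo * N" "\<And>j. coeff N j = coeff pP (j + ?lo)"
      using low_coeffs_factor[of ?lo pP] by blast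
    have "lim_at_zero (to_fract pP / to_fract pD) (to_fract (part ?S ?lo P) / poly ?R 0)"
      unfolding lim_at_zero_def
    proof (intro exI conjI)
      have "to_fract (monom (1::ratf) ?lo) \<noteq> 0" by simp
      then show "to_fract pP / to_fract pD = Fract N ?R"
        unfolding N(1) pDR Fract_conv_to_fract to_fract_mult by simp
      show "to_fract (part ?S ?lo P) / poly ?R 0 = poly N 0 / poly ?R 0"
        using N(2)[of 0] by (simp add: poly_0_coeff_0 coeffP)
    qed (rule R0)
    moreover have "lim_at_infty (to_fract pP / to_fract pD) (to_fract (part ?T ?lo' P) / poly (reg_part n ?T xvar) 0)"
    proof -
      have high: "degree (mpol_eval (\<lambda>c. [:const c:]) (resc ?S xvar) Q) \<le> top" if Q: "adm n Q" for Q
      proof (rule degree_le, intro allI impI)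
        fix j assume j: "top < j"
        have "wt ?S m \<noteq> j" if m: "m \<in> Poly_Mapping.keys Q" for m
        proof -
          have "wt ?S m + wt ?T m = n * (n - 1)" using wt_complement[OF S(1), of m] Q m by (simp add: adm_def)
          moreover have "?lo' \<le> wt ?T m" using low_weightD[OF Q m T(1)] T(2) by simp
          ultimately show ?thesis using j tl by linarith
        qed
        then have "part ?S j Q = 0" by (simp add: part_0_iff)
        then show "coeff (mpol_eval (\<lambda>c. [:const c:]) (resc ?S xvar) Q) j = 0"
          by (simp add: coeff_eval_resc_xvar)
      qed
      have top: "coeff pP top = to_fract (part ?T ?lo' P)" "coeff pD top = to_fract (part ?T ?lo' (Dp n))"
        unfolding coeffP coeffD using part_complement[OF P(1) S(1) tl] part_complement[OF adm_Dp S(1) tl] by simp_all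
      have "coeff pD top \<noteq> 0" unfolding top D0 by (rule R0)
      then have deg: "degree pD = top"
        using high[OF adm_Dp] le_degree[of pD top] unfolding pD_def by simp
      show ?thesis
        unfolding lim_at_infty_def
      proof (intro exI conjI)
        show "to_fract pP / to_fract pD = Fract pP pD" by (simp add: Fract_conv_to_fract)
        show "degree pP \<le> degree pD" unfolding deg pP_def by (rule high[OF P(1)])
        show "to_fract (part ?T ?lo' P) / poly (reg_part n ?T xvar) 0 = coeff pP (degree pD) / lead_coeff pD"
          unfolding deg top D0 ..
      qed (rule pD_nz)
    qed
    \<comment> \<open>At generic points both limits are values of \<open>delta\<close>, with the two
      clusters exchanged, so \<open>Bsp_lim_sym\<close> identifies them.\<close>
    moreover have "to_fract (part ?S ?lo P) / poly ?R 0 = to_fract (part ?T ?lo' P) / poly (reg_part n ?T xvar) 0"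
    proof (rule ratf_eqI[of n])
      fix a :: "nat \<Rightarrow> coef" assume a: "generic n a"
      have v: "val_at a (to_fract (part U (card U * (card U - 1)) P) / to_fract (part U (card U * (card U - 1)) (Dp n)))
          (delta F (a ` ({..<n} - U)) (a ` U))" if U: "U \<subseteq> {..<n}" for U
        unfolding delta_rep[OF P(2,1) generic_imp_sgeneric[OF a U]] id.eval_part_Dp[OF U, symmetric]
        by (rule id.has_value_quot, unfold id.eval_part_Dp[OF U])
          (rule poly_reg_part_0_nz[OF generic_imp_sgeneric[OF a U]])
      have "val_at a (to_fract (part ?S ?lo P) / poly ?R 0) (delta F (a ` ?T) (a ` ?S))"
        using v[OF S(1)] unfolding S(2) D0 .
      moreover have "val_at a (to_fract (part ?T ?lo' P) / poly (reg_part n ?T xvar) 0) (delta F (a ` ?S) (a ` ?T))"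
        using v[OF T(1)] unfolding T(2,3) D0 .
      moreover have "delta F (a ` ?T) (a ` ?S) = delta F (a ` ?S) (a ` ?T)"
      proof -
        have "finite (a ` ?T)" "finite (a ` ?S)" "0 \<notin> a ` ?T" "0 \<notin> a ` ?S"
          using a by (auto simp: generic_def image_iff) 
        then show ?thesis using Bsp_lim_sym[OF F] unfolding lim_sym_def by blast
      qed
      ultimately show "\<exists>v. val_at a (to_fract (part ?S ?lo P) / poly ?R 0) v \<and>
          val_at a (to_fract (part ?T ?lo' P) / poly (reg_part n ?T xvar) 0) v" by metis
    qed
    ultimately show ?thesis
      unfolding partial_infty_def partial_zero_def using resc k0 by auto
  qed
  have "f \<in> A_space n"
    using n vars sym lims diagonal_polesI[of n P] vanishes_at_wheelI[OF F P(2)]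
    by (simp add: A_space_def f_def)
  then show ?thesis using val by blast
qed

lemma A_space_iff: "f \<in> A_space n \<longleftrightarrow> (\<exists>F\<in>Bsp n. val n f F)"
  using A_space_val Bsp_val val_inj by metis

section \<open>The star product in terms of finite sets\<close>

lemma extend_bij:
  assumes "I \<subseteq> {..<N}" "card I = m"
  obtains t where "t permutes {..<N}" "t ` {..<m} = I"
proof -
  have fin: "finite I" using assms(1) finite_subset by blast
  have mN: "m \<le> N" using card_mono[OF finite_lessThan assms(1)] assms(2) by simp
  obtain e where e: "bij_betw e {..<m} I"
    using ex_bij_betw_nat_finite[OF fin] assms(2) by (auto simp: lessThan_atLeast0)
  have "card ({..<N} - {..<m}) = card ({..<N} - I)"
    using assms fin mN by (simp add: card_Diff_subset)
  then obtain e' where e': "bij_betw e' ({..<N} - {..<m}) ({..<N} - I)"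
    by (metis finite_Diff finite_lessThan finite_same_card_bij)
  define t where "t i = (if i < m then e i else if i < N then e' i else i)" for i
  have 1: "bij_betw t {..<m} I" using e by (rule bij_betw_cong[THEN iffD1, rotated]) (simp add: t_def)
  have 2: "bij_betw t ({..<N} - {..<m}) ({..<N} - I)"
    using e' by (rule bij_betw_cong[THEN iffD1, rotated]) (simp add: t_def)
  have "bij_betw t ({..<m} \<union> ({..<N} - {..<m})) (I \<union> ({..<N} - I))"
    by (rule bij_betw_combine[OF 1 2]) auto
  moreover have "{..<m} \<union> ({..<N} - {..<m}) = {..<N}" "I \<union> ({..<N} - I) = {..<N}" using mN assms(1) by auto
  ultimately have "t permutes {..<N}" using mN by (intro bij_imp_permutes) (auto simp: t_def)
  then show ?thesis using 1 by (intro that) (auto simp: bij_betw_def)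
qed

text \<open>Permutations are grouped by the image of the first \<open>m\<close> indices. Composition
  with a fixed permutation shows that all groups are equally large, and the number of all
  permutations gives their size.\<close>

lemma sum_permutes_image:
  fixes g :: "nat set \<Rightarrow> coef"
  assumes "m \<le> N"
  shows "(\<Sum>s | s permutes {..<N}. g (s ` {..<m})) =
    of_nat (fact m * fact (N - m)) * (\<Sum>I | I \<subseteq> {..<N} \<and> card I = m. g I)"
proof -
  let ?P = "{s. s permutes {..<N}}" and ?Is = "{I. I \<subseteq> {..<N} \<and> card I = m}"
  let ?c = "\<lambda>I. card {s \<in> ?P. s ` {..<m} = I}"
  have finP: "finite ?P" by (rule finite_permutations) simp
  have finI: "finite ?Is" by simp
  have into: "(\<lambda>s. s ` {..<m}) ` ?P \<subseteq> ?Is"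
  proof (rule image_subsetI)
    fix s assume "s \<in> ?P"
    then have s: "s permutes {..<N}" by simp
    have "s ` {..<m} \<subseteq> s ` {..<N}" using assms by auto
    then show "s ` {..<m} \<in> ?Is"
      using permutes_image[OF s] permutes_inj_on[OF s] by (simp add: card_image)
  qed
  have group: "(\<Sum>s\<in>?P. u (s ` {..<m})) = (\<Sum>I\<in>?Is. of_nat (?c I) * u I)" for u :: "nat set \<Rightarrow> coef"
  proof -
    have "(\<Sum>s\<in>?P. u (s ` {..<m})) = (\<Sum>I\<in>?Is. \<Sum>s\<in>{s \<in> ?P. s ` {..<m} = I}. u (s ` {..<m}))"
      by (rule sum.group[OF finP finI into, symmetric])
    also have "\<dots> = (\<Sum>I\<in>?Is. of_nat (?c I) * u I)" by (intro sum.cong refl) simp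
    finally show ?thesis .
  qed
  have const: "?c I = ?c {..<m}" if I: "I \<in> ?Is" for I
  proof -
    obtain t where t: "t permutes {..<N}" "t ` {..<m} = I" using extend_bij I by blast
    have comp_image: "(f \<circ> s) ` {..<m} = f ` (s ` {..<m})" for f s :: "nat \<Rightarrow> nat"
      by (rule image_comp[symmetric])
    have "bij_betw (\<lambda>s. t \<circ> s) {s \<in> ?P. s ` {..<m} = {..<m}} {s \<in> ?P. s ` {..<m} = I}"
    proof (rule bij_betw_byWitness[where f' = "\<lambda>s. inv_into UNIV t \<circ> s"])
      have it: "inv_into UNIV t permutes {..<N}" by (rule permutes_inv[OF t(1)])
      have o: "inv_into UNIV t \<circ> t = id" "t \<circ> inv_into UNIV t = id"
        using permutes_inv_o[OF t(1)] by simp_all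
      show "\<forall>s\<in>{s \<in> ?P. s ` {..<m} = {..<m}}. inv_into UNIV t \<circ> (t \<circ> s) = s" using o by (simp add: o_assoc)
      show "\<forall>s\<in>{s \<in> ?P. s ` {..<m} = I}. t \<circ> (inv_into UNIV t \<circ> s) = s" using o by (simp add: o_assoc)
      show "(\<lambda>s. t \<circ> s) ` {s \<in> ?P. s ` {..<m} = {..<m}} \<subseteq> {s \<in> ?P. s ` {..<m} = I}"
      proof (rule image_subsetI)
        fix s assume "s \<in> {s \<in> ?P. s ` {..<m} = {..<m}}"
        then have s: "s permutes {..<N}" "s ` {..<m} = {..<m}" by blast+
        have "(t \<circ> s) ` {..<m} = I" unfolding comp_image[of t s] s(2) t(2) ..
        then show "t \<circ> s \<in> {s \<in> ?P. s ` {..<m} = I}" using permutes_compose[OF s(1) t(1)] by blast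
      qed
      have "inv_into UNIV t ` I = {..<m}" using t(2) o(1) by (metis image_comp image_id id_apply)
      then show "(\<lambda>s. inv_into UNIV t \<circ> s) ` {s \<in> ?P. s ` {..<m} = I} \<subseteq> {s \<in> ?P. s ` {..<m} = {..<m}}"
        using permutes_compose[OF _ it] comp_image[of "inv_into UNIV t"] by blast
    qed
    then show ?thesis by (rule bij_betw_same_card[symmetric])
  qed
  have card: "?c {..<m} = fact m * fact (N - m)"
  proof -
    have "(of_nat (fact N) :: coef) = (\<Sum>s\<in>?P. 1)" by (simp add: card_permutations)
    also have "\<dots> = (\<Sum>I\<in>?Is. of_nat (?c I) * 1)" by (rule group)
    also have "\<dots> = (\<Sum>I\<in>?Is. of_nat (?c {..<m}))" by (intro sum.cong refl) (simp only: const mult_1_right)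
    also have "\<dots> = of_nat ((N choose m) * ?c {..<m})" by (simp add: n_subsets)
    finally have "fact N = (N choose m) * ?c {..<m}" by (simp only: of_nat_eq_iff)
    moreover have "fact N = (N choose m) * (fact m * fact (N - m))"
      using binomial_fact_lemma[OF assms] by (simp add: mult.commute)
    moreover have "(N choose m) \<noteq> 0" using assms by simp
    ultimately show ?thesis by simp
  qed
  show ?thesis unfolding group sum_distrib_left
    by (intro sum.cong refl) (simp only: const card)
qed

lemma val_lincomb:
  assumes "val n f F" "val n g G"
  shows "val n (scale c f + g) (\<lambda>V. c * F V + G V)"
proof -
  have "supp n (\<lambda>V. c * F V + G V)"
    using assms unfolding val_def supp_def by (metis add_0 mult_zero_right)
  moreover have "val_at a (scale c f + g) (c * F (a ` {..<n}) + G (a ` {..<n}))" if "generic n a" for a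
    unfolding scale_def using assms that id.has_value_const[of a c]
    by (intro id.has_value_add id.has_value_mult) (auto simp: val_def)
  ultimately show ?thesis by (simp add: val_def)
qed

lemma val_zero: "val n 0 (\<lambda>V. 0)"
  using id.has_value_const[of _ 0] by (simp add: val_def supp_def)

lemma val_at_omega: "a i \<noteq> a j \<Longrightarrow> val_at a (omega (xvar i) (xvar j)) (om (a i) (a j))"
proof -
  have *: "val_at a (const c) c" for c using id.has_value_const[of a c] by simp
  show "a i \<noteq> a j \<Longrightarrow> ?thesis"
    unfolding omega_def om_def
    by (intro id.has_value_divide id.has_value_mult id.has_value_diff id.has_value_power id.has_value_xvar *) simp
qed

text \<open>The term of \<open>Sym\<close> for a permutation depends only on the set of points
  assigned to the first factor, and each such set occurs \<open>fact m * fact n\<close>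
  times.\<close>

lemma val_star:
  assumes f: "val m f F" and g: "val n g G"
  shows "val (m + n) (star m n f g) (\<lambda>V. of_nat (fact m * fact n) / of_nat (fact (m + n)) * conv F G V)"
proof -
  let ?N = "m + n"
  have supp: "supp m F" "supp n G" using f g by (simp_all add: val_def)
  let ?U = "f * rename (\<lambda>i. m + i) g * (\<Prod>\<alpha>\<in>{..<m}. \<Prod>\<beta>\<in>{m..<m + n}. omega (xvar \<alpha>) (xvar \<beta>))"
  let ?u = "\<lambda>a. F (a ` {..<m}) * G (a ` {m..<?N}) * Om (a ` {..<m}) (a ` {m..<?N})"
  have U: "val_at a ?U (?u a)" if a: "generic ?N a" for a
  proof -
    have inj: "inj_on a {..<?N}" using a by (simp add: generic_def)
    have ne: "a i \<noteq> a j" if "i < m" "j \<in> {m..<?N}" for i j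
      using inj_onD[OF inj, of i j] that by fastforce
    have gm: "generic m a" using a by (auto simp: generic_def inj_on_def)
    have "inj_on (a \<circ> (\<lambda>i. m + i)) {..<n}"
      by (rule comp_inj_on) (auto intro: inj_on_subset[OF inj])
    then have gn: "generic n (a \<circ> (\<lambda>i. m + i))" using a by (auto simp: generic_def)
    have im: "(a \<circ> (\<lambda>i. m + i)) ` {..<n} = a ` {m..<?N}"
      unfolding image_comp[symmetric] by (simp add: lessThan_atLeast0 image_add_atLeastLessThan add.commute)
    have "val_at a (rename (\<lambda>i. m + i) g) (G (a ` {m..<?N}))"
      using g gn im by (intro val_at_rename) (auto simp: val_def inj_on_def)
    moreover have "val_at a f (F (a ` {..<m}))" using f gm by (simp add: val_def)
    moreover have "val_at a (\<Prod>\<alpha>\<in>{..<m}. \<Prod>\<beta>\<in>{m..<?N}. omega (xvar \<alpha>) (xvar \<beta>))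
        (\<Prod>\<alpha>\<in>{..<m}. \<Prod>\<beta>\<in>{m..<?N}. om (a \<alpha>) (a \<beta>))"
      by (intro id.has_value_prod val_at_omega) (use ne in auto)
    moreover have "(\<Prod>\<alpha>\<in>{..<m}. \<Prod>\<beta>\<in>{m..<?N}. om (a \<alpha>) (a \<beta>)) = Om (a ` {..<m}) (a ` {m..<?N})"
    proof -
      have "inj_on a {..<m}" "inj_on a {m..<?N}" using inj by (auto simp: inj_on_def)
      then show ?thesis by (simp add: Om_def prod.reindex)
    qed
    ultimately show ?thesis by (simp add: id.has_value_mult)
  qed
  have star: "val_at a (star m n f g) (of_nat (fact m * fact n) / of_nat (fact ?N) * conv F G (a ` {..<?N}))"
    if a: "generic ?N a" for a
  proof -
    have inj: "inj_on a {..<?N}" using a by (simp add: generic_def)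
    let ?t = "\<lambda>I. F (a ` I) * G (a ` ({..<?N} - I)) * Om (a ` I) (a ` ({..<?N} - I))"
    have ren: "val_at a (rename s ?U) (?t (s ` {..<m}))" if s: "s permutes {..<?N}" for s
    proof -
      have "inj_on (a \<circ> s) {..<?N}"
        using inj permutes_inj_on[OF s] permutes_image[OF s] by (intro comp_inj_on) auto
      moreover have "(a \<circ> s) i \<noteq> 0" if "i < ?N" for i
        using a permutes_in_image[OF s, of i] that by (simp add: generic_def)
      ultimately have "generic ?N (a \<circ> s)" by (simp add: generic_def)
      then have "val_at a (rename s ?U) (?u (a \<circ> s))" by (intro val_at_rename permutes_inj[OF s] U)
      moreover have "s ` {m..<?N} = {..<?N} - s ` {..<m}"
      proof -
        have "{m..<?N} = {..<?N} - {..<m}" by auto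
        then show ?thesis using image_set_diff[OF permutes_inj[OF s], of "{..<?N}" "{..<m}"] permutes_image[OF s] by simp
      qed
      ultimately show ?thesis by (simp only: image_comp[symmetric])
    qed
    have "val_at a (star m n f g) ((\<Sum>s | s permutes {..<?N}. ?t (s ` {..<m})) / of_nat (fact ?N))"
      unfolding star_def Sym_def
      by (intro id.has_value_divide id.has_value_sum id.has_value_of_nat ren) simp_all
    moreover have "(\<Sum>s | s permutes {..<?N}. ?t (s ` {..<m})) = of_nat (fact m * fact n) * conv F G (a ` {..<?N})"
      using sum_permutes_image[of m ?N ?t] by (simp add: conv_image[OF supp(1) inj])
    ultimately show ?thesis by simp
  qed
  moreover have "supp ?N (\<lambda>V. of_nat (fact m * fact n) / of_nat (fact ?N) * conv F G V)"
    using conv_supp[OF supp] unfolding supp_def by (metis mult_zero_right)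
  ultimately show ?thesis by (simp add: val_def)
qed

section \<open>Dimensions\<close>

definition has_basis :: "(coef set \<Rightarrow> coef) set \<Rightarrow> nat \<Rightarrow> bool" where
  "has_basis \<V> d \<longleftrightarrow> (\<exists>b. (\<forall>i<d. b i \<in> \<V>) \<and>
     (\<forall>F\<in>\<V>. \<exists>c. F = (\<lambda>V. \<Sum>i<d. c i * b i V)) \<and>
     (\<forall>c. (\<lambda>V. \<Sum>i<d. c i * b i V) = (\<lambda>V. 0) \<longrightarrow> (\<forall>i<d. c i = 0)))"

lemma sum_lessThan_add:
  fixes g :: "nat \<Rightarrow> 'b::comm_monoid_add"
  shows "(\<Sum>i<d + e. g i) = (\<Sum>i<d. g i) + (\<Sum>j<e. g (d + j))"
  by (induction e) (simp_all add: add.assoc)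

text \<open>Rank and nullity: a basis of the kernel together with preimages of a basis of the image.
  Linearity of \<open>T\<close> is asked only on the space, since limits need not exist
  elsewhere.\<close>

lemma has_basis_extension:
  assumes lin: "\<And>F G c. F \<in> \<V> \<Longrightarrow> G \<in> \<V> \<Longrightarrow> (\<lambda>V. c * F V + G V) \<in> \<V>" and zero: "(\<lambda>V. 0) \<in> \<V>"
    and T: "\<And>F G c. F \<in> \<V> \<Longrightarrow> G \<in> \<V> \<Longrightarrow> T (\<lambda>V. c * F V + G V) = (\<lambda>V. c * T F V + T G V)"
    and ker: "has_basis {F \<in> \<V>. T F = (\<lambda>V. 0)} d" and im: "has_basis (T ` \<V>) e"
  shows "has_basis \<V> (d + e)"
proof -
  obtain u where u: "\<And>i. i < d \<Longrightarrow> u i \<in> {F \<in> \<V>. T F = (\<lambda>V. 0)}"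
      "\<And>F. F \<in> \<V> \<Longrightarrow> T F = (\<lambda>V. 0) \<Longrightarrow> \<exists>c. F = (\<lambda>V. \<Sum>i<d. c i * u i V)"
      "\<And>c. (\<lambda>V. \<Sum>i<d. c i * u i V) = (\<lambda>V. 0) \<Longrightarrow> \<forall>i<d. c i = 0"
    using ker unfolding has_basis_def by auto
  obtain w where w: "\<And>j. j < e \<Longrightarrow> w j \<in> T ` \<V>"
      "\<And>F. F \<in> T ` \<V> \<Longrightarrow> \<exists>c. F = (\<lambda>V. \<Sum>j<e. c j * w j V)"
      "\<And>c. (\<lambda>V. \<Sum>j<e. c j * w j V) = (\<lambda>V. 0) \<Longrightarrow> \<forall>j<e. c j = 0"
    using im unfolding has_basis_def by auto
  have "\<forall>j\<in>{..<e}. \<exists>v. v \<in> \<V> \<and> T v = w j" using w(1) by force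
  from bchoice[OF this] obtain v where v: "\<And>j. j < e \<Longrightarrow> v j \<in> \<V>" "\<And>j. j < e \<Longrightarrow> T (v j) = w j" by auto
  have T0: "T (\<lambda>V. 0) = (\<lambda>V. 0)" using T[OF zero zero, of "-1"] by (simp add: fun_eq_iff)
  have sums: "(\<lambda>V. \<Sum>i<k. c i * x i V) \<in> \<V> \<and> T (\<lambda>V. \<Sum>i<k. c i * x i V) = (\<lambda>V. \<Sum>i<k. c i * T (x i) V)"
    if "\<And>i. i < k \<Longrightarrow> x i \<in> \<V>" for k :: nat and c x
    using that
  proof (induction k)
    case (Suc k)
    then have IH: "(\<lambda>V. \<Sum>i<k. c i * x i V) \<in> \<V>" "T (\<lambda>V. \<Sum>i<k. c i * x i V) = (\<lambda>V. \<Sum>i<k. c i * T (x i) V)"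
      by auto
    have "(\<lambda>V. \<Sum>i<Suc k. c i * x i V) = (\<lambda>V. c k * x k V + (\<Sum>i<k. c i * x i V))"
      by (simp add: add.commute)
    then show ?case using lin[OF _ IH(1), of "x k" "c k"] T[OF _ IH(1), of "x k" "c k"] Suc.prems IH(2)
      by (simp add: add.commute)
  qed (simp add: zero T0)
  define b where "b i = (if i < d then u i else v (i - d))" for i
  have split: "(\<Sum>i<d + e. c i * b i V) = (\<Sum>i<d. c i * u i V) + (\<Sum>j<e. c (d + j) * v j V)" for c V
    by (simp add: sum_lessThan_add b_def)
  show ?thesis
    unfolding has_basis_def
  proof (intro exI[of _ b] conjI allI impI ballI)
    fix i assume "i < d + e"
    then show "b i \<in> \<V>" using u(1)[of i] v(1)[of "i - d"] by (auto simp: b_def)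
  next
    fix F assume F: "F \<in> \<V>"
    obtain c where c: "T F = (\<lambda>V. \<Sum>j<e. c j * w j V)" using w(2) F by blast
    define G where "G = (\<lambda>V. \<Sum>j<e. c j * v j V)"
    have G: "G \<in> \<V>" "T G = T F" using sums[of e v c] v by (simp_all add: G_def c)
    define H where "H = (\<lambda>V. (-1) * G V + F V)"
    have "H \<in> \<V>" unfolding H_def by (rule lin[OF G(1) F])
    moreover have "T H = (\<lambda>V. 0)" unfolding H_def T[OF G(1) F] G(2) by simp
    ultimately obtain c' where c': "H = (\<lambda>V. \<Sum>i<d. c' i * u i V)" using u(2) by blast
    have "F V = (\<Sum>i<d + e. (if i < d then c' i else c (i - d)) * b i V)" for V
    proof -
      have "F V = H V + G V" by (simp add: H_def)
      also have "H V = (\<Sum>i<d. c' i * u i V)" by (simp add: c')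
      finally show ?thesis unfolding split by (simp add: G_def)
    qed
    then have "F = (\<lambda>V. \<Sum>i<d + e. (if i < d then c' i else c (i - d)) * b i V)" by (rule ext)
    then show "\<exists>c. F = (\<lambda>V. \<Sum>i<d + e. c i * b i V)"
      by (rule exI[of _ "\<lambda>i. if i < d then c' i else c (i - d)"])
  next
    fix c i assume eq: "(\<lambda>V. \<Sum>i<d + e. c i * b i V) = (\<lambda>V. 0)" and i: "i < d + e"
    let ?U = "\<lambda>V. \<Sum>i<d. c i * u i V" and ?W = "\<lambda>V. \<Sum>j<e. c (d + j) * v j V"
    have UW: "?U V + ?W V = 0" for V using fun_cong[OF eq, of V] by (simp add: split)
    have U: "?U \<in> \<V>" "T ?U = (\<lambda>V. 0)" using sums[of d u c] u(1) by auto
    have W: "?W \<in> \<V>" "T ?W = (\<lambda>V. \<Sum>j<e. c (d + j) * w j V)" using sums[of e v "\<lambda>j. c (d + j)"] v by auto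
    have "(\<lambda>V. 1 * ?U V + ?W V) = (\<lambda>V. 0)" by (rule ext) (simp add: UW)
    then have "T ?W = (\<lambda>V. 0)" using T[OF U(1) W(1), of 1] T0 U(2) by simp
    then have cw: "\<forall>j<e. c (d + j) = 0" using w(3)[of "\<lambda>j. c (d + j)"] W(2) by simp
    then have "?U V = 0" for V using UW[of V] by simp
    then have cu: "\<forall>i<d. c i = 0" by (intro u(3)) (rule ext)
    show "c i = 0"
    proof (cases "i < d")
      case False
      then have "i - d < e" using i by linarith
      then show ?thesis using cw[rule_format, of "i - d"] False by simp
    qed (use cu in simp)
  qed
qed

text \<open>The number of partitions of \<open>n\<close> into parts of size at most \<open>p\<close>.\<close>

fun pc :: "nat \<Rightarrow> nat \<Rightarrow> nat" where
  "pc 0 n = (if n = 0 then 1 else 0)"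
| "pc (Suc p) n = pc p n + (if Suc p \<le> n then pc (Suc p) (n - Suc p) else 0)"

text \<open>The recursion of \<open>pc\<close> is the dimension count for \<open>Th (Suc p)\<close>,
  whose kernel is \<open>Bp n p\<close>. If \<open>Suc p > n\<close> the operator is 0 and the two
  steps of the filtration agree.\<close>

lemma has_basis_Bp: "has_basis (Bp n p) (pc p n)"
proof (induction p n rule: pc.induct)
  case (1 n)
  show ?case
  proof (cases "n = 0")
    case True
    have e0: "en 0 {} = 1" by (simp add: en_def pp_def)
    show ?thesis
      unfolding has_basis_def
    proof (intro exI[of _ "\<lambda>i. en 0"] conjI allI impI ballI)
      show "en 0 \<in> Bp n 0" using Efun_Bp[of "[]" 0 n] True by (simp add: Efun_Nil)
    next
      fix F assume F: "F \<in> Bp n 0"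
      have "\<exists>c. F = (\<lambda>V. c * en 0 V)" by (rule exI, rule Bp_0[OF F])
      then obtain c where "F = (\<lambda>V. c * en 0 V)" ..
      then show "\<exists>c. F = (\<lambda>V. \<Sum>i<pc 0 n. c i * en 0 V)"
        by (intro exI[of _ "\<lambda>_. c"]) (simp add: True lessThan_Suc)
    next
      fix c i assume eq: "(\<lambda>V. \<Sum>i<pc 0 n. c i * en 0 V) = (\<lambda>V. 0)" and i: "i < pc 0 n"
      show "c i = 0" using fun_cong[OF eq, of "{}"] i by (simp add: e0 True lessThan_Suc)
    qed
  next
    case False
    have "F = (\<lambda>V. 0)" if "F \<in> Bp n 0" for F
      using that False by (intro Bsp_eq_0I[of F n]) (auto simp: Bp_def)
    then show ?thesis using False by (simp add: has_basis_def)
  qed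
next
  case (2 p n)
  have sub: "F \<in> Bp n (Suc p)" "Th (Suc p) F = (\<lambda>Z. 0)" if "F \<in> Bp n p" for F
    using that by (auto simp: Bp_def)
  have ker: "{F \<in> Bp n (Suc p). Th (Suc p) F = (\<lambda>Z. 0)} = Bp n p"
    using sub Bp_kernel by blast
  show ?case
  proof (cases "Suc p \<le> n")
    case True
    have im: "Th (Suc p) ` Bp n (Suc p) = Bp (n - Suc p) (Suc p)"
    proof
      show "Th (Suc p) ` Bp n (Suc p) \<subseteq> Bp (n - Suc p) (Suc p)" using Th_Bp by blast
      show "Bp (n - Suc p) (Suc p) \<subseteq> Th (Suc p) ` Bp n (Suc p)"
      proof
        fix F assume "F \<in> Bp (n - Suc p) (Suc p)"
        then obtain G where "G \<in> Esp n (Suc p)" "Th (Suc p) G = F"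
          using Esp_lift[of F "n - Suc p" "Suc p"] True unfolding Bp_eq_Esp by auto
        then show "F \<in> Th (Suc p) ` Bp n (Suc p)" unfolding Bp_eq_Esp by blast
      qed
    qed
    have "has_basis (Bp n (Suc p)) (pc p n + pc (Suc p) (n - Suc p))"
    proof (rule has_basis_extension[where T = "Th (Suc p)"])
      fix F G :: "coef set \<Rightarrow> coef" and c assume "F \<in> Bp n (Suc p)" "G \<in> Bp n (Suc p)"
      then show "(\<lambda>V. c * F V + G V) \<in> Bp n (Suc p)"
        "Th (Suc p) (\<lambda>V. c * F V + G V) = (\<lambda>V. c * Th (Suc p) F V + Th (Suc p) G V)"
        using Bp_lincomb Th_lincomb[OF BspD(4) BspD(4), of F n G n] by (auto simp: Bp_def)
    qed (use Bp_zero ker im 2 True in auto)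
    then show ?thesis using True by simp
  next
    case False
    then have "Th (Suc p) F = (\<lambda>Z. 0)" if "F \<in> Bp n (Suc p)" for F
      using Th_eq_0[OF BspD(1), of F n "Suc p"] that by (simp add: Bp_def)
    then have "Bp n (Suc p) = Bp n p" using ker by blast
    then show ?thesis using False 2(1) by simp
  qed
qed

section \<open>Transfer to the spaces of rational functions\<close>

lemma A_space_lincomb:
  assumes "f \<in> A_space n" "g \<in> A_space n"
  shows "scale c f + g \<in> A_space n"
  using assms val_lincomb lincomb_Bsp unfolding A_space_iff by blast

lemma A_space_zero: "0 \<in> A_space n"
  using val_zero Bsp_zero unfolding A_space_iff by blast

lemma A_space_add: "f \<in> A_space n \<Longrightarrow> g \<in> A_space n \<Longrightarrow> f + g \<in> A_space n"
  using A_space_lincomb[of f n g 1] by simp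

lemma A_space_scale: "f \<in> A_space n \<Longrightarrow> scale c f \<in> A_space n"
  using A_space_lincomb[OF _ A_space_zero, of f n c] by simp

lemma A_space_subspace: "ratf.subspace (A_space n)"
  by (rule ratf.subspaceI) (auto simp: A_space_zero A_space_add A_space_scale)

lemma val_sum:
  fixes d :: nat
  assumes "\<And>i. i < d \<Longrightarrow> val n (f i) (F i)"
  shows "val n (\<Sum>i<d. scale (c i) (f i)) (\<lambda>V. \<Sum>i<d. c i * F i V)"
  using assms
proof (induction d)
  case (Suc d)
  then show ?case using val_lincomb[of n "f d" "F d" "\<Sum>i<d. scale (c i) (f i)" "\<lambda>V. \<Sum>i<d. c i * F i V" "c d"]
    by (simp add: add.commute)
qed (simp add: val_zero)

lemma dim_A_space: "ratf.dim (A_space n) = pc n n"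
proof -
  let ?d = "pc n n"
  have "has_basis (Bsp n) ?d" using has_basis_Bp[of n n] by (simp add: Bsp_eq_Bp)
  then obtain b where b: "\<And>i. i < ?d \<Longrightarrow> b i \<in> Bsp n"
      "\<And>F. F \<in> Bsp n \<Longrightarrow> \<exists>c. F = (\<lambda>V. \<Sum>i<?d. c i * b i V)"
      "\<And>c. (\<lambda>V. \<Sum>i<?d. c i * b i V) = (\<lambda>V. 0) \<Longrightarrow> \<forall>i<?d. c i = 0"
    unfolding has_basis_def by auto
  have "\<forall>i\<in>{..<?d}. \<exists>f. f \<in> A_space n \<and> val n f (b i)" using b(1) Bsp_val by blast
  from bchoice[OF this] obtain f where f: "\<And>i. i < ?d \<Longrightarrow> f i \<in> A_space n" "\<And>i. i < ?d \<Longrightarrow> val n (f i) (b i)"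
    by auto
  have indep: "\<forall>i<?d. c i = 0" if "(\<Sum>i<?d. scale (c i) (f i)) = 0" for c
  proof (rule b(3), rule val_unique)
    show "val n 0 (\<lambda>V. \<Sum>i<?d. c i * b i V)" using val_sum[of ?d n f b c] f(2) that by simp
  qed (rule val_zero)
  \<comment> \<open>Dimension counts the elements of a set, so the members of the family have to be
    distinct.\<close>
  have inj: "inj_on f {..<?d}"
  proof (rule inj_onI, rule ccontr)
    fix i j assume ij: "i \<in> {..<?d}" "j \<in> {..<?d}" "f i = f j" "i \<noteq> j"
    define c :: "nat \<Rightarrow> coef" where "c k = (if k = i then 1 else if k = j then -1 else 0)" for k
    have "(\<Sum>k<?d. scale (c k) (f k)) = (\<Sum>k\<in>{i, j}. scale (c k) (f k))"
      by (rule sum.mono_neutral_right) (use ij in \<open>auto simp: c_def\<close>)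
    also have "\<dots> = 0" using ij by (simp add: c_def)
    finally have "\<forall>k<?d. c k = 0" by (rule indep)
    then have "c i = 0" using ij by blast
    then show False by (simp add: c_def)
  qed
  show ?thesis
  proof (rule ratf.dim_unique)
    show "f ` {..<?d} \<subseteq> A_space n" using f(1) by auto
    show "A_space n \<subseteq> ratf.span (f ` {..<?d})"
    proof
      fix g assume "g \<in> A_space n"
      then obtain G where G: "G \<in> Bsp n" "val n g G" using A_space_val by blast
      then obtain c where "G = (\<lambda>V. \<Sum>i<?d. c i * b i V)" using b(2) by blast
      then have "val n (\<Sum>i<?d. scale (c i) (f i)) G" using val_sum[of ?d n f b c] f(2) by simp
      then have "g = (\<Sum>i<?d. scale (c i) (f i))" by (rule val_inj[OF G(2)])
      then show "g \<in> ratf.span (f ` {..<?d})"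
        by (simp only:) (intro ratf.span_sum ratf.span_scale ratf.span_base imageI)
    qed
    show "ratf.independent (f ` {..<?d})"
    proof (rule ratf.independent_if_scalars_zero)
      fix u x assume "(\<Sum>x\<in>f ` {..<?d}. scale (u x) x) = 0" and x: "x \<in> f ` {..<?d}"
      then have "(\<Sum>i<?d. scale (u (f i)) (f i)) = 0" by (simp add: sum.reindex[OF inj])
      then show "u x = 0" using indep[of "\<lambda>i. u (f i)"] x by auto
    qed simp
    show "card (f ` {..<?d}) = ?d" using inj by (simp add: card_image)
  qed
qed

section \<open>The Poincare series\<close>

text \<open>No part of a partition of \<open>n\<close> exceeds \<open>n\<close>, so a larger bound
  changes nothing.\<close>

lemma pc_stable: "n \<le> p \<Longrightarrow> pc p n = pc n n"
proof (induction p)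
  case (Suc p)
  then show ?case by (cases "n = Suc p") auto
qed simp

text \<open>By the recursion of \<open>pc\<close>, multiplying the series for \<open>Suc p\<close>
  by \<open>1 - fps_X ^ Suc p\<close> gives the series for \<open>p\<close>.\<close>

lemma pc_prod: "(\<Prod>m<p. inverse (1 - fps_X ^ Suc m) :: rat fps) = Abs_fps (\<lambda>n. of_nat (pc p n))"
proof (induction p)
  case 0
  show ?case by (rule fps_ext) simp
next
  case (Suc p)
  let ?A = "\<lambda>p. Abs_fps (\<lambda>n. of_nat (pc p n)) :: rat fps"
  let ?e = "1 - fps_X ^ Suc p :: rat fps"
  have e1: "?A (Suc p) * ?e = ?A p"
  proof (rule fps_ext)
    fix n
    have "fps_nth (?A (Suc p) * fps_X ^ Suc p) n = (if n < Suc p then 0 else of_nat (pc (Suc p) (n - Suc p)))"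
      by (simp only: fps_X_power_mult_right_nth fps_nth_Abs_fps)
    then show "fps_nth (?A (Suc p) * ?e) n = fps_nth (?A p) n"
      by (simp add: right_diff_distrib del: power_Suc) 
  qed
  have e2: "?e * inverse ?e = 1"
    by (subst mult.commute, rule inverse_mult_eq_1) simp
  have "?A p * inverse ?e = ?A (Suc p) * (?e * inverse ?e)"
    unfolding e1[symmetric] by (simp only: mult.assoc)
  then show ?case unfolding prod.lessThan_Suc Suc.IH e2 by (simp only: mult_1_right)
qed

lemma Poincare_series:
  "(\<lambda>m. inverse (1 - fps_X ^ Suc m) :: rat fps) has_prod Abs_fps (\<lambda>n. of_nat (pc n n))"
proof -
  have "(\<lambda>N. \<Prod>m\<le>N. inverse (1 - fps_X ^ Suc m) :: rat fps) \<longlonglongrightarrow> Abs_fps (\<lambda>n. of_nat (pc n n))"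
  proof (rule tendsto_fpsI)
    fix n
    have "fps_nth (\<Prod>m\<le>N. inverse (1 - fps_X ^ Suc m) :: rat fps) n = of_nat (pc n n)" if "N \<ge> n" for N
      using pc_stable[of n "Suc N"] that unfolding lessThan_Suc_atMost[symmetric] pc_prod by simp
    then show "\<forall>\<^sub>F N in sequentially. fps_nth (\<Prod>m\<le>N. inverse (1 - fps_X ^ Suc m) :: rat fps) n =
        fps_nth (Abs_fps (\<lambda>n. of_nat (pc n n))) n"
      unfolding eventually_sequentially by auto
  qed
  \<comment> \<open>\<open>raw_has_prod\<close> requires a nonzero limit; the constant coefficient
    is 1.\<close>
  moreover have "Abs_fps (\<lambda>n. of_nat (pc n n)) \<noteq> (0 :: rat fps)"
  proof
    assume "Abs_fps (\<lambda>n. of_nat (pc n n)) = (0 :: rat fps)"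
    then have "fps_nth (Abs_fps (\<lambda>n. of_nat (pc n n)) :: rat fps) 0 = 0" by simp
    then show False by simp
  qed
  ultimately show ?thesis by (simp add: has_prod_def raw_has_prod_def)
qed

section \<open>The algebra\<close>

lemma star_closed:
  assumes "f \<in> A_space m" "g \<in> A_space n"
  shows "star m n f g \<in> A_space (m + n)"
proof -
  obtain F G where FG: "F \<in> Bsp m" "val m f F" "G \<in> Bsp n" "val n g G" using assms A_space_val by blast
  have "(\<lambda>V. of_nat (fact m * fact n) / of_nat (fact (m + n)) * conv F G V + 0) \<in> Bsp (m + n)"
    by (rule lincomb_Bsp[OF conv_Bsp[OF FG(1,3)] Bsp_zero])
  then show ?thesis using val_star[OF FG(2,4)] unfolding A_space_iff by auto
qed

lemma star_commute:
  assumes "f \<in> A_space m" "g \<in> A_space n"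
  shows "star m n f g = star n m g f"
proof -
  obtain F G where FG: "F \<in> Bsp m" "val m f F" "G \<in> Bsp n" "val n g G" using assms A_space_val by blast
  have "val (m + n) (star m n f g) (\<lambda>V. of_nat (fact m * fact n) / of_nat (fact (m + n)) * conv F G V)"
    by (rule val_star[OF FG(2,4)])
  moreover have "val (m + n) (star n m g f) (\<lambda>V. of_nat (fact m * fact n) / of_nat (fact (m + n)) * conv F G V)"
    using val_star[OF FG(4,2)] conv_commute[OF FG(1,3)] by (simp add: add.commute mult.commute)
  ultimately show ?thesis by (rule val_inj)
qed

text \<open>The factor \<open>n!\<close> absorbs the normalisation of the star product.\<close>

definition valf :: "nat \<Rightarrow> ratf \<Rightarrow> coef set \<Rightarrow> coef" where
  "valf n f V = of_nat (fact n) * (THE F. val n f F) V"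

lemma valf_eq: "val n f F \<Longrightarrow> valf n f = (\<lambda>V. of_nat (fact n) * F V)"
  unfolding valf_def using val_unique by (metis the_equality)

lemma valf_supp: "f \<in> A_space n \<Longrightarrow> supp n (valf n f)"
  using A_space_val[of f n] BspD(1) valf_eq by (fastforce simp: supp_def)

lemma valf_inj:
  assumes "f \<in> A_space n" "g \<in> A_space n" "valf n f = valf n g"
  shows "f = g"
proof -
  obtain F G where FG: "val n f F" "val n g G" using assms A_space_val by blast
  then have "(\<lambda>V. of_nat (fact n) * F V) = (\<lambda>V. of_nat (fact n) * G V)" using assms(3) valf_eq by metis
  then have "F = G" by (simp add: fun_eq_iff)
  then show ?thesis using FG val_inj by blast
qed

lemma valf_lincomb:
  assumes "f \<in> A_space n" "g \<in> A_space n"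
  shows "valf n (scale c f + g) = (\<lambda>V. c * valf n f V + valf n g V)"
proof -
  obtain F G where FG: "val n f F" "val n g G" using assms A_space_val by blast
  show ?thesis
    unfolding valf_eq[OF FG(1)] valf_eq[OF FG(2)] valf_eq[OF val_lincomb[OF FG]] by (simp add: algebra_simps)
qed

lemma valf_zero: "valf n 0 = (\<lambda>V. 0)"
  using valf_eq[OF val_zero] by simp

lemma valf_add: "f \<in> A_space n \<Longrightarrow> g \<in> A_space n \<Longrightarrow> valf n (f + g) = (\<lambda>V. valf n f V + valf n g V)"
  using valf_lincomb[of f n g 1] by simp

lemma valf_scale: "f \<in> A_space n \<Longrightarrow> valf n (scale c f) = (\<lambda>V. c * valf n f V)"
  using valf_lincomb[OF _ A_space_zero, of f n c] by (simp add: valf_zero)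

lemma A_space_sum: "(\<And>i. i \<in> I \<Longrightarrow> f i \<in> A_space n) \<Longrightarrow> (\<Sum>i\<in>I. f i) \<in> A_space n"
  by (induction I rule: infinite_finite_induct) (simp_all add: A_space_zero A_space_add)

lemma valf_sum:
  "(\<And>i. i \<in> I \<Longrightarrow> f i \<in> A_space n) \<Longrightarrow> valf n (\<Sum>i\<in>I. f i) = (\<lambda>V. \<Sum>i\<in>I. valf n (f i) V)"
  by (induction I rule: infinite_finite_induct) (simp_all add: valf_zero valf_add A_space_sum)

lemma valf_star:
  assumes "f \<in> A_space m" "g \<in> A_space n"
  shows "valf (m + n) (star m n f g) = conv (valf m f) (valf n g)"
proof -
  obtain F G where FG: "val m f F" "val n g G" using assms A_space_val by blast
  show ?thesis
    unfolding valf_eq[OF FG(1)] valf_eq[OF FG(2)] valf_eq[OF val_star[OF FG]] conv_scale by simp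
qed

lemma star_zero: "star m n 0 g = 0" "star m n f 0 = 0"
proof -
  have r0: "rename s 0 = 0" if "inj s" for s
    using rename_quot[OF that, of 1 0] by simp
  have S0: "Sym N 0 = 0" for N
    unfolding Sym_def by (simp add: r0 permutes_inj)
  show "star m n 0 g = 0" by (simp add: star_def S0)
  show "star m n f 0 = 0" by (simp add: star_def S0 r0 inj_on_def)
qed

text \<open>All components of a family as one function of sets, the cardinality selecting the
  component. The product of the direct sum then becomes plain \<open>conv\<close>.\<close>

definition tot :: "(nat \<Rightarrow> ratf) \<Rightarrow> coef set \<Rightarrow> coef" where
  "tot a V = valf (card V) (a (card V)) V"

lemma tot_valf:
  assumes "\<And>n. a n \<in> A_space n"
  shows "valf n (a n) V = (if card V = n then tot a V else 0)"
  using valf_supp[OF assms, of n] by (auto simp: tot_def supp_def)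

lemma tot_inj:
  assumes "\<And>n. a n \<in> A_space n" "\<And>n. b n \<in> A_space n" "tot a = tot b"
  shows "a = b"
proof
  fix n
  have "valf n (a n) = valf n (b n)"
    by (rule ext) (simp add: tot_valf[OF assms(1)] tot_valf[OF assms(2)] assms(3))
  then show "a n = b n" using valf_inj assms(1,2) by blast
qed

lemma tot_infinite:
  assumes "\<And>n. a n \<in> A_space n" "infinite V"
  shows "tot a V = 0"
  using valf_supp[OF assms(1), of "card V"] assms(2) by (auto simp: tot_def supp_def)

text \<open>For a given \<open>S\<close> only the term with \<open>m = card S\<close> survives, so
  the sum over degrees and subsets is a sum over subsets alone.\<close>

lemma tot_mult:
  assumes a: "\<And>n. a n \<in> A_space n" and b: "\<And>n. b n \<in> A_space n"
  shows "tot (\<lambda>N. \<Sum>m\<le>N. star m (N - m) (a m) (b (N - m))) = conv (tot a) (tot b)"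
proof
  fix V :: "coef set"
  let ?N = "card V"
  have mem: "star m (N - m) (a m) (b (N - m)) \<in> A_space N" if "m \<le> N" for m N
    using star_closed[OF a[of m] b[of "N - m"]] that by simp
  show "tot (\<lambda>N. \<Sum>m\<le>N. star m (N - m) (a m) (b (N - m))) V = conv (tot a) (tot b) V"
  proof (cases "finite V")
    case False
    have "tot (\<lambda>N. \<Sum>m\<le>N. star m (N - m) (a m) (b (N - m))) V = 0"
      by (rule tot_infinite[OF _ False]) (intro A_space_sum mem, simp)
    then show ?thesis using False by (simp add: conv_def)
  next
    case True
    have "tot (\<lambda>N. \<Sum>m\<le>N. star m (N - m) (a m) (b (N - m))) V =
        (\<Sum>m\<le>?N. valf ?N (star m (?N - m) (a m) (b (?N - m))) V)"
      unfolding tot_def using valf_sum[of "{..?N}" _ ?N] mem by simp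
    also have "\<dots> = (\<Sum>m\<le>?N. conv (valf m (a m)) (valf (?N - m) (b (?N - m))) V)"
    proof (intro sum.cong refl)
      fix m assume "m \<in> {..?N}"
      then have "m + (?N - m) = ?N" by simp
      then show "valf ?N (star m (?N - m) (a m) (b (?N - m))) V = conv (valf m (a m)) (valf (?N - m) (b (?N - m))) V"
        using valf_star[OF a[of m] b[of "?N - m"]] by simp
    qed
    also have "\<dots> = (\<Sum>S\<in>Pow V. \<Sum>m\<le>?N. valf m (a m) S * valf (?N - m) (b (?N - m)) (V - S) * Om S (V - S))"
      unfolding conv_def by (rule sum.swap)
    also have "\<dots> = (\<Sum>S\<in>Pow V. tot a S * tot b (V - S) * Om S (V - S))"
    proof (intro sum.cong refl)
      fix S assume "S \<in> Pow V"
      then have S: "S \<subseteq> V" "finite S" using True finite_subset by auto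
      then have cS: "card S \<le> ?N" "card (V - S) = ?N - card S" using True by (auto simp: card_mono card_Diff_subset)
      have "(\<Sum>m\<le>?N. valf m (a m) S * valf (?N - m) (b (?N - m)) (V - S) * Om S (V - S)) =
          (\<Sum>m\<le>?N. if m = card S then tot a S * tot b (V - S) * Om S (V - S) else 0)"
        by (intro sum.cong refl) (simp add: tot_valf[OF a] tot_valf[OF b] cS(2))
      then show "(\<Sum>m\<le>?N. valf m (a m) S * valf (?N - m) (b (?N - m)) (V - S) * Om S (V - S)) =
          tot a S * tot b (V - S) * Om S (V - S)" using cS(1) by simp
    qed
    finally show ?thesis by (simp add: conv_def)
  qed
qed

section \<open>The ring and algebra axioms\<close>

lemma carrier_iff: "a \<in> carrier A_algebra \<longleftrightarrow> finite {n. a n \<noteq> 0} \<and> (\<forall>n. a n \<in> A_space n)"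
  by (simp add: A_algebra_def)

lemma A_algebra_ops:
  "a \<otimes>\<^bsub>A_algebra\<^esub> b = (\<lambda>N. \<Sum>m\<le>N. star m (N - m) (a m) (b (N - m)))"
  "\<one>\<^bsub>A_algebra\<^esub> = (\<lambda>n. if n = 0 then 1 else 0)"
  "\<zero>\<^bsub>A_algebra\<^esub> = (\<lambda>n. 0)"
  "a \<oplus>\<^bsub>A_algebra\<^esub> b = (\<lambda>n. a n + b n)"
  "c \<odot>\<^bsub>A_algebra\<^esub> a = (\<lambda>n. scale c (a n))"
  by (simp_all add: A_algebra_def)

lemma A_mult_closed:
  assumes "a \<in> carrier A_algebra" "b \<in> carrier A_algebra"
  shows "a \<otimes>\<^bsub>A_algebra\<^esub> b \<in> carrier A_algebra"
proof -
  have a: "finite {n. a n \<noteq> 0}" "\<And>n. a n \<in> A_space n" and b: "finite {n. b n \<noteq> 0}" "\<And>n. b n \<in> A_space n"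
    using assms by (auto simp: carrier_iff)
  have "{N. (\<Sum>m\<le>N. star m (N - m) (a m) (b (N - m))) \<noteq> 0} \<subseteq>
      (\<lambda>(m, n). m + n) ` ({n. a n \<noteq> 0} \<times> {n. b n \<noteq> 0})"
  proof
    fix N assume "N \<in> {N. (\<Sum>m\<le>N. star m (N - m) (a m) (b (N - m))) \<noteq> 0}"
    then obtain m where m: "m \<le> N" "star m (N - m) (a m) (b (N - m)) \<noteq> 0"
      by (auto elim: sum.not_neutral_contains_not_neutral)
    then have "a m \<noteq> 0" "b (N - m) \<noteq> 0" using star_zero by metis+
    then show "N \<in> (\<lambda>(m, n). m + n) ` ({n. a n \<noteq> 0} \<times> {n. b n \<noteq> 0})"
      using m(1) by (intro image_eqI[of _ _ "(m, N - m)"]) auto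
  qed
  moreover have "star m (N - m) (a m) (b (N - m)) \<in> A_space N" if "m \<le> N" for m N
    using star_closed[OF a(2)[of m] b(2)[of "N - m"]] that by simp
  ultimately show ?thesis
    unfolding carrier_iff A_algebra_ops using a(1) b(1)
    by (auto intro: finite_subset A_space_sum)
qed

lemma A_one_closed: "\<one>\<^bsub>A_algebra\<^esub> \<in> carrier A_algebra"
proof -
  have "(1 :: ratf) \<in> A_space 0" unfolding A_space_def using const_1 by (auto intro: range_eqI[of _ _ 1])
  then show ?thesis by (auto simp: carrier_iff A_algebra_ops A_space_zero)
qed

lemma A_add_closed:
  assumes "a \<in> carrier A_algebra" "b \<in> carrier A_algebra"
  shows "a \<oplus>\<^bsub>A_algebra\<^esub> b \<in> carrier A_algebra"
proof -
  have "{n. a n + b n \<noteq> 0} \<subseteq> {n. a n \<noteq> 0} \<union> {n. b n \<noteq> 0}" by auto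
  then show ?thesis using assms
    by (auto simp: carrier_iff A_algebra_ops A_space_add intro: finite_subset)
qed

lemma A_smult_closed:
  assumes "a \<in> carrier A_algebra"
  shows "c \<odot>\<^bsub>A_algebra\<^esub> a \<in> carrier A_algebra"
proof -
  have "{n. scale c (a n) \<noteq> 0} \<subseteq> {n. a n \<noteq> 0}" by auto
  then show ?thesis using assms
    by (auto simp: carrier_iff A_algebra_ops A_space_scale intro: finite_subset)
qed

lemma tot_ops:
  assumes "a \<in> carrier A_algebra" "b \<in> carrier A_algebra"
  shows "tot (a \<otimes>\<^bsub>A_algebra\<^esub> b) = conv (tot a) (tot b)"
    and "tot (a \<oplus>\<^bsub>A_algebra\<^esub> b) = (\<lambda>V. tot a V + tot b V)"
proof -
  have a: "\<And>n. a n \<in> A_space n" and b: "\<And>n. b n \<in> A_space n" using assms by (auto simp: carrier_iff)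
  show "tot (a \<otimes>\<^bsub>A_algebra\<^esub> b) = conv (tot a) (tot b)" unfolding A_algebra_ops by (rule tot_mult[OF a b])
  show "tot (a \<oplus>\<^bsub>A_algebra\<^esub> b) = (\<lambda>V. tot a V + tot b V)"
    unfolding A_algebra_ops tot_def by (simp add: valf_add a b)
qed

lemma tot_smult:
  assumes "a \<in> carrier A_algebra"
  shows "tot (c \<odot>\<^bsub>A_algebra\<^esub> a) = (\<lambda>V. c * tot a V)"
  using assms unfolding A_algebra_ops(5) tot_def by (simp add: valf_scale carrier_iff)

lemma tot_one: "tot \<one>\<^bsub>A_algebra\<^esub> = en 0"
proof
  fix V
  have "val 0 1 (en 0)"
    using id.has_value_const[of _ 1] by (simp add: val_def supp_en const_1 en_def pp_def)
  then have "valf 0 1 = en 0" using valf_eq by fastforce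
  moreover have "en 0 V = 0" if "card V \<noteq> 0" using that by (simp add: en_def)
  ultimately show "tot \<one>\<^bsub>A_algebra\<^esub> V = en 0 V" by (auto simp: tot_def A_algebra_ops valf_zero)
qed

text \<open>Reduces ring axioms to identities of \<open>conv\<close>, where neither degrees nor
  normalising factors occur.\<close>

lemma carrier_eqI:
  assumes "a \<in> carrier A_algebra" "b \<in> carrier A_algebra" "tot a = tot b"
  shows "a = b"
  using assms tot_inj by (auto simp: carrier_iff)

lemma conv_add_left: "conv (\<lambda>V. F V + G V) H = (\<lambda>V. conv F H V + conv G H V)"
  by (simp add: conv_def distrib_right sum.distrib fun_eq_iff)

lemma conv_scale_left: "conv (\<lambda>V. c * F V) G = (\<lambda>V. c * conv F G V)"
  using conv_scale[of c F 1 G] by simp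

lemma A_mult_commute:
  assumes "a \<in> carrier A_algebra" "b \<in> carrier A_algebra"
  shows "a \<otimes>\<^bsub>A_algebra\<^esub> b = b \<otimes>\<^bsub>A_algebra\<^esub> a"
  unfolding A_algebra_ops
proof
  fix N
  have "(\<Sum>m\<le>N. star m (N - m) (a m) (b (N - m))) = (\<Sum>m\<le>N. star (N - m) m (a (N - m)) (b m))"
    by (rule sum.reindex_bij_witness[where i = "\<lambda>m. N - m" and j = "\<lambda>m. N - m"]) auto
  also have "\<dots> = (\<Sum>m\<le>N. star m (N - m) (b m) (a (N - m)))"
    using assms by (intro sum.cong refl star_commute) (auto simp: carrier_iff)
  finally show "(\<Sum>m\<le>N. star m (N - m) (a m) (b (N - m))) = (\<Sum>m\<le>N. star m (N - m) (b m) (a (N - m)))" .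
qed

lemma A_cring: "cring A_algebra"
proof (rule cringI)
  have zero: "\<zero>\<^bsub>A_algebra\<^esub> \<in> carrier A_algebra" by (simp add: carrier_iff A_algebra_ops A_space_zero)
  show "abelian_group A_algebra"
  proof (rule abelian_groupI)
    fix a assume a: "a \<in> carrier A_algebra"
    show "\<exists>b\<in>carrier A_algebra. b \<oplus>\<^bsub>A_algebra\<^esub> a = \<zero>\<^bsub>A_algebra\<^esub>"
      by (rule bexI[OF _ A_smult_closed[OF a, of "-1"]])
        (simp add: A_algebra_ops)
  qed (auto simp: zero A_add_closed, auto simp: A_algebra_ops add_ac)
  have inf: "tot a V = 0" if "a \<in> carrier A_algebra" "infinite V" for a V
    by (rule tot_infinite) (use that in \<open>auto simp: carrier_iff\<close>)
  show "Group.comm_monoid A_algebra"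
  proof (rule comm_monoidI)
    fix a b c assume abc: "a \<in> carrier A_algebra" "b \<in> carrier A_algebra" "c \<in> carrier A_algebra"
    show "a \<otimes>\<^bsub>A_algebra\<^esub> b \<otimes>\<^bsub>A_algebra\<^esub> c = a \<otimes>\<^bsub>A_algebra\<^esub> (b \<otimes>\<^bsub>A_algebra\<^esub> c)"
      by (rule carrier_eqI) (simp_all add: abc A_mult_closed tot_ops conv_assoc)
    show "a \<otimes>\<^bsub>A_algebra\<^esub> b = b \<otimes>\<^bsub>A_algebra\<^esub> a" using abc by (intro A_mult_commute)
    show "\<one>\<^bsub>A_algebra\<^esub> \<otimes>\<^bsub>A_algebra\<^esub> a = a"
      by (rule carrier_eqI)
        (simp_all add: abc A_mult_closed A_one_closed tot_ops tot_one conv_en_0 inf)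
  qed (simp_all add: A_mult_closed A_one_closed)
  fix a b c assume abc: "a \<in> carrier A_algebra" "b \<in> carrier A_algebra" "c \<in> carrier A_algebra"
  show "(a \<oplus>\<^bsub>A_algebra\<^esub> b) \<otimes>\<^bsub>A_algebra\<^esub> c = a \<otimes>\<^bsub>A_algebra\<^esub> c \<oplus>\<^bsub>A_algebra\<^esub> b \<otimes>\<^bsub>A_algebra\<^esub> c"
    by (rule carrier_eqI) (simp_all add: abc A_mult_closed A_add_closed tot_ops conv_add_left)
qed

text \<open>The locale \<open>algebra\<close> asks for a commutative ring with unit, so
  associativity, the unit and commutativity of the star product are all contained here.\<close>

lemma A_algebra_algebra: "algebra (ring_of_type_algebra :: coef ring) A_algebra"
proof (rule algebraI)
  show "cring (ring_of_type_algebra :: coef ring)" by (rule cring_from_type_algebra)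
  show "cring A_algebra" by (rule A_cring)
  fix c x y assume x: "x \<in> carrier A_algebra" and y: "y \<in> carrier A_algebra"
  show "c \<odot>\<^bsub>A_algebra\<^esub> x \<otimes>\<^bsub>A_algebra\<^esub> y = c \<odot>\<^bsub>A_algebra\<^esub> (x \<otimes>\<^bsub>A_algebra\<^esub> y)"
    by (rule carrier_eqI)
      (simp_all add: x y A_mult_closed A_smult_closed tot_ops tot_smult conv_scale_left)
qed (simp_all add: A_smult_closed, simp_all add: A_algebra_ops ring_of_type_algebra_def
    ratf.scale_left_distrib ratf.scale_right_distrib)

theorem theorem1p5:
  shows "(\<forall>n. ratf.subspace (A_space n)) \<and>
    (\<forall>m n. \<forall>f\<in>A_space m. \<forall>g\<in>A_space n. star m n f g \<in> A_space (m + n)) \<and>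
    algebra (ring_of_type_algebra :: coef ring) A_algebra \<and>
    (\<lambda>m. inverse (1 - fps_X ^ Suc m) :: rat fps) has_prod
      Abs_fps (\<lambda>n. of_nat (ratf.dim (A_space n)))"
  using A_space_subspace star_closed A_algebra_algebra Poincare_series by (simp add: dim_A_space)

end
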